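(* If $(\mathcal{C},\mathcal{E}',\mathcal{E})$ is an $n$-IT category, then $$\mathrm{fpd}_{\mathcal{E}}(\mathcal{C})\leq n+1+\Psi_{\mathcal{E}}\mathrm{dim}(\mathcal{P}(\mathcal{E}'))<\infty.$$
   Context: Exact categories: $(\mathcal{C},\mathcal{E})$ is an exact category in the sense of Quillen: $\mathcal{C}$ is additive and $\mathcal{E}$ is a class of kernel-cokernel pairs (short $\mathcal{E}$-exact sequences) $A'\rightarrowtail A\twoheadrightarrow A''$ satisfying the usual axioms; the second maps are the admissible epics. An object $P$ is $\mathcal{E}$-projective if $\mathrm{Hom}_{\mathcal{C}}(P,-)$ takes short $\mathcal{E}$-exact sequences to short exact sequences; $\mathcal{P}(\mathcal{E})$ is the class of these. Enough $\mathcal{E}$-projectives: every $C$ admits an admissible epic $P\twoheadrightarrow C$ with $P\in\mathcal{P}(\mathcal{E})$. $\mathrm{Ext}^n_{\mathcal{E}}(C,B)$ is the $n$-th cohomology of $\mathrm{Hom}_{\mathcal{C}}(P_\bullet(C),B)$, with $P_\bullet(C)$ an $\mathcal{E}$-projective resolution of $C$ (spliced from short $\mathcal{E}$-exact sequences), and $\mathrm{pd}_{\mathcal{E}}(C)=\min\{n\in\mathbb{N}: \mathrm{Ext}^j_{\mathcal{E}}(C,Z)=0\ \forall j>n,\ \forall Z\in\mathcal{C}\}$ ($\infty$ if none). For a class $\mathcal{Y}$, $\mathrm{fpd}_{\mathcal{E}}(\mathcal{Y})=\sup\{\mathrm{pd}_{\mathcal{E}}(Y): Y\in\mathcal{Y},\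 \mathrm{pd}_{\mathcal{E}}(Y)<\infty\}$. IT-contexts: an exact IT-context is a skeletally small exact category $(\mathcal{C},\mathcal{E})$ with enough $\mathcal{E}$-projectives which is Krull-Schmidt (each object is a finite direct sum of objects with local endomorphism ring). A strong triple IT-context is a triple $(\mathcal{C},\mathcal{E}',\mathcal{E})$ such that $(\mathcal{C},\mathcal{E}')$ and $(\mathcal{C},\mathcal{E})$ are exact IT-contexts, $\mathcal{E}'\subseteq\mathcal{E}$, and $\mathcal{C}$ satisfies Fitting's property: for any $X\in\mathcal{C}$ and $f\in\mathrm{End}_{\mathcal{C}}(X)$ there is a decomposition $X=Y\oplus Z$ with $f=\begin{pmatrix}\theta&0\\0&\alpha\end{pmatrix}$, $\theta:Y\to Y$ an automorphism and $\alpha:Z\to Z$ nilpotent. Igusa-Todorov functions: the stable category $\underline{\mathcal{C}}$ has the objects of $\mathcal{C}$, and its morphisms are those of $\mathcal{C}$ modulo morphisms factoring through an object of $\mathcal{P}(\mathcal{E})$. An $\mathcal{E}$-syzygy $\Omega_{\mathcal{E}}(M)$ is an object $K$ in a short $\mathcal{E}$-exact sequence $K\rightarrowtail P\twoheadrightarrow M$ with $P\in\mathcal{P}(\mathcal{E})$; it is unique up to isomorphism in $\underline{\mathcal{C}}$ and $\Omega_{\mathcal{E}}$ is an additive endofunctor of $\underline{\mathcal{C}}$ with iterates $\Omega^n_{\mathcal{E}}$ ($\Omega^0_{\mathcal{E}}(M)=M$). $K_{\mathcal{E}}(\mathcal{C})$ is the free abelian group on isoclasses $[M]$ of objects of $\mathcal{C}$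 modulo $[N]-[S]-[T]$ when $N\cong S\oplus T$, and $[P]$ for $P\in\mathcal{P}(\mathcal{E})$; $\Omega_{\mathcal{E}}$ induces the endomorphism $[M]\mapsto[\Omega_{\mathcal{E}}(M)]$. $\langle M\rangle$ is the subgroup generated by the classes of the indecomposable direct summands of $M$ in $\underline{\mathcal{C}}$. Then $\Phi_{\mathcal{E}}(M)=\min\{k\in\mathbb{N}:\ \Omega_{\mathcal{E}}$ restricts to an isomorphism $\Omega^m_{\mathcal{E}}(\langle M\rangle)\to\Omega^{m+1}_{\mathcal{E}}(\langle M\rangle)$ for all $m\ge k\}$, $\Psi_{\mathcal{E}}(M)=\Phi_{\mathcal{E}}(M)+\mathrm{fpd}_{\mathcal{E}}(\mathrm{add}(\Omega_{\mathcal{E}}^{\Phi_{\mathcal{E}}(M)}(M)))$, where $\mathrm{add}(X)$ is the class of direct summands of finite direct sums of copies of $X$, and $\Psi_{\mathcal{E}}\mathrm{dim}(\mathcal{Y})=\sup_{Y\in\mathcal{Y}}\Psi_{\mathcal{E}}(Y)$. For $n\in\mathbb{N}$, an $n$-IT category is a strong triple IT-context $(\mathcal{C},\mathcal{E}',\mathcal{E})$ such that: (a) for any $M\in\mathcal{C}$ there is an $\mathcal{E}$-exact sequence $V_1\rightarrowtail V_0\twoheadrightarrow\Omega^n_{\mathcal{E}}(M)\oplus P$ with $V_1,V_0\in\mathcal{P}(\mathcal{E}')$ and $P\in\mathcal{P}(\mathcal{E})$; and (b) $\Psi_{\mathcal{E}}\mathrm{dim}(\mathcal{P}(\mathcal{E}'))$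 is finite. *)

theory Defs
  imports "HOL-Algebra.Exact_Sequence" "HOL-Algebra.Free_Abelian_Groups" "HOL-Algebra.Ideal"
    "HOL-Algebra.Generated_Groups" "HOL-Library.Extended_Nat"
begin

section \<open>Preadditive and additive categories\<close>

text \<open>
  Hom groups are groups in the sense of \<^theory>\<open>HOL-Algebra.Group\<close>, hence written multiplicatively:
  \<open>f \<otimes> g\<close> in \<open>Hom C X Y\<close> is the sum of two parallel morphisms and \<open>\<one>\<close> is the
  zero morphism. The objects form a set, so every category here is small, and skeletal smallness
  needs no axiom of its own.
\<close>

record ('o, 'm) precategory =
  Obj :: "'o set"
  Hom :: "'o \<Rightarrow> 'o \<Rightarrow> 'm monoid"
  Cmp :: "'m \<Rightarrow> 'm \<Rightarrow> 'm"  (infixl \<open>\<cdot>\<index>\<close> 75)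
  Idn :: "'o \<Rightarrow> 'm"

abbreviation mor :: "('o, 'm) precategory \<Rightarrow> 'o \<Rightarrow> 'o \<Rightarrow> 'm set" where
  "mor C X Y \<equiv> carrier (Hom C X Y)"

abbreviation zmor :: "('o, 'm) precategory \<Rightarrow> 'o \<Rightarrow> 'o \<Rightarrow> 'm" where
  "zmor C X Y \<equiv> \<one>\<^bsub>Hom C X Y\<^esub>"

locale preadditive_category =
  fixes C :: "('o, 'm) precategory" (structure)
  assumes Hom_comm_group: "\<lbrakk>X \<in> Obj C; Y \<in> Obj C\<rbrakk> \<Longrightarrow> comm_group (Hom C X Y)"
    and Hom_disjoint: "\<lbrakk>X \<in> Obj C; Y \<in> Obj C; X' \<in> Obj C; Y' \<in> Obj C;
          f \<in> mor C X Y; f \<in> mor C X' Y'\<rbrakk> \<Longrightarrow> X = X' \<and> Y = Y'"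
    and Cmp_closed: "\<lbrakk>X \<in> Obj C; Y \<in> Obj C; Z \<in> Obj C; f \<in> mor C X Y; g \<in> mor C Y Z\<rbrakk>
          \<Longrightarrow> g \<cdot> f \<in> mor C X Z"
    and Cmp_assoc: "\<lbrakk>W \<in> Obj C; X \<in> Obj C; Y \<in> Obj C; Z \<in> Obj C;
          f \<in> mor C W X; g \<in> mor C X Y; h \<in> mor C Y Z\<rbrakk> \<Longrightarrow> h \<cdot> g \<cdot> f = h \<cdot> (g \<cdot> f)"
    and Idn_closed: "X \<in> Obj C \<Longrightarrow> Idn C X \<in> mor C X X"
    and Idn_right: "\<lbrakk>X \<in> Obj C; Y \<in> Obj C; f \<in> mor C X Y\<rbrakk> \<Longrightarrow> f \<cdot> Idn C X = f"
    and Idn_left: "\<lbrakk>X \<in> Obj C; Y \<in> Obj C; f \<in> mor C X Y\<rbrakk> \<Longrightarrow> Idn C Y \<cdot> f = f"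
    and Cmp_add_right: "\<lbrakk>X \<in> Obj C; Y \<in> Obj C; Z \<in> Obj C;
          f \<in> mor C X Y; f' \<in> mor C X Y; g \<in> mor C Y Z\<rbrakk>
          \<Longrightarrow> g \<cdot> (f \<otimes>\<^bsub>Hom C X Y\<^esub> f') = (g \<cdot> f) \<otimes>\<^bsub>Hom C X Z\<^esub> (g \<cdot> f')"
    and Cmp_add_left: "\<lbrakk>X \<in> Obj C; Y \<in> Obj C; Z \<in> Obj C;
          f \<in> mor C X Y; g \<in> mor C Y Z; g' \<in> mor C Y Z\<rbrakk>
          \<Longrightarrow> (g \<otimes>\<^bsub>Hom C Y Z\<^esub> g') \<cdot> f = (g \<cdot> f) \<otimes>\<^bsub>Hom C X Z\<^esub> (g' \<cdot> f)"

definition iso_mor :: "('o, 'm) precategory \<Rightarrow> 'o \<Rightarrow> 'o \<Rightarrow> 'm \<Rightarrow> bool" where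
  "iso_mor C X Y f \<longleftrightarrow> f \<in> mor C X Y \<and>
     (\<exists>g \<in> mor C Y X. g \<cdot>\<^bsub>C\<^esub> f = Idn C X \<and> f \<cdot>\<^bsub>C\<^esub> g = Idn C Y)"

definition isomorphic :: "('o, 'm) precategory \<Rightarrow> 'o \<Rightarrow> 'o \<Rightarrow> bool" where
  "isomorphic C X Y \<longleftrightarrow> (\<exists>f. iso_mor C X Y f)"

definition zero_object :: "('o, 'm) precategory \<Rightarrow> 'o \<Rightarrow> bool" where
  "zero_object C Z \<longleftrightarrow> Z \<in> Obj C \<and>
     (\<forall>Y \<in> Obj C. (\<exists>!f. f \<in> mor C Z Y) \<and> (\<exists>!f. f \<in> mor C Y Z))"

text \<open>\<open>X\<close> is the biproduct of the family \<open>Xs\<close>, with injections \<open>\<iota>\<close> and projections \<open>\<pi>\<close>; the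
  \<^const>\<open>finprod\<close> is the sum \<open>\<Sum>\<^sub>k \<iota>\<^sub>k \<pi>\<^sub>k\<close> in the additive group of endomorphisms of \<open>X\<close>.\<close>

definition biproduct ::
  "('o, 'm) precategory \<Rightarrow> 'o \<Rightarrow> 'o list \<Rightarrow> (nat \<Rightarrow> 'm) \<Rightarrow> (nat \<Rightarrow> 'm) \<Rightarrow> bool" where
  "biproduct C X Xs \<iota> \<pi> \<longleftrightarrow> X \<in> Obj C \<and> set Xs \<subseteq> Obj C \<and>
     (\<forall>k < length Xs. \<iota> k \<in> mor C (Xs ! k) X \<and> \<pi> k \<in> mor C X (Xs ! k)) \<and>
     (\<forall>j < length Xs. \<forall>k < length Xs.
        \<pi> j \<cdot>\<^bsub>C\<^esub> \<iota> k = (if j = k then Idn C (Xs ! k) else zmor C (Xs ! k) (Xs ! j))) \<and>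
     finprod (Hom C X X) (\<lambda>k. \<iota> k \<cdot>\<^bsub>C\<^esub> \<pi> k) {..<length Xs} = Idn C X"

definition direct_sum :: "('o, 'm) precategory \<Rightarrow> 'o \<Rightarrow> 'o list \<Rightarrow> bool" where
  "direct_sum C X Xs \<longleftrightarrow> (\<exists>\<iota> \<pi>. biproduct C X Xs \<iota> \<pi>)"

definition direct_summand :: "('o, 'm) precategory \<Rightarrow> 'o \<Rightarrow> 'o \<Rightarrow> bool" where
  "direct_summand C Y X \<longleftrightarrow> (\<exists>Z. direct_sum C X [Y, Z])"

definition indecomposable :: "('o, 'm) precategory \<Rightarrow> 'o \<Rightarrow> bool" where
  "indecomposable C X \<longleftrightarrow> X \<in> Obj C \<and> \<not> zero_object C X \<and>
     (\<forall>Y Z. direct_sum C X [Y, Z] \<longrightarrow> zero_object C Y \<or> zero_object C Z)"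

definition add_closure :: "('o, 'm) precategory \<Rightarrow> 'o \<Rightarrow> 'o set" where
  "add_closure C X = {Y. \<exists>k S. direct_sum C S (replicate k X) \<and> direct_summand C Y S}"

locale additive_category = preadditive_category +
  assumes ex_zero_object: "\<exists>Z. zero_object C Z"
    and ex_direct_sum: "\<lbrakk>X \<in> Obj C; Y \<in> Obj C\<rbrakk> \<Longrightarrow> \<exists>S. direct_sum C S [X, Y]"


section \<open>Exact categories\<close>

definition is_kernel :: "('o, 'm) precategory \<Rightarrow> 'o \<Rightarrow> 'm \<Rightarrow> 'o \<Rightarrow> 'm \<Rightarrow> 'o \<Rightarrow> bool" where
  "is_kernel C A i B p D \<longleftrightarrow> i \<in> mor C A B \<and> p \<in> mor C B D \<and> p \<cdot>\<^bsub>C\<^esub> i = zmor C A D \<and>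
     (\<forall>T \<in> Obj C. \<forall>t \<in> mor C T B. p \<cdot>\<^bsub>C\<^esub> t = zmor C T D \<longrightarrow>
        (\<exists>!u. u \<in> mor C T A \<and> i \<cdot>\<^bsub>C\<^esub> u = t))"

definition is_cokernel :: "('o, 'm) precategory \<Rightarrow> 'o \<Rightarrow> 'm \<Rightarrow> 'o \<Rightarrow> 'm \<Rightarrow> 'o \<Rightarrow> bool" where
  "is_cokernel C A i B p D \<longleftrightarrow> i \<in> mor C A B \<and> p \<in> mor C B D \<and> p \<cdot>\<^bsub>C\<^esub> i = zmor C A D \<and>
     (\<forall>T \<in> Obj C. \<forall>t \<in> mor C B T. t \<cdot>\<^bsub>C\<^esub> i = zmor C A T \<longrightarrow>
        (\<exists>!u. u \<in> mor C D T \<and> u \<cdot>\<^bsub>C\<^esub> p = t))"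

text \<open>A candidate exact structure is a set \<open>E\<close> of pairs \<open>(i, p)\<close> of composable morphisms; since
  the Hom sets are disjoint, such a pair determines the three objects involved.\<close>

definition ses ::
  "('o, 'm) precategory \<Rightarrow> ('m \<times> 'm) set \<Rightarrow> 'o \<Rightarrow> 'm \<Rightarrow> 'o \<Rightarrow> 'm \<Rightarrow> 'o \<Rightarrow> bool" where
  "ses C E A i B p D \<longleftrightarrow> A \<in> Obj C \<and> B \<in> Obj C \<and> D \<in> Obj C \<and>
     i \<in> mor C A B \<and> p \<in> mor C B D \<and> (i, p) \<in> E"

definition adm_monic :: "('o, 'm) precategory \<Rightarrow> ('m \<times> 'm) set \<Rightarrow> 'o \<Rightarrow> 'o \<Rightarrow> 'm \<Rightarrow> bool" where
  "adm_monic C E A B i \<longleftrightarrow> (\<exists>p D. ses C E A i B p D)"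

definition adm_epic :: "('o, 'm) precategory \<Rightarrow> ('m \<times> 'm) set \<Rightarrow> 'o \<Rightarrow> 'o \<Rightarrow> 'm \<Rightarrow> bool" where
  "adm_epic C E B D p \<longleftrightarrow> (\<exists>i A. ses C E A i B p D)"

text \<open>The square \<open>f' \<cdot> i = i' \<cdot> f\<close>, with \<open>i : A \<rightarrow> B\<close>, \<open>f : A \<rightarrow> A'\<close>, \<open>f' : B \<rightarrow> B'\<close>,
  \<open>i' : A' \<rightarrow> B'\<close>, is a pushout.\<close>

definition is_pushout :: "('o, 'm) precategory \<Rightarrow> 'o \<Rightarrow> 'o \<Rightarrow> 'o \<Rightarrow> 'o \<Rightarrow>
    'm \<Rightarrow> 'm \<Rightarrow> 'm \<Rightarrow> 'm \<Rightarrow> bool" where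
  "is_pushout C A B A' B' i f f' i' \<longleftrightarrow>
     i \<in> mor C A B \<and> f \<in> mor C A A' \<and> f' \<in> mor C B B' \<and> i' \<in> mor C A' B' \<and>
     f' \<cdot>\<^bsub>C\<^esub> i = i' \<cdot>\<^bsub>C\<^esub> f \<and>
     (\<forall>T \<in> Obj C. \<forall>u \<in> mor C B T. \<forall>v \<in> mor C A' T. u \<cdot>\<^bsub>C\<^esub> i = v \<cdot>\<^bsub>C\<^esub> f \<longrightarrow>
        (\<exists>!w. w \<in> mor C B' T \<and> w \<cdot>\<^bsub>C\<^esub> f' = u \<and> w \<cdot>\<^bsub>C\<^esub> i' = v))"

text \<open>The square \<open>p \<cdot> f' = f \<cdot> p'\<close>, with \<open>p : B \<rightarrow> D\<close>, \<open>f : D' \<rightarrow> D\<close>, \<open>f' : B' \<rightarrow> B\<close>,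
  \<open>p' : B' \<rightarrow> D'\<close>, is a pullback.\<close>

definition is_pullback :: "('o, 'm) precategory \<Rightarrow> 'o \<Rightarrow> 'o \<Rightarrow> 'o \<Rightarrow> 'o \<Rightarrow>
    'm \<Rightarrow> 'm \<Rightarrow> 'm \<Rightarrow> 'm \<Rightarrow> bool" where
  "is_pullback C B D B' D' p f f' p' \<longleftrightarrow>
     p \<in> mor C B D \<and> f \<in> mor C D' D \<and> f' \<in> mor C B' B \<and> p' \<in> mor C B' D' \<and>
     p \<cdot>\<^bsub>C\<^esub> f' = f \<cdot>\<^bsub>C\<^esub> p' \<and>
     (\<forall>T \<in> Obj C. \<forall>u \<in> mor C T B. \<forall>v \<in> mor C T D'. p \<cdot>\<^bsub>C\<^esub> u = f \<cdot>\<^bsub>C\<^esub> v \<longrightarrow>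
        (\<exists>!w. w \<in> mor C T B' \<and> f' \<cdot>\<^bsub>C\<^esub> w = u \<and> p' \<cdot>\<^bsub>C\<^esub> w = v))"

text \<open>The axioms are those of Buehler's survey ``Exact categories''.\<close>

locale exact_category = additive_category C for C :: "('o, 'm) precategory" (structure) +
  fixes E :: "('m \<times> 'm) set"
  assumes kernel_cokernel_pairs: "(i, p) \<in> E \<Longrightarrow>
        \<exists>A \<in> Obj C. \<exists>B \<in> Obj C. \<exists>D \<in> Obj C. is_kernel C A i B p D \<and> is_cokernel C A i B p D"
    and iso_closed: "\<lbrakk>ses C E A i B p D; A' \<in> Obj C; B' \<in> Obj C; D' \<in> Obj C;
        i' \<in> mor C A' B'; p' \<in> mor C B' D';
        iso_mor C A A' a; iso_mor C B B' b; iso_mor C D D' d;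
        b \<cdot> i = i' \<cdot> a; d \<cdot> p = p' \<cdot> b\<rbrakk> \<Longrightarrow> (i', p') \<in> E"
    and Idn_adm_monic: "X \<in> Obj C \<Longrightarrow> adm_monic C E X X (Idn C X)"
    and Idn_adm_epic: "X \<in> Obj C \<Longrightarrow> adm_epic C E X X (Idn C X)"
    and adm_monic_Cmp: "\<lbrakk>adm_monic C E X Y f; adm_monic C E Y Z g\<rbrakk> \<Longrightarrow> adm_monic C E X Z (g \<cdot> f)"
    and adm_epic_Cmp: "\<lbrakk>adm_epic C E X Y f; adm_epic C E Y Z g\<rbrakk> \<Longrightarrow> adm_epic C E X Z (g \<cdot> f)"
    and ex_pushout: "\<lbrakk>adm_monic C E A B i; A' \<in> Obj C; f \<in> mor C A A'\<rbrakk> \<Longrightarrow>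
        \<exists>B' \<in> Obj C. \<exists>f' i'. is_pushout C A B A' B' i f f' i' \<and> adm_monic C E A' B' i'"
    and ex_pullback: "\<lbrakk>adm_epic C E B D p; D' \<in> Obj C; f \<in> mor C D' D\<rbrakk> \<Longrightarrow>
        \<exists>B' \<in> Obj C. \<exists>f' p'. is_pullback C B D B' D' p f f' p' \<and> adm_epic C E B' D' p'"


section \<open>Projectives, Ext and projective dimension\<close>

text \<open>\<^const>\<open>short_exact_sequence\<close> lists its groups from right to left, i.e. target first.\<close>

definition projectives :: "('o, 'm) precategory \<Rightarrow> ('m \<times> 'm) set \<Rightarrow> 'o set" where
  "projectives C E = {P \<in> Obj C. \<forall>A i B p D. ses C E A i B p D \<longrightarrow>
     short_exact_sequence (Hom C P D) (Hom C P B) (Hom C P A) (\<lambda>t. p \<cdot>\<^bsub>C\<^esub> t) (\<lambda>t. i \<cdot>\<^bsub>C\<^esub> t)}"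

definition enough_projectives :: "('o, 'm) precategory \<Rightarrow> ('m \<times> 'm) set \<Rightarrow> bool" where
  "enough_projectives C E \<longleftrightarrow>
     (\<forall>X \<in> Obj C. \<exists>P \<in> projectives C E. \<exists>p. adm_epic C E P X p)"

text \<open>The resolution \<open>\<dots> \<rightarrow> P 1 \<rightarrow> P 0 \<rightarrow> X\<close> with differentials \<open>d n : P (n + 1) \<rightarrow> P n\<close> is spliced
  from the short exact sequences \<open>K (n + 1) \<rightarrow> P n \<rightarrow> K n\<close>, \<open>K 0 = X\<close>.\<close>

definition proj_resolution ::
  "('o, 'm) precategory \<Rightarrow> ('m \<times> 'm) set \<Rightarrow> 'o \<Rightarrow> (nat \<Rightarrow> 'o) \<Rightarrow> (nat \<Rightarrow> 'm) \<Rightarrow> bool" where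
  "proj_resolution C E X P d \<longleftrightarrow> (\<exists>K i p. K 0 = X \<and>
     (\<forall>n. P n \<in> projectives C E \<and> ses C E (K (Suc n)) (i n) (P n) (p n) (K n) \<and>
          d n = i n \<cdot>\<^bsub>C\<^esub> p (Suc n)))"

definition chosen_resolution ::
  "('o, 'm) precategory \<Rightarrow> ('m \<times> 'm) set \<Rightarrow> 'o \<Rightarrow> (nat \<Rightarrow> 'o) \<times> (nat \<Rightarrow> 'm)" where
  "chosen_resolution C E X = (SOME R. proj_resolution C E X (fst R) (snd R))"

fun Hom_coboundaries ::
  "('o, 'm) precategory \<Rightarrow> (nat \<Rightarrow> 'o) \<Rightarrow> (nat \<Rightarrow> 'm) \<Rightarrow> 'o \<Rightarrow> nat \<Rightarrow> 'm set" where
  "Hom_coboundaries C P d B 0 = {zmor C (P 0) B}"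
| "Hom_coboundaries C P d B (Suc n) = (\<lambda>f. f \<cdot>\<^bsub>C\<^esub> d n) ` mor C (P n) B"

definition Hom_cocycles ::
  "('o, 'm) precategory \<Rightarrow> (nat \<Rightarrow> 'o) \<Rightarrow> (nat \<Rightarrow> 'm) \<Rightarrow> 'o \<Rightarrow> nat \<Rightarrow> 'm set" where
  "Hom_cocycles C P d B n = kernel (Hom C (P n) B) (Hom C (P (Suc n)) B) (\<lambda>f. f \<cdot>\<^bsub>C\<^esub> d n)"

definition Hom_cohomology ::
  "('o, 'm) precategory \<Rightarrow> (nat \<Rightarrow> 'o) \<Rightarrow> (nat \<Rightarrow> 'm) \<Rightarrow> 'o \<Rightarrow> nat \<Rightarrow> 'm set monoid" where
  "Hom_cohomology C P d B n =
     (Hom C (P n) B)\<lparr>carrier := Hom_cocycles C P d B n\<rparr> Mod Hom_coboundaries C P d B n"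

definition Ext :: "('o, 'm) precategory \<Rightarrow> ('m \<times> 'm) set \<Rightarrow> nat \<Rightarrow> 'o \<Rightarrow> 'o \<Rightarrow> 'm set monoid" where
  "Ext C E n X B = (let (P, d) = chosen_resolution C E X in Hom_cohomology C P d B n)"

text \<open>In \<^typ>\<open>enat\<close> the infimum of the empty set is \<open>\<infinity>\<close> and the supremum of the empty set is
  \<open>0\<close>.\<close>

definition pd :: "('o, 'm) precategory \<Rightarrow> ('m \<times> 'm) set \<Rightarrow> 'o \<Rightarrow> enat" where
  "pd C E X = Inf {enat n |n. \<forall>j > n. \<forall>Z \<in> Obj C. trivial_group (Ext C E j X Z)}"

definition fpd :: "('o, 'm) precategory \<Rightarrow> ('m \<times> 'm) set \<Rightarrow> 'o set \<Rightarrow> enat" where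
  "fpd C E \<Y> = Sup {pd C E Y |Y. Y \<in> \<Y> \<and> pd C E Y < \<infinity>}"


section \<open>Stable category, syzygies and Igusa--Todorov functions\<close>

definition proj_factoring :: "('o, 'm) precategory \<Rightarrow> ('m \<times> 'm) set \<Rightarrow> 'o \<Rightarrow> 'o \<Rightarrow> 'm set" where
  "proj_factoring C E X Y =
     {b \<cdot>\<^bsub>C\<^esub> a |a b P. P \<in> projectives C E \<and> a \<in> mor C X P \<and> b \<in> mor C P Y}"

text \<open>Morphisms of the stable category are cosets; the union in the composition is a single coset,
  since the morphisms factoring through projectives form a two-sided ideal.\<close>

definition stable_category ::
  "('o, 'm) precategory \<Rightarrow> ('m \<times> 'm) set \<Rightarrow> ('o, 'm set) precategory" where
  "stable_category C E = \<lparr>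
     Obj = Obj C,
     Hom = (\<lambda>X Y. Hom C X Y Mod proj_factoring C E X Y),
     Cmp = (\<lambda>G F. \<Union>{proj_factoring C E X Z #>\<^bsub>Hom C X Z\<^esub> (g \<cdot>\<^bsub>C\<^esub> f) |X Y Z f g.
              X \<in> Obj C \<and> Y \<in> Obj C \<and> Z \<in> Obj C \<and>
              f \<in> F \<inter> mor C X Y \<and> g \<in> G \<inter> mor C Y Z}),
     Idn = (\<lambda>X. proj_factoring C E X X #>\<^bsub>Hom C X X\<^esub> Idn C X)\<rparr>"

definition is_syzygy :: "('o, 'm) precategory \<Rightarrow> ('m \<times> 'm) set \<Rightarrow> 'o \<Rightarrow> 'o \<Rightarrow> bool" where
  "is_syzygy C E K M \<longleftrightarrow> (\<exists>P \<in> projectives C E. \<exists>i p. ses C E K i P p M)"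

text \<open>A syzygy is determined only up to isomorphism in the stable category; as usual one is fixed
  for each object.\<close>

definition syzygy :: "('o, 'm) precategory \<Rightarrow> ('m \<times> 'm) set \<Rightarrow> 'o \<Rightarrow> 'o" where
  "syzygy C E M = (SOME K. is_syzygy C E K M)"

definition isoclass :: "('o, 'm) precategory \<Rightarrow> 'o \<Rightarrow> 'o set" where
  "isoclass C M = {N \<in> Obj C. isomorphic C M N}"

definition K_relations ::
  "('o, 'm) precategory \<Rightarrow> ('m \<times> 'm) set \<Rightarrow> ('o set \<Rightarrow>\<^sub>0 int) set" where
  "K_relations C E =
     {frag_of (isoclass C N) - frag_of (isoclass C S) - frag_of (isoclass C T) |N S T.
        direct_sum C N [S, T]} \<union>
     {frag_of (isoclass C P) |P. P \<in> projectives C E}"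

definition K_subgroup ::
  "('o, 'm) precategory \<Rightarrow> ('m \<times> 'm) set \<Rightarrow> ('o set \<Rightarrow>\<^sub>0 int) set" where
  "K_subgroup C E = generate (free_Abelian_group (isoclass C ` Obj C)) (K_relations C E)"

definition K_group ::
  "('o, 'm) precategory \<Rightarrow> ('m \<times> 'm) set \<Rightarrow> ('o set \<Rightarrow>\<^sub>0 int) set monoid" where
  "K_group C E = free_Abelian_group (isoclass C ` Obj C) Mod K_subgroup C E"

definition K_class ::
  "('o, 'm) precategory \<Rightarrow> ('m \<times> 'm) set \<Rightarrow> 'o \<Rightarrow> ('o set \<Rightarrow>\<^sub>0 int) set" where
  "K_class C E M =
     K_subgroup C E #>\<^bsub>free_Abelian_group (isoclass C ` Obj C)\<^esub> frag_of (isoclass C M)"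

text \<open>The classes \<open>[M]\<close> generate the group, so the endomorphism is unique on its carrier.\<close>

definition K_syzygy :: "('o, 'm) precategory \<Rightarrow> ('m \<times> 'm) set \<Rightarrow>
    ('o set \<Rightarrow>\<^sub>0 int) set \<Rightarrow> ('o set \<Rightarrow>\<^sub>0 int) set" where
  "K_syzygy C E = (SOME L. L \<in> hom (K_group C E) (K_group C E) \<and>
     (\<forall>M \<in> Obj C. L (K_class C E M) = K_class C E (syzygy C E M)))"

definition K_span ::
  "('o, 'm) precategory \<Rightarrow> ('m \<times> 'm) set \<Rightarrow> 'o \<Rightarrow> ('o set \<Rightarrow>\<^sub>0 int) set set" where
  "K_span C E M = generate (K_group C E)
     (K_class C E ` {N. indecomposable (stable_category C E) N \<and>
                        direct_summand (stable_category C E) N M})"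

definition IT_Phi :: "('o, 'm) precategory \<Rightarrow> ('m \<times> 'm) set \<Rightarrow> 'o \<Rightarrow> nat" where
  "IT_Phi C E M = (LEAST k. \<forall>m \<ge> k. K_syzygy C E \<in>
     iso ((K_group C E)\<lparr>carrier := (K_syzygy C E ^^ m) ` K_span C E M\<rparr>)
         ((K_group C E)\<lparr>carrier := (K_syzygy C E ^^ Suc m) ` K_span C E M\<rparr>))"

definition IT_Psi :: "('o, 'm) precategory \<Rightarrow> ('m \<times> 'm) set \<Rightarrow> 'o \<Rightarrow> enat" where
  "IT_Psi C E M =
     enat (IT_Phi C E M) + fpd C E (add_closure C ((syzygy C E ^^ IT_Phi C E M) M))"

definition IT_Psi_dim :: "('o, 'm) precategory \<Rightarrow> ('m \<times> 'm) set \<Rightarrow> 'o set \<Rightarrow> enat" where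
  "IT_Psi_dim C E \<Y> = (SUP Y \<in> \<Y>. IT_Psi C E Y)"


section \<open>IT-contexts\<close>

definition End_ring :: "('o, 'm) precategory \<Rightarrow> 'o \<Rightarrow> 'm ring" where
  "End_ring C X = \<lparr>carrier = mor C X X, monoid.mult = Cmp C, one = Idn C X,
     zero = zmor C X X, add = monoid.mult (Hom C X X)\<rparr>"

text \<open>A (not necessarily commutative) ring is local if its non-units form a two-sided ideal. This
  excludes the zero ring, where the set of non-units is empty.\<close>

definition local_ring :: "('a, 'b) ring_scheme \<Rightarrow> bool" where
  "local_ring R \<longleftrightarrow> ring R \<and> ideal (carrier R - Units R) R"

definition krull_schmidt :: "('o, 'm) precategory \<Rightarrow> bool" where
  "krull_schmidt C \<longleftrightarrow>
     (\<forall>X \<in> Obj C. \<exists>Xs. direct_sum C X Xs \<and> (\<forall>Y \<in> set Xs. local_ring (End_ring C Y)))"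

definition fitting_property :: "('o, 'm) precategory \<Rightarrow> bool" where
  "fitting_property C \<longleftrightarrow> (\<forall>X \<in> Obj C. \<forall>f \<in> mor C X X.
     \<exists>Y Z \<iota> \<pi> \<theta> \<alpha>. biproduct C X [Y, Z] \<iota> \<pi> \<and>
       iso_mor C Y Y \<theta> \<and>
       \<alpha> \<in> mor C Z Z \<and> (\<exists>k::nat. \<alpha> [^]\<^bsub>End_ring C Z\<^esub> k = zmor C Z Z) \<and>
       f = (\<iota> 0 \<cdot>\<^bsub>C\<^esub> \<theta> \<cdot>\<^bsub>C\<^esub> \<pi> 0) \<otimes>\<^bsub>Hom C X X\<^esub> (\<iota> 1 \<cdot>\<^bsub>C\<^esub> \<alpha> \<cdot>\<^bsub>C\<^esub> \<pi> 1))"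

locale exact_IT_context = exact_category +
  assumes enough_projectives: "enough_projectives C E"
    and krull_schmidt: "krull_schmidt C"

locale strong_triple_IT_context =
  E': exact_IT_context C E' + E: exact_IT_context C E
  for C :: "('o, 'm) precategory" (structure) and E' E +
  assumes E'_subset: "E' \<subseteq> E"
    and fitting: "fitting_property C"

locale n_IT_category = strong_triple_IT_context C E' E
  for C :: "('o, 'm) precategory" (structure) and E' E +
  fixes n :: nat
  assumes syzygy_presentation: "M \<in> Obj C \<Longrightarrow>
        \<exists>V\<^sub>1 \<in> projectives C E'. \<exists>V\<^sub>0 \<in> projectives C E'. \<exists>P \<in> projectives C E. \<exists>S i p.
          direct_sum C S [(syzygy C E ^^ n) M, P] \<and> ses C E V\<^sub>1 i V\<^sub>0 p S"
    and IT_Psi_dim_finite: "IT_Psi_dim C E (projectives C E') < \<infinity>"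

end

theory Submission
  imports Defs
begin

text \<open>
Let \<open>(C, E', E)\<close> be an \<open>n\<close>-IT category and let \<open>M\<close> have finite \<open>E\<close>-projective dimension. Passing to
\<open>\<Omega>\<^sup>n M\<close> costs at most \<open>n\<close>, and \<open>\<Omega>\<^sup>n M\<close>, up to a projective summand, ends an \<open>E\<close>-exact sequence
\<open>V\<^sub>1 \<rightarrow> V\<^sub>0 \<rightarrow> S\<close> with \<open>V\<^sub>1, V\<^sub>0\<close> in \<open>\<P>(E')\<close>. So the theorem follows from the Igusa--Todorov inequality
(\<open>Igusa_Todorov_bound\<close>): if \<open>A \<rightarrow> B \<rightarrow> D\<close> is exact and \<open>pd D < \<infinity>\<close>, then
\<open>pd D \<le> \<Psi>(A \<oplus> B) + 1\<close>; here \<open>V\<^sub>1 \<oplus> V\<^sub>0\<close> lies in \<open>\<P>(E')\<close>, so \<open>\<Psi>\<close> of it is at most \<open>\<Psi>dim(\<P>(E'))\<close>.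

For that inequality put \<open>V = A \<oplus> B\<close> and \<open>d = \<Phi>(V)\<close>. When \<open>r \<ge> pd D\<close>, the \<open>r\<close>-th syzygy of \<open>D\<close> is
projective, so \<open>\<Omega>\<^sup>r A\<close> and \<open>\<Omega>\<^sup>r B\<close> are isomorphic in the stable category. The classes \<open>[A]\<close> and \<open>[B]\<close>
lie in \<open>\<langle>V\<rangle>\<close>, and \<open>\<Omega>\<close> is injective on \<open>\<Omega>\<^sup>m\<langle>V\<rangle>\<close> for \<open>m \<ge> d\<close>; therefore already \<open>[\<Omega>\<^sup>d A] = [\<Omega>\<^sup>d B]\<close>, and
equality of classes means stable isomorphism (\<open>kc_stably_isomorphic\<close>, a cancellation argument resting on
local endomorphism rings). That the number \<open>d\<close> exists at all is a Noetherian argument: \<open>\<langle>V\<rangle>\<close> is finitely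
generated, hence the kernels of the powers of \<open>\<Omega>\<close> on it become constant
(\<open>endomorphism_eventually_iso\<close>, \<open>finite_span_generators\<close>).

One is left with an exact sequence \<open>X \<rightarrow> S \<rightarrow> Z\<close> whose first two terms are stably isomorphic and whose third
term has finite projective dimension (\<open>stably_split_extension\<close>). Composing with a retraction \<open>S \<rightarrow> X\<close>
gives an endomorphism of \<open>X\<close>, which by Fitting's property is the sum of an automorphism of a summand \<open>A'\<close> and
a nilpotent endomorphism of a complement \<open>Y\<close>. Dividing the sequence by \<open>A'\<close> leaves \<open>Y \<rightarrow> G \<rightarrow> Z\<close> with
\<open>G\<close> a stable retract of \<open>Y\<close>, so \<open>pd Z \<le> pd Y + 1\<close>. Iterating the monomorphism \<open>X \<rightarrow> S\<close> by
pushouts yields sequences \<open>X \<rightarrow> S\<^sub>m \<rightarrow> Z\<^sub>m\<close> in which \<open>Z\<^sub>m\<close> is an iterated extension of copies of \<open>Z\<close> and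
the component \<open>X \<rightarrow> X\<close> is the \<open>m\<close>-th power; as soon as that power vanishes on \<open>Y\<close>, the object \<open>Y\<close> is a
retract of \<open>Z\<^sub>m\<close>. Hence \<open>pd Y\<close> is finite; and since \<open>Y\<close> is stably a summand of \<open>\<Omega>\<^sup>d V\<close>, \<open>pd Y\<close> is at
most the finitistic dimension that enters \<open>\<Psi>(V)\<close>.

The long exact sequences of Ext are replaced throughout by two facts: taking
syzygies is a functor on the stable category, and a short exact sequence \<open>A \<rightarrow> B \<rightarrow> D\<close> rotates to one \<open>\<Omega>D \<rightarrow> A \<oplus> Q \<rightarrow> B\<close> with
\<open>Q\<close> projective (\<open>rotation\<close>). Ext itself enters only through \<open>pd_le_iff\<close>, which translates \<open>pd M \<le> k\<close> into
``some \<open>k\<close>-th syzygy of \<open>M\<close> is projective''.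
\<close>

section \<open>Morphisms of a preadditive category\<close>

text \<open>The Hom sets determine source and target of a morphism, so the ringoid laws can be stated in terms of the
functions \<open>src\<close> and \<open>tgt\<close> without mentioning objects. In this form they are conditional rewrite rules, and
identities between sums of composites are left to the simplifier.\<close>

definition arrows :: "('o, 'm, 'z) precategory_scheme \<Rightarrow> 'o \<Rightarrow> 'o \<Rightarrow> 'm set" (infix \<open>\<leadsto>\<index>\<close> 60) where
  "X \<leadsto>\<^bsub>C\<^esub> Y = {f \<in> carrier (Hom C X Y). X \<in> Obj C \<and> Y \<in> Obj C}"

definition arr :: "('o, 'm, 'z) precategory_scheme \<Rightarrow> 'm \<Rightarrow> bool" where
  "arr C f \<longleftrightarrow> (\<exists>X Y. f \<in> X \<leadsto>\<^bsub>C\<^esub> Y)"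

definition src :: "('o, 'm, 'z) precategory_scheme \<Rightarrow> 'm \<Rightarrow> 'o" where
  "src C f = (THE X. \<exists>Y. f \<in> X \<leadsto>\<^bsub>C\<^esub> Y)"

definition tgt :: "('o, 'm, 'z) precategory_scheme \<Rightarrow> 'm \<Rightarrow> 'o" where
  "tgt C f = (THE Y. \<exists>X. f \<in> X \<leadsto>\<^bsub>C\<^esub> Y)"

definition addm :: "('o, 'm, 'z) precategory_scheme \<Rightarrow> 'm \<Rightarrow> 'm \<Rightarrow> 'm" (infixl \<open>\<boxplus>\<index>\<close> 65) where
  "f \<boxplus>\<^bsub>C\<^esub> g = f \<otimes>\<^bsub>Hom C (src C f) (tgt C f)\<^esub> g"

definition negm :: "('o, 'm, 'z) precategory_scheme \<Rightarrow> 'm \<Rightarrow> 'm" (\<open>\<boxminus>\<index> _\<close> [81] 80) where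
  "\<boxminus>\<^bsub>C\<^esub> f = inv\<^bsub>Hom C (src C f) (tgt C f)\<^esub> f"

context preadditive_category
begin

lemma arrows_unique:
  assumes "f \<in> X \<leadsto> Y" "f \<in> X' \<leadsto> Y'" shows "X = X' \<and> Y = Y'"
  using assms Hom_disjoint unfolding arrows_def by blast

text \<open>As a rewrite rule this turns every typing assumption into the equations for \<open>src\<close> and \<open>tgt\<close> on which the
side conditions of all later rules depend.\<close>

lemma in_arrows [simp]:
  "f \<in> X \<leadsto> Y \<longleftrightarrow> arr C f \<and> src C f = X \<and> tgt C f = Y \<and> X \<in> Obj C \<and> Y \<in> Obj C"
proof -
  have 1: "src C f = X \<and> tgt C f = Y" if "f \<in> X \<leadsto> Y" for X Y
    unfolding src_def tgt_def using that by (auto intro!: the_equality dest: arrows_unique)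
  have 2: "X \<in> Obj C \<and> Y \<in> Obj C" if "f \<in> X \<leadsto> Y" for X Y using that by (simp add: arrows_def)
  have 3: "f \<in> src C f \<leadsto> tgt C f" if "arr C f"
    using that 1 unfolding arr_def by force
  show ?thesis
  proof
    assume "f \<in> X \<leadsto> Y"
    with 1 2 show "arr C f \<and> src C f = X \<and> tgt C f = Y \<and> X \<in> Obj C \<and> Y \<in> Obj C"
      by (auto simp: arr_def)
  next
    assume "arr C f \<and> src C f = X \<and> tgt C f = Y \<and> X \<in> Obj C \<and> Y \<in> Obj C"
    with 3 show "f \<in> X \<leadsto> Y" by simp
  qed
qed

lemma arrowsI: "f \<in> mor C X Y \<Longrightarrow> X \<in> Obj C \<Longrightarrow> Y \<in> Obj C \<Longrightarrow> f \<in> X \<leadsto> Y"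
  by (simp only: arrows_def mem_Collect_eq)

lemma arrowsD: "f \<in> X \<leadsto> Y \<Longrightarrow> f \<in> mor C X Y \<and> X \<in> Obj C \<and> Y \<in> Obj C"
  by (simp only: arrows_def mem_Collect_eq)

lemma src_Obj [simp]: "arr C f \<Longrightarrow> src C f \<in> Obj C"
  and tgt_Obj [simp]: "arr C f \<Longrightarrow> tgt C f \<in> Obj C"
proof -
  assume "arr C f"
  then obtain X Y where f: "f \<in> X \<leadsto> Y" unfolding arr_def by blast
  then have "X \<in> Obj C" "Y \<in> Obj C" by (simp_all only: arrows_def mem_Collect_eq)
  moreover have "src C f = X" "tgt C f = Y" using f by simp_all
  ultimately show "src C f \<in> Obj C" "tgt C f \<in> Obj C" by simp_all
qed

lemma arr_mor: "arr C f \<Longrightarrow> f \<in> mor C (src C f) (tgt C f)"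
  using arrowsD[of f "src C f" "tgt C f"] by simp

lemma mor_iff: "X \<in> Obj C \<Longrightarrow> Y \<in> Obj C \<Longrightarrow> f \<in> mor C X Y \<longleftrightarrow> arr C f \<and> src C f = X \<and> tgt C f = Y"
  using arrowsI arrowsD in_arrows by blast

lemma Cmp_in:
  assumes "arr C f" "arr C g" "tgt C f = src C g"
  shows "g \<cdot> f \<in> src C f \<leadsto> tgt C g"
  by (rule arrowsI[OF Cmp_closed]) (use assms arr_mor[of f] arr_mor[of g] in auto)

lemma Cmp_arr [simp]:
  assumes "arr C f" "arr C g" "tgt C f = src C g"
  shows "arr C (g \<cdot> f)" "src C (g \<cdot> f) = src C f" "tgt C (g \<cdot> f) = tgt C g"
  using Cmp_in[OF assms] by auto

lemma Idn_arr [simp]: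
  assumes "X \<in> Obj C" shows "arr C (Idn C X)" "src C (Idn C X) = X" "tgt C (Idn C X) = X"
  using arrowsI[OF Idn_closed] assms by auto

lemma zmor_arr [simp]:
  assumes "X \<in> Obj C" "Y \<in> Obj C"
  shows "arr C (zmor C X Y)" "src C (zmor C X Y) = X" "tgt C (zmor C X Y) = Y"
proof -
  interpret comm_group "Hom C X Y" using assms by (rule Hom_comm_group)
  have "zmor C X Y \<in> X \<leadsto> Y" by (rule arrowsI[OF one_closed assms])
  then show "arr C (zmor C X Y)" "src C (zmor C X Y) = X" "tgt C (zmor C X Y) = Y" by auto
qed

lemma mor_typed: "\<lbrakk>arr C f; src C f = X; tgt C f = Y\<rbrakk> \<Longrightarrow> f \<in> mor C X Y"
  using arr_mor by blast

lemma Hom_mult_addm: "arr C f \<Longrightarrow> src C f = X \<Longrightarrow> tgt C f = Y \<Longrightarrow> f \<otimes>\<^bsub>Hom C X Y\<^esub> g = f \<boxplus> g"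
  by (simp add: addm_def)

lemma Hom_group: "arr C f \<Longrightarrow> comm_group (Hom C (src C f) (tgt C f))"
  by (rule Hom_comm_group) simp_all

lemma addm_arr [simp]:
  assumes "arr C f" "arr C g" "src C f = src C g" "tgt C f = tgt C g"
  shows "arr C (f \<boxplus> g)" "src C (f \<boxplus> g) = src C g" "tgt C (f \<boxplus> g) = tgt C g"
proof -
  interpret comm_group "Hom C (src C g) (tgt C g)" using assms(2) by (rule Hom_group)
  have "f \<boxplus> g \<in> src C g \<leadsto> tgt C g"
    unfolding addm_def assms
    by (rule arrowsI[OF m_closed]) (use assms in \<open>simp_all add: mor_typed\<close>)
  then show "arr C (f \<boxplus> g)" "src C (f \<boxplus> g) = src C g" "tgt C (f \<boxplus> g) = tgt C g"
    using assms by auto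
qed

lemma negm_arr [simp]:
  assumes "arr C f"
  shows "arr C (\<boxminus> f)" "src C (\<boxminus> f) = src C f" "tgt C (\<boxminus> f) = tgt C f"
proof -
  interpret comm_group "Hom C (src C f) (tgt C f)" using assms by (rule Hom_group)
  have "\<boxminus> f \<in> src C f \<leadsto> tgt C f"
    unfolding negm_def by (rule arrowsI[OF inv_closed]) (use assms in \<open>simp_all add: mor_typed\<close>)
  then show "arr C (\<boxminus> f)" "src C (\<boxminus> f) = src C f" "tgt C (\<boxminus> f) = tgt C f"
    using assms by auto
qed

lemma addm_comm:
  assumes "arr C f" "arr C g" "src C f = src C g" "tgt C f = tgt C g"
  shows "f \<boxplus> g = g \<boxplus> f"
proof -
  interpret comm_group "Hom C (src C g) (tgt C g)" using assms(2) by (rule Hom_group)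
  show ?thesis unfolding addm_def assms by (rule m_comm) (use assms in \<open>simp_all add: mor_typed\<close>)
qed

lemma addm_assoc:
  assumes "arr C f" "arr C g" "arr C h" "src C f = src C g" "tgt C f = tgt C g"
    "src C g = src C h" "tgt C g = tgt C h"
  shows "f \<boxplus> g \<boxplus> h = f \<boxplus> (g \<boxplus> h)"
proof -
  interpret comm_group "Hom C (src C h) (tgt C h)" using assms(3) by (rule Hom_group)
  have 1: "src C (f \<boxplus> g) = src C h" "tgt C (f \<boxplus> g) = tgt C h" using assms by auto
  show ?thesis unfolding addm_def[of _ "f \<boxplus> g"] 1 unfolding addm_def assms
    by (rule m_assoc) (use assms in \<open>simp_all add: mor_typed\<close>)
qed

lemma addm_lcomm:
  assumes "arr C f" "arr C g" "arr C h" "src C f = src C g" "tgt C f = tgt C g"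
    "src C g = src C h" "tgt C g = tgt C h"
  shows "f \<boxplus> (g \<boxplus> h) = g \<boxplus> (f \<boxplus> h)"
  by (metis addm_assoc addm_comm assms)

lemma addm_zero [simp]:
  assumes "arr C f" "src C f = X" "tgt C f = Y"
  shows "f \<boxplus> zmor C X Y = f" "zmor C X Y \<boxplus> f = f"
proof -
  interpret comm_group "Hom C (src C f) (tgt C f)" using assms(1) by (rule Hom_group)
  show 1: "f \<boxplus> zmor C X Y = f"
    unfolding addm_def assms(2,3)[symmetric] by (rule r_one) (use assms in \<open>simp add: mor_typed\<close>)
  have "zmor C X Y \<boxplus> f = f \<boxplus> zmor C X Y" using assms by (intro addm_comm) auto
  with 1 show "zmor C X Y \<boxplus> f = f" by simp
qed

lemma addm_neg [simp]:
  assumes "arr C f"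
  shows "f \<boxplus> \<boxminus> f = zmor C (src C f) (tgt C f)" "\<boxminus> f \<boxplus> f = zmor C (src C f) (tgt C f)"
proof -
  interpret comm_group "Hom C (src C f) (tgt C f)" using assms by (rule Hom_group)
  show 1: "f \<boxplus> \<boxminus> f = zmor C (src C f) (tgt C f)"
    unfolding addm_def negm_def by (rule r_inv) (use assms in \<open>simp add: mor_typed\<close>)
  have "\<boxminus> f \<boxplus> f = f \<boxplus> \<boxminus> f" using assms by (intro addm_comm) auto
  with 1 show "\<boxminus> f \<boxplus> f = zmor C (src C f) (tgt C f)" by simp
qed

lemma addm_neg_cancel [simp]:
  assumes "arr C f" "arr C g" "src C f = src C g" "tgt C f = tgt C g"
  shows "f \<boxplus> (\<boxminus> f \<boxplus> g) = g" "\<boxminus> f \<boxplus> (f \<boxplus> g) = g"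
  using assms by (simp_all flip: addm_assoc)

lemma subtract_add_cancel:
  assumes "arr C f" "arr C g" "src C f = src C g" "tgt C f = tgt C g"
  shows "f \<boxplus> \<boxminus> g \<boxplus> g = f"
  using assms by (simp add: addm_assoc)

lemma addm_cancel_left:
  assumes "arr C f" "arr C g" "arr C h" "src C f = src C g" "tgt C f = tgt C g"
    "src C f = src C h" "tgt C f = tgt C h"
  shows "f \<boxplus> g = f \<boxplus> h \<longleftrightarrow> g = h"
  by (metis addm_neg_cancel(2) assms)

lemma neg_unique:
  assumes "arr C f" "arr C g" "src C f = src C g" "tgt C f = tgt C g"
    "f \<boxplus> g = zmor C (src C f) (tgt C f)"
  shows "g = \<boxminus> f"
  using assms addm_cancel_left[of f g "\<boxminus> f"] by auto

lemma negm_negm [simp]: "arr C f \<Longrightarrow> \<boxminus> (\<boxminus> f) = f"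
  using neg_unique[of "\<boxminus> f" f] by auto

lemma Cmp_assoc':
  assumes "arr C f" "arr C g" "arr C h" "tgt C f = src C g" "tgt C g = src C h"
  shows "h \<cdot> g \<cdot> f = h \<cdot> (g \<cdot> f)"
  by (rule Cmp_assoc[of "src C f" "src C g" "src C h" "tgt C h"])
    (use assms in \<open>simp_all add: mor_typed\<close>)

lemma Cmp_Idn [simp]:
  assumes "arr C f" shows "src C f = X \<Longrightarrow> f \<cdot> Idn C X = f" "tgt C f = Y \<Longrightarrow> Idn C Y \<cdot> f = f"
  using assms Idn_right[OF _ _ arr_mor[of f]] Idn_left[OF _ _ arr_mor[of f]] by auto

lemma Cmp_distrib_right:
  assumes "arr C f" "arr C f'" "arr C g" "src C f = src C f'" "tgt C f = tgt C f'" "tgt C f' = src C g"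
  shows "g \<cdot> (f \<boxplus> f') = g \<cdot> f \<boxplus> g \<cdot> f'"
proof -
  have "g \<cdot> (f \<otimes>\<^bsub>Hom C (src C f') (src C g)\<^esub> f') = (g \<cdot> f) \<otimes>\<^bsub>Hom C (src C f') (tgt C g)\<^esub> (g \<cdot> f')"
    by (rule Cmp_add_right) (use assms in \<open>simp_all add: mor_typed\<close>)
  then show ?thesis using assms by (simp add: Hom_mult_addm)
qed

lemma Cmp_distrib_left:
  assumes "arr C g" "arr C g'" "arr C f" "src C g = src C g'" "tgt C g = tgt C g'" "tgt C f = src C g'"
  shows "(g \<boxplus> g') \<cdot> f = g \<cdot> f \<boxplus> g' \<cdot> f"
proof -
  have "(g \<otimes>\<^bsub>Hom C (src C g') (tgt C g')\<^esub> g') \<cdot> f = (g \<cdot> f) \<otimes>\<^bsub>Hom C (src C f) (tgt C g')\<^esub> (g' \<cdot> f)"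
    by (rule Cmp_add_left) (use assms in \<open>simp_all add: mor_typed\<close>)
  then show ?thesis using assms by (simp add: Hom_mult_addm)
qed

lemma Cmp_zero [simp]:
  assumes "arr C f"
  shows "\<lbrakk>src C f = Y; X \<in> Obj C\<rbrakk> \<Longrightarrow> f \<cdot> zmor C X Y = zmor C X (tgt C f)"
    "\<lbrakk>tgt C f = Y; Z \<in> Obj C\<rbrakk> \<Longrightarrow> zmor C Y Z \<cdot> f = zmor C (src C f) Z"
proof -
  assume a: "src C f = Y" "X \<in> Obj C"
  have "f \<cdot> (zmor C X Y \<boxplus> zmor C X Y) = f \<cdot> zmor C X Y \<boxplus> f \<cdot> zmor C X Y"
    using assms a by (intro Cmp_distrib_right) auto
  then have "f \<cdot> zmor C X Y \<boxplus> zmor C X (tgt C f) = f \<cdot> zmor C X Y \<boxplus> f \<cdot> zmor C X Y"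
    using assms a by auto
  then show "f \<cdot> zmor C X Y = zmor C X (tgt C f)"
    using assms a by (subst (asm) addm_cancel_left) auto
next
  assume a: "tgt C f = Y" "Z \<in> Obj C"
  have "(zmor C Y Z \<boxplus> zmor C Y Z) \<cdot> f = zmor C Y Z \<cdot> f \<boxplus> zmor C Y Z \<cdot> f"
    using assms a by (intro Cmp_distrib_left) auto
  then have "zmor C Y Z \<cdot> f \<boxplus> zmor C (src C f) Z = zmor C Y Z \<cdot> f \<boxplus> zmor C Y Z \<cdot> f"
    using assms a by auto
  then show "zmor C Y Z \<cdot> f = zmor C (src C f) Z"
    using assms a by (subst (asm) addm_cancel_left) auto
qed

lemma Cmp_neg [simp]:
  assumes "arr C f" "arr C g" "tgt C f = src C g"
  shows "g \<cdot> \<boxminus> f = \<boxminus> (g \<cdot> f)" "(\<boxminus> g) \<cdot> f = \<boxminus> (g \<cdot> f)"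
proof -
  have "g \<cdot> f \<boxplus> g \<cdot> \<boxminus> f = g \<cdot> (f \<boxplus> \<boxminus> f)" using assms by (subst Cmp_distrib_right) auto
  then show "g \<cdot> \<boxminus> f = \<boxminus> (g \<cdot> f)" using assms by (intro neg_unique) auto
  have "g \<cdot> f \<boxplus> (\<boxminus> g) \<cdot> f = (g \<boxplus> \<boxminus> g) \<cdot> f" using assms by (subst Cmp_distrib_left) auto
  then show "(\<boxminus> g) \<cdot> f = \<boxminus> (g \<cdot> f)" using assms by (intro neg_unique) auto
qed

lemma neg_zero [simp]: "X \<in> Obj C \<Longrightarrow> Y \<in> Obj C \<Longrightarrow> \<boxminus> (zmor C X Y) = zmor C X Y"
  using neg_unique[of "zmor C X Y" "zmor C X Y"] by auto

lemma neg_addm [simp]: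
  assumes "arr C f" "arr C g" "src C f = src C g" "tgt C f = tgt C g"
  shows "\<boxminus> (f \<boxplus> g) = \<boxminus> f \<boxplus> \<boxminus> g"
proof (rule neg_unique[symmetric])
  have "f \<boxplus> g \<boxplus> (\<boxminus> f \<boxplus> \<boxminus> g) = f \<boxplus> (\<boxminus> f \<boxplus> (g \<boxplus> \<boxminus> g))"
    using assms by (simp add: addm_assoc addm_lcomm[of g "\<boxminus> f"] del: addm_neg addm_neg_cancel)
  also have "\<dots> = zmor C (src C f) (tgt C f)" using assms by auto
  finally show "f \<boxplus> g \<boxplus> (\<boxminus> f \<boxplus> \<boxminus> g) = zmor C (src C (f \<boxplus> g)) (tgt C (f \<boxplus> g))" using assms by auto
qed (use assms in auto)

lemmas ringoid_simps = Cmp_assoc' Cmp_distrib_left Cmp_distrib_right addm_assoc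

text \<open>Composites are normalised by bracketing to the right, which hides a known product \<open>h \<cdot> g\<close> inside
\<open>h \<cdot> (g \<cdot> f)\<close>; instances of this rule make a relation such as \<open>p \<cdot> i = 0\<close> applicable there.\<close>

lemma Cmp_reassoc:
  assumes "h \<cdot> g = k" "arr C f" "arr C g" "arr C h" "tgt C f = src C g" "tgt C g = src C h"
  shows "h \<cdot> (g \<cdot> f) = k \<cdot> f"
  using assms by (simp flip: Cmp_assoc')

end

section \<open>Isomorphisms, retracts and biproducts\<close>

context preadditive_category
begin

lemma iso_mor_iff:
  assumes "X \<in> Obj C" "Y \<in> Obj C"
  shows "iso_mor C X Y f \<longleftrightarrow> f \<in> X \<leadsto> Y \<and> (\<exists>g \<in> Y \<leadsto> X. g \<cdot> f = Idn C X \<and> f \<cdot> g = Idn C Y)"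
  unfolding iso_mor_def using assms by (auto simp: mor_iff)

lemma isomorphicI:
  assumes "f \<in> X \<leadsto> Y" "g \<in> Y \<leadsto> X" "g \<cdot> f = Idn C X" "f \<cdot> g = Idn C Y"
  shows "isomorphic C X Y"
  unfolding isomorphic_def using assms iso_mor_iff[of X Y f] by auto

lemma isomorphicE:
  assumes "isomorphic C X Y" "X \<in> Obj C" "Y \<in> Obj C"
  obtains f g where "f \<in> X \<leadsto> Y" "g \<in> Y \<leadsto> X" "g \<cdot> f = Idn C X" "f \<cdot> g = Idn C Y"
  using assms iso_mor_iff[of X Y] unfolding isomorphic_def by blast

lemma isomorphic_refl: "X \<in> Obj C \<Longrightarrow> isomorphic C X X"
  by (rule isomorphicI[of "Idn C X" _ _ "Idn C X"]) auto

lemma isomorphic_sym: "isomorphic C X Y \<Longrightarrow> X \<in> Obj C \<Longrightarrow> Y \<in> Obj C \<Longrightarrow> isomorphic C Y X"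
  by (erule isomorphicE) (assumption | rule isomorphicI)+

lemma iso_comp:
  assumes "f \<in> X \<leadsto> Y" "g \<in> Y \<leadsto> X" "g \<cdot> f = Idn C X"
    "f' \<in> Y \<leadsto> Z" "g' \<in> Z \<leadsto> Y" "g' \<cdot> f' = Idn C Y"
  shows "(g \<cdot> g') \<cdot> (f' \<cdot> f) = Idn C X"
  using assms by (simp add: ringoid_simps Cmp_reassoc[OF assms(6)])

lemma isomorphic_trans:
  assumes "isomorphic C X Y" "isomorphic C Y Z" "X \<in> Obj C" "Y \<in> Obj C" "Z \<in> Obj C"
  shows "isomorphic C X Z"
proof -
  obtain f g where 1: "f \<in> X \<leadsto> Y" "g \<in> Y \<leadsto> X" "g \<cdot> f = Idn C X" "f \<cdot> g = Idn C Y"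
    using isomorphicE[OF assms(1,3,4)] by blast
  obtain f' g' where 2: "f' \<in> Y \<leadsto> Z" "g' \<in> Z \<leadsto> Y" "g' \<cdot> f' = Idn C Y" "f' \<cdot> g' = Idn C Z"
    using isomorphicE[OF assms(2,4,5)] by blast
  have "(g \<cdot> g') \<cdot> (f' \<cdot> f) = Idn C X" using 1 2 by (intro iso_comp) blast+
  moreover have "(f' \<cdot> f) \<cdot> (g \<cdot> g') = Idn C Z" using 1 2 by (intro iso_comp) blast+
  ultimately show ?thesis using 1 2 by (intro isomorphicI[of "f' \<cdot> f" X Z "g \<cdot> g'"]) auto
qed

end

definition retract :: "('o, 'm) precategory \<Rightarrow> 'o \<Rightarrow> 'o \<Rightarrow> bool" where
  "retract C X Y \<longleftrightarrow> (\<exists>s \<in> X \<leadsto>\<^bsub>C\<^esub> Y. \<exists>r \<in> Y \<leadsto>\<^bsub>C\<^esub> X. r \<cdot>\<^bsub>C\<^esub> s = Idn C X)"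

definition biprod2 :: "('o, 'm) precategory \<Rightarrow> 'o \<Rightarrow> 'o \<Rightarrow> 'o \<Rightarrow> 'm \<Rightarrow> 'm \<Rightarrow> 'm \<Rightarrow> 'm \<Rightarrow> bool" where
  "biprod2 C S X Y i p j q \<longleftrightarrow>
     i \<in> X \<leadsto>\<^bsub>C\<^esub> S \<and> p \<in> S \<leadsto>\<^bsub>C\<^esub> X \<and> j \<in> Y \<leadsto>\<^bsub>C\<^esub> S \<and> q \<in> S \<leadsto>\<^bsub>C\<^esub> Y \<and>
     p \<cdot>\<^bsub>C\<^esub> i = Idn C X \<and> q \<cdot>\<^bsub>C\<^esub> j = Idn C Y \<and> p \<cdot>\<^bsub>C\<^esub> j = zmor C Y X \<and> q \<cdot>\<^bsub>C\<^esub> i = zmor C X Y \<and>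
     (i \<cdot>\<^bsub>C\<^esub> p) \<boxplus>\<^bsub>C\<^esub> (j \<cdot>\<^bsub>C\<^esub> q) = Idn C S"

context preadditive_category
begin

lemma retract_trans:
  assumes "retract C X Y" "retract C Y Z" shows "retract C X Z"
proof -
  obtain s r where 1: "s \<in> X \<leadsto> Y" "r \<in> Y \<leadsto> X" "r \<cdot> s = Idn C X"
    using assms unfolding retract_def by blast
  obtain s' r' where 2: "s' \<in> Y \<leadsto> Z" "r' \<in> Z \<leadsto> Y" "r' \<cdot> s' = Idn C Y"
    using assms unfolding retract_def by blast
  have "(r \<cdot> r') \<cdot> (s' \<cdot> s) = Idn C X" using 1 2 by (rule iso_comp)
  moreover have "s' \<cdot> s \<in> X \<leadsto> Z" "r \<cdot> r' \<in> Z \<leadsto> X" using 1 2 by auto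
  ultimately show ?thesis unfolding retract_def by blast
qed

lemma isomorphic_retract: "isomorphic C X Y \<Longrightarrow> X \<in> Obj C \<Longrightarrow> Y \<in> Obj C \<Longrightarrow> retract C X Y"
  unfolding retract_def by (erule isomorphicE) blast+

lemma biprod2D:
  assumes "biprod2 C S X Y i p j q"
  shows "i \<in> X \<leadsto> S" "p \<in> S \<leadsto> X" "j \<in> Y \<leadsto> S" "q \<in> S \<leadsto> Y"
     "p \<cdot> i = Idn C X" "q \<cdot> j = Idn C Y" "p \<cdot> j = zmor C Y X" "q \<cdot> i = zmor C X Y"
     "(i \<cdot> p) \<boxplus> (j \<cdot> q) = Idn C S"
     "arr C i" "arr C p" "arr C j" "arr C q" "src C i = X" "tgt C i = S" "src C p = S" "tgt C p = X"
     "src C j = Y" "tgt C j = S" "src C q = S" "tgt C q = Y" "X \<in> Obj C" "Y \<in> Obj C" "S \<in> Obj C"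
  using assms unfolding biprod2_def by auto

lemma biprod2_swap: "biprod2 C S X Y i p j q \<Longrightarrow> biprod2 C S Y X j q i p"
proof -
  assume b: "biprod2 C S X Y i p j q"
  have "j \<cdot> q \<boxplus> i \<cdot> p = i \<cdot> p \<boxplus> j \<cdot> q" by (rule addm_comm) (simp_all add: biprod2D(10-)[OF b])
  with biprod2D(1-9)[OF b] show ?thesis unfolding biprod2_def by simp
qed

lemma biproduct_two:
  "biproduct C S [X, Y] \<iota> \<pi> \<longleftrightarrow> biprod2 C S X Y (\<iota> 0) (\<pi> 0) (\<iota> 1) (\<pi> 1)" (is "?L \<longleftrightarrow> ?R")
proof -
  have fp: "finprod (Hom C S S) (\<lambda>k. \<iota> k \<cdot> \<pi> k) {..<length [X, Y]} = (\<iota> 0 \<cdot> \<pi> 0) \<boxplus> (\<iota> 1 \<cdot> \<pi> 1)"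
    if "\<iota> 0 \<in> X \<leadsto> S" "\<iota> 1 \<in> Y \<leadsto> S" "\<pi> 0 \<in> S \<leadsto> X" "\<pi> 1 \<in> S \<leadsto> Y"
  proof -
    have S: "S \<in> Obj C" using that by auto
    interpret comm_group "Hom C S S" using S by (intro Hom_comm_group)
    have m: "\<iota> 0 \<cdot> \<pi> 0 \<in> mor C S S" "\<iota> 1 \<cdot> \<pi> 1 \<in> mor C S S"
      using that S by (auto simp: mor_iff)
    have "{..<length [X, Y]} = {0, 1}" by auto
    moreover have "finprod (Hom C S S) (\<lambda>k. \<iota> k \<cdot> \<pi> k) {0, 1} = (\<iota> 0 \<cdot> \<pi> 0) \<otimes>\<^bsub>Hom C S S\<^esub> (\<iota> 1 \<cdot> \<pi> 1)"
      using m by (simp add: Pi_iff)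
    ultimately show ?thesis using that S by (simp add: Hom_mult_addm)
  qed
  have all2: "(\<forall>k < length [X, Y]. P k) \<longleftrightarrow> P 0 \<and> P 1" for P :: "nat \<Rightarrow> bool"
    by (auto simp: less_Suc_eq)
  show ?thesis
  proof
    assume L: ?L
    then have o: "S \<in> Obj C" "X \<in> Obj C" "Y \<in> Obj C" unfolding biproduct_def by auto
    from L have t: "\<iota> 0 \<in> X \<leadsto> S" "\<iota> 1 \<in> Y \<leadsto> S" "\<pi> 0 \<in> S \<leadsto> X" "\<pi> 1 \<in> S \<leadsto> Y"
      unfolding biproduct_def all2 using o by (auto simp: mor_iff)
    show ?R using L t unfolding biproduct_def all2 biprod2_def fp[OF t] by auto
  next
    assume R: ?R
    then have o: "S \<in> Obj C" "X \<in> Obj C" "Y \<in> Obj C" by (rule biprod2D)+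
    show ?L using R o unfolding biproduct_def all2 biprod2_def using fp by (auto simp: mor_iff)
  qed
qed

lemma direct_sum_two: "direct_sum C S [X, Y] \<longleftrightarrow> (\<exists>i p j q. biprod2 C S X Y i p j q)"
proof
  assume "direct_sum C S [X, Y]"
  then show "\<exists>i p j q. biprod2 C S X Y i p j q" unfolding direct_sum_def biproduct_two by blast
next
  assume "\<exists>i p j q. biprod2 C S X Y i p j q"
  then obtain i p j q where "biprod2 C S X Y i p j q" by blast
  then have "biproduct C S [X, Y] (\<lambda>k. if k = 0 then i else j) (\<lambda>k. if k = 0 then p else q)"
    unfolding biproduct_two by simp
  then show "direct_sum C S [X, Y]" unfolding direct_sum_def by blast
qed

lemma direct_sum_sym: "direct_sum C S [X, Y] \<Longrightarrow> direct_sum C S [Y, X]"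
  unfolding direct_sum_two by (elim exE, drule biprod2_swap) blast

lemma direct_sum_Obj: "direct_sum C S [X, Y] \<Longrightarrow> S \<in> Obj C \<and> X \<in> Obj C \<and> Y \<in> Obj C"
  unfolding direct_sum_two by (elim exE) (simp add: biprod2D(22-24))

lemma direct_sum_retract: "direct_sum C S [X, Y] \<Longrightarrow> retract C X S"
  unfolding direct_sum_two retract_def by (elim exE) (metis biprod2D(1,2,5))

lemma direct_summand_iff: "direct_summand C X S \<longleftrightarrow> (\<exists>Y. direct_sum C S [X, Y])"
  by (simp add: direct_summand_def)

lemma biprod2_iso:
  assumes b: "biprod2 C S X Y i p j q" and f: "f \<in> S \<leadsto> S'" "g \<in> S' \<leadsto> S" "g \<cdot> f = Idn C S" "f \<cdot> g = Idn C S'"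
  shows "biprod2 C S' X Y (f \<cdot> i) (p \<cdot> g) (f \<cdot> j) (q \<cdot> g)"
proof -
  note B = biprod2D[OF b]
  note [simp] = B(10-)
  have "f \<cdot> (i \<cdot> p \<boxplus> j \<cdot> q) \<cdot> g = Idn C S'" using f unfolding B(9) by simp
  then have "f \<cdot> (i \<cdot> (p \<cdot> g)) \<boxplus> f \<cdot> (j \<cdot> (q \<cdot> g)) = Idn C S'"
    using f by (simp add: ringoid_simps)
  then show ?thesis unfolding biprod2_def using f B(5-8)
    by (simp add: ringoid_simps Cmp_reassoc[OF f(3)])
qed

lemma direct_sum_iso:
  assumes "direct_sum C S [X, Y]" "isomorphic C S S'" "S' \<in> Obj C"
  shows "direct_sum C S' [X, Y]"
proof -
  obtain i p j q where b: "biprod2 C S X Y i p j q" using assms unfolding direct_sum_two by blast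
  obtain f g where "f \<in> S \<leadsto> S'" "g \<in> S' \<leadsto> S" "g \<cdot> f = Idn C S" "f \<cdot> g = Idn C S'"
    using isomorphicE[OF assms(2) biprod2D(24)[OF b] assms(3)] by blast
  with biprod2_iso[OF b] show ?thesis unfolding direct_sum_two by blast
qed

lemma direct_sum_isos:
  assumes b: "direct_sum C S [X, Y]" and "direct_sum C S' [X', Y']"
    and "isomorphic C X X'" "isomorphic C Y Y'"
  shows "isomorphic C S S'"
proof -
  obtain i p j q where b: "biprod2 C S X Y i p j q" using assms unfolding direct_sum_two by blast
  obtain i' p' j' q' where b': "biprod2 C S' X' Y' i' p' j' q'" using assms unfolding direct_sum_two by blast
  note B = biprod2D[OF b] and B' = biprod2D[OF b']
  obtain f g where f: "f \<in> X \<leadsto> X'" "g \<in> X' \<leadsto> X" "g \<cdot> f = Idn C X" "f \<cdot> g = Idn C X'"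
    using isomorphicE[OF assms(3) B(22) B'(22)] by blast
  obtain h k where h: "h \<in> Y \<leadsto> Y'" "k \<in> Y' \<leadsto> Y" "k \<cdot> h = Idn C Y" "h \<cdot> k = Idn C Y'"
    using isomorphicE[OF assms(4) B(23) B'(23)] by blast
  note [simp] = B(10-) B'(10-)
  have fg: "arr C f" "arr C g" "arr C h" "arr C k" "src C f = X" "src C g = X'" "src C h = Y" "src C k = Y'"
    "tgt C f = X'" "tgt C g = X" "tgt C h = Y'" "tgt C k = Y" using f h by auto
  note [simp] = fg
  show ?thesis
  proof (rule isomorphicI[of "i' \<cdot> (f \<cdot> p) \<boxplus> j' \<cdot> (h \<cdot> q)" _ _ "i \<cdot> (g \<cdot> p') \<boxplus> j \<cdot> (k \<cdot> q')"])
    show "(i \<cdot> (g \<cdot> p') \<boxplus> j \<cdot> (k \<cdot> q')) \<cdot> (i' \<cdot> (f \<cdot> p) \<boxplus> j' \<cdot> (h \<cdot> q)) = Idn C S"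
      using B B' by (simp add: ringoid_simps Cmp_reassoc[OF B'(5)] Cmp_reassoc[OF B'(6)] Cmp_reassoc[OF B'(7)]
        Cmp_reassoc[OF B'(8)] Cmp_reassoc[OF f(3)] Cmp_reassoc[OF h(3)])
    show "(i' \<cdot> (f \<cdot> p) \<boxplus> j' \<cdot> (h \<cdot> q)) \<cdot> (i \<cdot> (g \<cdot> p') \<boxplus> j \<cdot> (k \<cdot> q')) = Idn C S'"
      using B B' by (simp add: ringoid_simps Cmp_reassoc[OF B(5)] Cmp_reassoc[OF B(6)] Cmp_reassoc[OF B(7)]
        Cmp_reassoc[OF B(8)] Cmp_reassoc[OF f(4)] Cmp_reassoc[OF h(4)])
  qed auto
qed

lemma direct_sum_change:
  assumes "direct_sum C S [X, Y]" "isomorphic C X X'" "isomorphic C Y Y'" "X' \<in> Obj C" "Y' \<in> Obj C"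
  shows "direct_sum C S [X', Y']"
proof -
  obtain i p j q where b: "biprod2 C S X Y i p j q" using assms unfolding direct_sum_two by blast
  note B = biprod2D[OF b]
  obtain f g where f: "f \<in> X \<leadsto> X'" "g \<in> X' \<leadsto> X" "g \<cdot> f = Idn C X" "f \<cdot> g = Idn C X'"
    using isomorphicE[OF assms(2) B(22) assms(4)] by blast
  obtain h k where h: "h \<in> Y \<leadsto> Y'" "k \<in> Y' \<leadsto> Y" "k \<cdot> h = Idn C Y" "h \<cdot> k = Idn C Y'"
    using isomorphicE[OF assms(3) B(23) assms(5)] by blast
  have "biprod2 C S X' Y' (i \<cdot> g) (f \<cdot> p) (j \<cdot> k) (h \<cdot> q)"
    unfolding biprod2_def using B f h by (simp add: ringoid_simps Cmp_reassoc[OF B(5)] Cmp_reassoc[OF B(6)] Cmp_reassoc[OF B(7)]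
        Cmp_reassoc[OF B(8)] Cmp_reassoc[OF f(3)] Cmp_reassoc[OF h(3)])
  then show ?thesis unfolding direct_sum_two by blast
qed

lemma zero_objectD:
  assumes "zero_object C Z" shows "Z \<in> Obj C" "Idn C Z = zmor C Z Z"
proof -
  show Z: "Z \<in> Obj C" using assms by (simp add: zero_object_def)
  then have "\<exists>!f. f \<in> mor C Z Z" using assms by (auto simp: zero_object_def)
  moreover have "Idn C Z \<in> mor C Z Z" "zmor C Z Z \<in> mor C Z Z" using Z by (auto simp: mor_iff)
  ultimately show "Idn C Z = zmor C Z Z" by blast
qed

lemma zero_object_iff: "zero_object C Z \<longleftrightarrow> Z \<in> Obj C \<and> Idn C Z = zmor C Z Z"
proof
  assume a: "Z \<in> Obj C \<and> Idn C Z = zmor C Z Z"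
  have 1: "f = zmor C Z Y" if "f \<in> mor C Z Y" "Y \<in> Obj C" for f Y
  proof -
    have "f = f \<cdot> Idn C Z" using that conjunct1[OF a] by (simp add: mor_iff)
    also have "\<dots> = zmor C Z Y" using that a by (simp add: mor_iff)
    finally show ?thesis .
  qed
  have 2: "f = zmor C Y Z" if "f \<in> mor C Y Z" "Y \<in> Obj C" for f Y
  proof -
    have "f = Idn C Z \<cdot> f" using that conjunct1[OF a] by (simp add: mor_iff)
    also have "\<dots> = zmor C Y Z" using that a by (simp add: mor_iff)
    finally show ?thesis .
  qed
  have 3: "zmor C Z Y \<in> mor C Z Y" "zmor C Y Z \<in> mor C Y Z" if "Y \<in> Obj C" for Y
    using a that by (simp_all add: mor_iff)
  show "zero_object C Z" unfolding zero_object_def using a 1 2 3 by blast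
qed (use zero_objectD in auto)

lemma zero_object_maps:
  assumes "zero_object C Z" "f \<in> Z \<leadsto> X" shows "f = zmor C Z X"
proof -
  have "f \<cdot> Idn C Z = zmor C Z X" unfolding zero_objectD(2)[OF assms(1)] using assms(2) by simp
  then show ?thesis using assms(2) by simp
qed

lemma direct_sum_zero_iso:
  assumes "direct_sum C S [X, Y]" "zero_object C Y" shows "isomorphic C S X"
proof -
  obtain i p j q where b: "biprod2 C S X Y i p j q" using assms unfolding direct_sum_two by blast
  note B = biprod2D[OF b]
  note [simp] = B(10-)
  have "j \<cdot> q = j \<cdot> (Idn C Y \<cdot> q)" by simp
  also have "\<dots> = zmor C S S" unfolding zero_objectD(2)[OF assms(2)] by simp
  finally have "i \<cdot> p = Idn C S" using B(9) by simp
  then show ?thesis by (intro isomorphicI[of p _ _ i]) (use B in simp_all)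
qed

end

section \<open>Cancellation, local objects and Fitting decompositions\<close>

definition automorphism :: "('o, 'm) precategory \<Rightarrow> 'o \<Rightarrow> 'm \<Rightarrow> bool" where
  "automorphism C X f \<longleftrightarrow> f \<in> X \<leadsto>\<^bsub>C\<^esub> X \<and> (\<exists>g \<in> X \<leadsto>\<^bsub>C\<^esub> X. g \<cdot>\<^bsub>C\<^esub> f = Idn C X \<and> f \<cdot>\<^bsub>C\<^esub> g = Idn C X)"

text \<open>Stable range one in the sense of Bass for the endomorphism ring of \<open>X\<close>: the property that makes \<open>X\<close> cancel
from direct sums. It passes to quotient rings, hence to the stable category, where the endomorphism ring of an
object with local endomorphism ring may become zero.\<close>

definition stable_range_one :: "('o, 'm) precategory \<Rightarrow> 'o \<Rightarrow> bool" where
  "stable_range_one C X \<longleftrightarrow> X \<in> Obj C \<and>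
     (\<forall>a \<in> X \<leadsto>\<^bsub>C\<^esub> X. \<forall>a' \<in> X \<leadsto>\<^bsub>C\<^esub> X. \<forall>d \<in> X \<leadsto>\<^bsub>C\<^esub> X. (a' \<cdot>\<^bsub>C\<^esub> a) \<boxplus>\<^bsub>C\<^esub> d = Idn C X \<longrightarrow>
        (\<exists>y \<in> X \<leadsto>\<^bsub>C\<^esub> X. automorphism C X (a \<boxplus>\<^bsub>C\<^esub> (y \<cdot>\<^bsub>C\<^esub> d))))"

definition local_object :: "('o, 'm) precategory \<Rightarrow> 'o \<Rightarrow> bool" where
  "local_object C X \<longleftrightarrow> X \<in> Obj C \<and> local_ring (End_ring C X)"

primrec endpow :: "('o, 'm) precategory \<Rightarrow> 'o \<Rightarrow> 'm \<Rightarrow> nat \<Rightarrow> 'm" where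
  "endpow C X f 0 = Idn C X"
| "endpow C X f (Suc k) = endpow C X f k \<cdot>\<^bsub>C\<^esub> f"

context preadditive_category
begin

lemma automorphismE:
  assumes "automorphism C X f"
  obtains g where "f \<in> X \<leadsto> X" "g \<in> X \<leadsto> X" "g \<cdot> f = Idn C X" "f \<cdot> g = Idn C X"
  using assms unfolding automorphism_def by blast

lemma automorphismI:
  assumes "f \<in> X \<leadsto> X" "g \<in> X \<leadsto> X" "g \<cdot> f = Idn C X" "f \<cdot> g = Idn C X"
  shows "automorphism C X f"
  using assms unfolding automorphism_def by blast

text \<open>Evans' cancellation theorem. Write the identity of \<open>S\<close> as a two-by-two matrix from \<open>L \<oplus> X\<close> to \<open>L \<oplus> Y\<close>.
Stable range one allows a row operation after which the corner \<open>L \<rightarrow> L\<close> is invertible, and then the Schur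
complement of this corner is an isomorphism from \<open>X\<close> to \<open>Y\<close>.\<close>

lemma direct_sum_cancel:
  assumes L: "stable_range_one C L" and "direct_sum C S [L, X]" "direct_sum C S [L, Y]"
  shows "isomorphic C X Y"
proof -
  obtain i1 p1 i2 p2 where b: "biprod2 C S L X i1 p1 i2 p2" using assms unfolding direct_sum_two by blast
  obtain j1 q1 j2 q2 where b': "biprod2 C S L Y j1 q1 j2 q2" using assms unfolding direct_sum_two by blast
  note B = biprod2D[OF b] and B' = biprod2D[OF b']
  note [simp] = B(10-) B'(10-)
  have "p1 \<cdot> (j1 \<cdot> q1 \<boxplus> j2 \<cdot> q2) \<cdot> i1 = Idn C L" unfolding B'(9) using B(5) by simp
  then have "(p1 \<cdot> j1) \<cdot> (q1 \<cdot> i1) \<boxplus> p1 \<cdot> (j2 \<cdot> (q2 \<cdot> i1)) = Idn C L" by (simp add: ringoid_simps)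
  moreover have "q1 \<cdot> i1 \<in> L \<leadsto> L" "p1 \<cdot> j1 \<in> L \<leadsto> L" "p1 \<cdot> (j2 \<cdot> (q2 \<cdot> i1)) \<in> L \<leadsto> L" by simp_all
  ultimately obtain y where y: "y \<in> L \<leadsto> L"
    and aut: "automorphism C L (q1 \<cdot> i1 \<boxplus> y \<cdot> (p1 \<cdot> (j2 \<cdot> (q2 \<cdot> i1))))"
    using L unfolding stable_range_one_def by blast
  define b where "b = y \<cdot> (p1 \<cdot> j2)"
  \<comment> \<open>The row operation, and the corresponding change \<open>j\<close> of the injection of \<open>Y\<close>.\<close>
  define q where "q = q1 \<boxplus> b \<cdot> q2"
  define j where "j = j2 \<boxplus> \<boxminus> (j1 \<cdot> b)"
  have y': "arr C y" "src C y = L" "tgt C y = L" using y by auto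
  have bt: "arr C b" "src C b = Y" "tgt C b = L" unfolding b_def using y' by simp_all
  have qt: "arr C q" "src C q = S" "tgt C q = L" unfolding q_def using bt by simp_all
  have jt: "arr C j" "src C j = Y" "tgt C j = S" unfolding j_def using bt by simp_all
  have "q \<cdot> i1 = q1 \<cdot> i1 \<boxplus> y \<cdot> (p1 \<cdot> (j2 \<cdot> (q2 \<cdot> i1)))"
    unfolding q_def b_def using y' by (simp add: ringoid_simps)
  with aut obtain w where w: "w \<in> L \<leadsto> L" "w \<cdot> (q \<cdot> i1) = Idn C L" "q \<cdot> i1 \<cdot> w = Idn C L"
    using automorphismE by metis
  have wt: "arr C w" "src C w = L" "tgt C w = L" using w by auto
  have w2: "q \<cdot> (i1 \<cdot> w) = Idn C L" using w(3) wt qt by (simp add: ringoid_simps)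
  have qj: "q \<cdot> j = zmor C Y L" unfolding q_def j_def using bt
    by (simp add: ringoid_simps B' Cmp_reassoc[OF B'(5)] Cmp_reassoc[OF B'(8)])
  have q2j: "q2 \<cdot> j = Idn C Y" unfolding j_def using bt
    by (simp add: ringoid_simps B' Cmp_reassoc[OF B'(8)])
  have jq: "j \<cdot> q2 \<boxplus> j1 \<cdot> q = Idn C S"
  proof -
    have "j \<cdot> q2 \<boxplus> j1 \<cdot> q = j2 \<cdot> q2 \<boxplus> (\<boxminus> (j1 \<cdot> (b \<cdot> q2)) \<boxplus> (j1 \<cdot> q1 \<boxplus> j1 \<cdot> (b \<cdot> q2)))"
      unfolding q_def j_def using bt by (simp add: ringoid_simps)
    also have "\<dots> = j2 \<cdot> q2 \<boxplus> (\<boxminus> (j1 \<cdot> (b \<cdot> q2)) \<boxplus> (j1 \<cdot> (b \<cdot> q2) \<boxplus> j1 \<cdot> q1))"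
      using bt by (subst (4) addm_comm) simp_all
    also have "\<dots> = j2 \<cdot> q2 \<boxplus> j1 \<cdot> q1" using bt by simp
    also have "\<dots> = Idn C S" by (subst addm_comm) (simp_all add: B'(9))
    finally show ?thesis .
  qed
  \<comment> \<open>The Schur complement, before restricting it to \<open>X\<close>.\<close>
  define d where "d = q2 \<boxplus> \<boxminus> (q2 \<cdot> (i1 \<cdot> (w \<cdot> q)))"
  have dt: "arr C d" "src C d = S" "tgt C d = Y" unfolding d_def using wt qt by simp_all
  have di: "d \<cdot> i1 = zmor C L Y" unfolding d_def using wt qt w by (simp add: ringoid_simps)
  have dj: "d \<cdot> j = Idn C Y" unfolding d_def using wt qt jt qj q2j by (simp add: ringoid_simps)
  have d1: "j \<cdot> d \<boxplus> i1 \<cdot> (w \<cdot> q) = Idn C S"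
  proof -
    have "j \<cdot> q2 \<cdot> (i1 \<cdot> (w \<cdot> q)) \<boxplus> j1 \<cdot> q \<cdot> (i1 \<cdot> (w \<cdot> q)) = i1 \<cdot> (w \<cdot> q)"
      unfolding Cmp_distrib_left[symmetric, of "j \<cdot> q2" "j1 \<cdot> q" "i1 \<cdot> (w \<cdot> q)"] using jt qt wt
      by (subst Cmp_distrib_left[symmetric]) (simp_all add: jq)
    moreover have "q \<cdot> (i1 \<cdot> (w \<cdot> q)) = q" using w2 wt qt
      by (metis B(10,14,15) B'(22) Cmp_Idn(2) Cmp_arr Cmp_assoc')
    ultimately have 1: "j \<cdot> (q2 \<cdot> (i1 \<cdot> (w \<cdot> q))) \<boxplus> j1 \<cdot> q = i1 \<cdot> (w \<cdot> q)"
      using jt qt wt by (simp add: ringoid_simps)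
    have "j \<cdot> d \<boxplus> i1 \<cdot> (w \<cdot> q) = j \<cdot> q2 \<boxplus> (\<boxminus> (j \<cdot> (q2 \<cdot> (i1 \<cdot> (w \<cdot> q)))) \<boxplus> i1 \<cdot> (w \<cdot> q))"
      unfolding d_def using jt qt wt by (simp add: ringoid_simps)
    also have "\<dots> = j \<cdot> q2 \<boxplus> (\<boxminus> (j \<cdot> (q2 \<cdot> (i1 \<cdot> (w \<cdot> q)))) \<boxplus> (j \<cdot> (q2 \<cdot> (i1 \<cdot> (w \<cdot> q))) \<boxplus> j1 \<cdot> q))"
      by (simp only: 1)
    also have "\<dots> = j \<cdot> q2 \<boxplus> j1 \<cdot> q" using jt qt wt by simp
    finally show ?thesis using jq by simp
  qed
  show ?thesis
  proof (rule isomorphicI[of "d \<cdot> i2" X Y "p2 \<cdot> j"])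
    show "d \<cdot> i2 \<in> X \<leadsto> Y" "p2 \<cdot> j \<in> Y \<leadsto> X" using dt jt by simp_all
    have "p2 \<cdot> (j \<cdot> d \<boxplus> i1 \<cdot> (w \<cdot> q)) \<cdot> i2 = Idn C X" unfolding d1 using B by simp
    then show "p2 \<cdot> j \<cdot> (d \<cdot> i2) = Idn C X"
      using dt jt wt qt by (simp add: ringoid_simps Cmp_reassoc[OF B(8)])
    have "d \<cdot> (i1 \<cdot> p1 \<boxplus> i2 \<cdot> p2) \<cdot> j = Idn C Y" unfolding B(9) using dt jt dj by simp
    then show "d \<cdot> i2 \<cdot> (p2 \<cdot> j) = Idn C Y"
      using dt jt by (simp add: ringoid_simps Cmp_reassoc[OF di])
  qed
qed

lemma End_ring_Units: "X \<in> Obj C \<Longrightarrow> Units (End_ring C X) = {f. automorphism C X f}"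
  unfolding Units_def automorphism_def End_ring_def by (auto simp: mor_iff)

lemma local_object_facts:
  assumes "local_object C X"
  shows "automorphism C X (Idn C X)" "\<not> automorphism C X (zmor C X X)"
    and "\<And>f g. \<lbrakk>f \<in> X \<leadsto> X; g \<in> X \<leadsto> X; \<not> automorphism C X f; \<not> automorphism C X g\<rbrakk> \<Longrightarrow> \<not> automorphism C X (f \<boxplus> g)"
    and "\<And>f g. \<lbrakk>f \<in> X \<leadsto> X; g \<in> X \<leadsto> X; \<not> automorphism C X f\<rbrakk> \<Longrightarrow> \<not> automorphism C X (g \<cdot> f)"
    and "\<And>f g. \<lbrakk>f \<in> X \<leadsto> X; g \<in> X \<leadsto> X; \<not> automorphism C X f\<rbrakk> \<Longrightarrow> \<not> automorphism C X (f \<cdot> g)"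
proof -
  have X: "X \<in> Obj C" using assms by (simp add: local_object_def)
  interpret I: ideal "carrier (End_ring C X) - Units (End_ring C X)" "End_ring C X"
    using assms by (simp add: local_object_def local_ring_def)
  have c: "f \<in> carrier (End_ring C X) \<longleftrightarrow> f \<in> X \<leadsto> X" for f
    unfolding End_ring_def using X by (simp add: mor_iff)
  have m: "g \<otimes>\<^bsub>End_ring C X\<^esub> f = g \<cdot> f" for f g by (simp add: End_ring_def)
  have a: "f \<oplus>\<^bsub>End_ring C X\<^esub> g = f \<boxplus> g" if "f \<in> X \<leadsto> X" for f g
    using that by (simp add: End_ring_def Hom_mult_addm)
  have z: "\<zero>\<^bsub>End_ring C X\<^esub> = zmor C X X" by (simp add: End_ring_def)
  have u: "f \<in> Units (End_ring C X) \<longleftrightarrow> automorphism C X f" for f using End_ring_Units[OF X] by simp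
  have i: "f \<in> carrier (End_ring C X) - Units (End_ring C X) \<longleftrightarrow> f \<in> X \<leadsto> X \<and> \<not> automorphism C X f" for f
    using c u by simp
  show "automorphism C X (Idn C X)" by (rule automorphismI[of _ _ "Idn C X"]) (use X in simp_all)
  show "\<not> automorphism C X (zmor C X X)" using additive_subgroup.zero_closed[OF ideal.axioms(1)[OF I.ideal_axioms]] unfolding i z by blast
  show "\<not> automorphism C X (f \<boxplus> g)" if "f \<in> X \<leadsto> X" "g \<in> X \<leadsto> X" "\<not> automorphism C X f" "\<not> automorphism C X g" for f g
    using additive_subgroup.a_closed[OF ideal.axioms(1)[OF I.ideal_axioms], of f g] that unfolding i a[OF that(1)] by blast
  show "\<not> automorphism C X (g \<cdot> f)" if "f \<in> X \<leadsto> X" "g \<in> X \<leadsto> X" "\<not> automorphism C X f" for f g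
    using I.I_l_closed[of f g] that unfolding i m c by blast
  show "\<not> automorphism C X (f \<cdot> g)" if "f \<in> X \<leadsto> X" "g \<in> X \<leadsto> X" "\<not> automorphism C X f" for f g
    using I.I_r_closed[of f g] that unfolding i m c by blast
qed

text \<open>If \<open>a' a + d = 1\<close> and \<open>a\<close> is not invertible, then \<open>a' a\<close> lies in the ideal of non-units, so \<open>d\<close> is
a unit and \<open>y = (1 - a) d\<^sup>-\<^sup>1\<close> gives \<open>a + y d = 1\<close>.\<close>

lemma local_object_stable_range_one:
  assumes L: "local_object C X" shows "stable_range_one C X"
  unfolding stable_range_one_def
proof (intro conjI ballI impI)
  show X: "X \<in> Obj C" using assms by (simp add: local_object_def)
  fix a a' d assume a: "a \<in> X \<leadsto> X" and a': "a' \<in> X \<leadsto> X" and d: "d \<in> X \<leadsto> X" and e: "a' \<cdot> a \<boxplus> d = Idn C X"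
  show "\<exists>y \<in> X \<leadsto> X. automorphism C X (a \<boxplus> y \<cdot> d)"
  proof (cases "automorphism C X a")
    case True
    show ?thesis by (rule bexI[of _ "zmor C X X"]) (use True X a d in simp_all)
  next
    case False
    then have 1: "\<not> automorphism C X (a' \<cdot> a)" by (intro local_object_facts(4)[OF L] a a')
    have "automorphism C X d"
    proof (rule ccontr)
      assume "\<not> automorphism C X d"
      then have "\<not> automorphism C X (a' \<cdot> a \<boxplus> d)"
        by (intro local_object_facts(3)[OF L] 1) (use a a' d in simp_all)
      then show False using e local_object_facts(1)[OF L] by simp
    qed
    then obtain g where g: "g \<in> X \<leadsto> X" "g \<cdot> d = Idn C X" by (rule automorphismE)
    have "a \<boxplus> (Idn C X \<boxplus> \<boxminus> a) \<cdot> g \<cdot> d = a \<boxplus> (Idn C X \<boxplus> \<boxminus> a)" using a d g by (simp add: ringoid_simps)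
    also have "\<dots> = a \<boxplus> (\<boxminus> a \<boxplus> Idn C X)" using a X by (subst (2) addm_comm) simp_all
    also have "\<dots> = Idn C X" using a X by simp
    finally have "automorphism C X (a \<boxplus> (Idn C X \<boxplus> \<boxminus> a) \<cdot> g \<cdot> d)" using local_object_facts(1)[OF L] by simp
    moreover have "(Idn C X \<boxplus> \<boxminus> a) \<cdot> g \<in> X \<leadsto> X" using a g X by simp
    ultimately show ?thesis by blast
  qed
qed

lemma endpow_arr [simp]:
  assumes "f \<in> X \<leadsto> X" shows "arr C (endpow C X f k)" "src C (endpow C X f k) = X" "tgt C (endpow C X f k) = X"
  by (induction k) (use assms in simp_all)

lemma endpow_nat_pow: "f [^]\<^bsub>End_ring C X\<^esub> (k::nat) = endpow C X f k"
  by (induction k) (simp_all add: nat_pow_def End_ring_def)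

lemma endpow_commute:
  assumes "f \<in> X \<leadsto> X" shows "f \<cdot> endpow C X f k = endpow C X f k \<cdot> f"
proof (induction k)
  case (Suc k)
  have "f \<cdot> (endpow C X f k \<cdot> f) = f \<cdot> endpow C X f k \<cdot> f"
    using assms by (simp add: Cmp_assoc' endpow_arr[OF assms])
  then show ?case using Suc by simp
qed (use assms in simp)

lemma endpow_intertwine:
  assumes "a \<in> X \<leadsto> X" "b \<in> Y \<leadsto> Y" "q \<in> X \<leadsto> Y" "q \<cdot> a = b \<cdot> q"
  shows "q \<cdot> endpow C X a k = endpow C Y b k \<cdot> q"
proof (induction k)
  case (Suc k)
  have "q \<cdot> (endpow C X a k \<cdot> a) = endpow C Y b k \<cdot> q \<cdot> a"
    using assms(1-3) by (simp add: Cmp_reassoc[OF Suc])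
  also have "\<dots> = endpow C Y b k \<cdot> b \<cdot> q" using assms by (simp add: Cmp_assoc' endpow_arr[OF assms(2)])
  finally show ?case by simp
qed (use assms in simp)

lemma fitting_decomposition:
  assumes "fitting_property C" "f \<in> X \<leadsto> X"
  obtains Y Z i p j q \<theta> \<theta>' \<alpha> k where "biprod2 C X Y Z i p j q" "\<theta> \<in> Y \<leadsto> Y" "\<theta>' \<in> Y \<leadsto> Y"
    "\<theta>' \<cdot> \<theta> = Idn C Y" "\<theta> \<cdot> \<theta>' = Idn C Y" "\<alpha> \<in> Z \<leadsto> Z" "endpow C Z \<alpha> k = zmor C Z Z"
    "f = i \<cdot> (\<theta> \<cdot> p) \<boxplus> j \<cdot> (\<alpha> \<cdot> q)"
proof -
  have X: "X \<in> Obj C" and fm: "f \<in> mor C X X" using assms(2) by (simp_all add: mor_iff)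
  have "\<exists>Y Z \<iota> \<pi> \<theta> \<alpha>. biproduct C X [Y, Z] \<iota> \<pi> \<and> iso_mor C Y Y \<theta> \<and>
       \<alpha> \<in> mor C Z Z \<and> (\<exists>k::nat. \<alpha> [^]\<^bsub>End_ring C Z\<^esub> k = zmor C Z Z) \<and>
       f = (\<iota> 0 \<cdot> \<theta> \<cdot> \<pi> 0) \<otimes>\<^bsub>Hom C X X\<^esub> (\<iota> 1 \<cdot> \<alpha> \<cdot> \<pi> 1)"
    using assms(1) X fm unfolding fitting_property_def by blast
  then obtain Y Z \<iota> \<pi> \<theta> \<alpha> k where b: "biproduct C X [Y, Z] \<iota> \<pi>" and th: "iso_mor C Y Y \<theta>"
    and al: "\<alpha> \<in> mor C Z Z" and k: "\<alpha> [^]\<^bsub>End_ring C Z\<^esub> (k::nat) = zmor C Z Z"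
    and f: "f = (\<iota> 0 \<cdot> \<theta> \<cdot> \<pi> 0) \<otimes>\<^bsub>Hom C X X\<^esub> (\<iota> 1 \<cdot> \<alpha> \<cdot> \<pi> 1)" by blast
  have b2: "biprod2 C X Y Z (\<iota> 0) (\<pi> 0) (\<iota> 1) (\<pi> 1)" using b by (simp only: biproduct_two)
  note B = biprod2D[OF b2]
  note [simp] = B(10-)
  obtain \<theta>' where th': "\<theta> \<in> Y \<leadsto> Y" "\<theta>' \<in> Y \<leadsto> Y" "\<theta>' \<cdot> \<theta> = Idn C Y" "\<theta> \<cdot> \<theta>' = Idn C Y"
    using th by (auto simp: iso_mor_iff)
  have al': "\<alpha> \<in> Z \<leadsto> Z" using al by (simp add: mor_iff)
  have "f = \<iota> 0 \<cdot> (\<theta> \<cdot> \<pi> 0) \<boxplus> \<iota> 1 \<cdot> (\<alpha> \<cdot> \<pi> 1)"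
    unfolding f using th' al' by (simp add: Hom_mult_addm ringoid_simps del: One_nat_def)
  then show ?thesis using that[OF b2 th' al' k[unfolded endpow_nat_pow]] by blast
qed

lemma biprod2_components:
  assumes b: "biprod2 C X Y Z i p j q" and "\<theta> \<in> Y \<leadsto> Y" "\<alpha> \<in> Z \<leadsto> Z"
  shows "p \<cdot> (i \<cdot> (\<theta> \<cdot> p) \<boxplus> j \<cdot> (\<alpha> \<cdot> q)) \<cdot> i = \<theta>" "q \<cdot> (i \<cdot> (\<theta> \<cdot> p) \<boxplus> j \<cdot> (\<alpha> \<cdot> q)) \<cdot> j = \<alpha>"
proof -
  note B = biprod2D[OF b]
  note [simp] = B(10-)
  show "p \<cdot> (i \<cdot> (\<theta> \<cdot> p) \<boxplus> j \<cdot> (\<alpha> \<cdot> q)) \<cdot> i = \<theta>"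
    using assms(2,3) by (simp add: ringoid_simps B Cmp_reassoc[OF B(5)] Cmp_reassoc[OF B(7)])
  show "q \<cdot> (i \<cdot> (\<theta> \<cdot> p) \<boxplus> j \<cdot> (\<alpha> \<cdot> q)) \<cdot> j = \<alpha>"
    using assms(2,3) by (simp add: ringoid_simps B Cmp_reassoc[OF B(6)] Cmp_reassoc[OF B(8)])
qed

lemma biprod2_mult:
  assumes b: "biprod2 C X Y Z i p j q" and "\<theta> \<in> Y \<leadsto> Y" "\<alpha> \<in> Z \<leadsto> Z" "\<theta>' \<in> Y \<leadsto> Y" "\<alpha>' \<in> Z \<leadsto> Z"
  shows "(i \<cdot> (\<theta> \<cdot> p) \<boxplus> j \<cdot> (\<alpha> \<cdot> q)) \<cdot> (i \<cdot> (\<theta>' \<cdot> p) \<boxplus> j \<cdot> (\<alpha>' \<cdot> q)) =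
    i \<cdot> ((\<theta> \<cdot> \<theta>') \<cdot> p) \<boxplus> j \<cdot> ((\<alpha> \<cdot> \<alpha>') \<cdot> q)"
proof -
  note B = biprod2D[OF b]
  note [simp] = B(10-)
  show ?thesis using assms(2-)
    by (simp add: ringoid_simps B Cmp_reassoc[OF B(5)] Cmp_reassoc[OF B(6)] Cmp_reassoc[OF B(7)] Cmp_reassoc[OF B(8)])
qed

lemma idempotent_nilpotent:
  assumes "a \<in> X \<leadsto> X" "a \<cdot> a = a" "endpow C X a k = zmor C X X" shows "a = zmor C X X"
proof -
  have "endpow C X a (Suc k) = a" using assms(1,2)
    by (induction k) simp_all
  moreover have "endpow C X a (Suc k) = zmor C X X" using assms by simp
  ultimately show ?thesis by simp
qed

lemma idempotent_automorphism:
  assumes "a \<in> X \<leadsto> X" "g \<in> X \<leadsto> X" "g \<cdot> a = Idn C X" "a \<cdot> a = a" shows "a = Idn C X"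
proof -
  have "g \<cdot> (a \<cdot> a) = Idn C X \<cdot> a" using assms(1,2) by (simp add: Cmp_reassoc[OF assms(3)])
  then show ?thesis using assms by simp
qed

text \<open>An idempotent that is the sum of an automorphism and a nilpotent endomorphism has idempotent components, so the
first is an identity and the second is zero. Stated for given decomposition data because it is applied in the
stable category to the image of a decomposition made in \<open>C\<close>.\<close>

lemma idempotent_fitting:
  assumes b: "biprod2 C X Y Z i p j q" and th: "\<theta> \<in> Y \<leadsto> Y" "\<theta>' \<in> Y \<leadsto> Y" "\<theta>' \<cdot> \<theta> = Idn C Y"
    and al: "\<alpha> \<in> Z \<leadsto> Z" "endpow C Z \<alpha> k = zmor C Z Z"
    and e: "e = i \<cdot> (\<theta> \<cdot> p) \<boxplus> j \<cdot> (\<alpha> \<cdot> q)" "e \<cdot> e = e"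
  shows "i \<cdot> p = e"
proof -
  note B = biprod2D[OF b]
  note [simp] = B(10-)
  have ee: "e = i \<cdot> ((\<theta> \<cdot> \<theta>) \<cdot> p) \<boxplus> j \<cdot> ((\<alpha> \<cdot> \<alpha>) \<cdot> q)"
    using e(2) biprod2_mult[OF b th(1) al(1) th(1) al(1)] unfolding e(1) by simp
  have t2: "\<theta> \<cdot> \<theta> \<in> Y \<leadsto> Y" "\<alpha> \<cdot> \<alpha> \<in> Z \<leadsto> Z" using th al by simp_all
  have "\<theta> \<cdot> \<theta> = p \<cdot> e \<cdot> i" unfolding ee by (rule biprod2_components(1)[OF b t2, symmetric])
  also have "\<dots> = \<theta>" unfolding e(1) by (rule biprod2_components(1)[OF b th(1) al(1)])
  finally have "\<theta> = Idn C Y" using idempotent_automorphism[OF th(1,2,3)] by simp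
  moreover have "\<alpha> \<cdot> \<alpha> = q \<cdot> e \<cdot> j" unfolding ee by (rule biprod2_components(2)[OF b t2, symmetric])
  then have "\<alpha> \<cdot> \<alpha> = \<alpha>" unfolding e(1) biprod2_components(2)[OF b th(1) al(1)] .
  then have "\<alpha> = zmor C Z Z" using idempotent_nilpotent[OF al(1) _ al(2)] by simp
  ultimately show "i \<cdot> p = e" unfolding e(1) by simp
qed

text \<open>Fitting's property implies that idempotents split, so that retracts and direct summands are the same.\<close>

lemma idempotent_splits:
  assumes "fitting_property C" "e \<in> X \<leadsto> X" "e \<cdot> e = e"
  obtains Y Z i p j q where "biprod2 C X Y Z i p j q" "i \<cdot> p = e"
proof -
  from fitting_decomposition[OF assms(1,2)] obtain Y Z i p j q \<theta> \<theta>' \<alpha> k where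
    b: "biprod2 C X Y Z i p j q" and th: "\<theta> \<in> Y \<leadsto> Y" "\<theta>' \<in> Y \<leadsto> Y" "\<theta>' \<cdot> \<theta> = Idn C Y"
    and al: "\<alpha> \<in> Z \<leadsto> Z" "endpow C Z \<alpha> k = zmor C Z Z" and e: "e = i \<cdot> (\<theta> \<cdot> p) \<boxplus> j \<cdot> (\<alpha> \<cdot> q)" by metis
  then show ?thesis using that idempotent_fitting[OF b th al e assms(3)] by blast
qed

lemma retract_complement:
  assumes "fitting_property C" "s \<in> X \<leadsto> Y" "r \<in> Y \<leadsto> X" "r \<cdot> s = Idn C X"
  obtains Z j q where "biprod2 C Y X Z s r j q"
proof -
  have "s \<cdot> r \<in> Y \<leadsto> Y" "(s \<cdot> r) \<cdot> (s \<cdot> r) = s \<cdot> r"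
    using assms(2,3) by (simp_all add: ringoid_simps Cmp_reassoc[OF assms(4)])
  from idempotent_splits[OF assms(1) this] obtain Y' Z i p j q
    where b: "biprod2 C Y Y' Z i p j q" and ip: "i \<cdot> p = s \<cdot> r" by blast
  note B = biprod2D[OF b]
  note [simp] = B(10-)
  have t: "arr C s" "src C s = X" "tgt C s = Y" "arr C r" "src C r = Y" "tgt C r = X" "X \<in> Obj C" using assms by auto
  note [simp] = t
  have 1: "r \<cdot> j = zmor C Z X"
  proof -
    have "r \<cdot> j = r \<cdot> ((s \<cdot> r) \<cdot> j)" by (simp add: ringoid_simps Cmp_reassoc[OF assms(4)])
    also have "\<dots> = zmor C Z X" unfolding ip[symmetric] by (simp add: ringoid_simps B)
    finally show ?thesis .
  qed
  have 2: "q \<cdot> s = zmor C X Z"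
  proof -
    have "q \<cdot> s = q \<cdot> ((s \<cdot> r) \<cdot> s)" by (simp add: ringoid_simps assms)
    also have "\<dots> = zmor C X Z" unfolding ip[symmetric] by (simp add: ringoid_simps B Cmp_reassoc[OF B(8)])
    finally show ?thesis .
  qed
  have "biprod2 C Y X Z s r j q" unfolding biprod2_def using 1 2 B(6,9) ip assms(4) by simp
  then show ?thesis by (rule that)
qed

lemma retract_direct_summand:
  assumes "fitting_property C" "retract C X Y" shows "direct_summand C X Y"
  using assms(2) retract_complement[OF assms(1)] unfolding retract_def direct_summand_iff direct_sum_two
  by metis

end

text \<open>Bracketing direct sums to the right gives a form suited to induction on the list, in contrast to the biproduct of
a whole family.\<close>

primrec list_sum :: "('o, 'm) precategory \<Rightarrow> 'o \<Rightarrow> 'o list \<Rightarrow> bool" where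
  "list_sum C S [] = zero_object C S"
| "list_sum C S (X # Xs) = (\<exists>T. direct_sum C S [X, T] \<and> list_sum C T Xs)"

section \<open>Iterated direct sums\<close>

context preadditive_category
begin

lemma direct_sum_assoc:
  assumes "direct_sum C S [T, X]" "direct_sum C T [L, T']" "direct_sum C W [T', X]"
  shows "direct_sum C S [L, W]"
proof -
  obtain i p j q where b1: "biprod2 C S T X i p j q" using assms(1) unfolding direct_sum_two by blast
  obtain a b c d where b2: "biprod2 C T L T' a b c d" using assms(2) unfolding direct_sum_two by blast
  obtain e f g h where b3: "biprod2 C W T' X e f g h" using assms(3) unfolding direct_sum_two by blast
  note B1 = biprod2D[OF b1] and B2 = biprod2D[OF b2] and B3 = biprod2D[OF b3]
  note [simp] = B1(10-) B2(10-) B3(10-)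
  note R = ringoid_simps Cmp_reassoc[OF B1(5)] Cmp_reassoc[OF B1(6)] Cmp_reassoc[OF B1(7)] Cmp_reassoc[OF B1(8)]
    Cmp_reassoc[OF B2(5)] Cmp_reassoc[OF B2(6)] Cmp_reassoc[OF B2(7)] Cmp_reassoc[OF B2(8)]
    Cmp_reassoc[OF B3(5)] Cmp_reassoc[OF B3(6)] Cmp_reassoc[OF B3(7)] Cmp_reassoc[OF B3(8)]
  have 1: "b \<cdot> p \<cdot> (i \<cdot> a) = Idn C L" by (simp add: R B2)
  have 2: "(e \<cdot> (d \<cdot> p) \<boxplus> g \<cdot> q) \<cdot> (i \<cdot> (c \<cdot> f) \<boxplus> j \<cdot> h) = Idn C W"
    by (simp add: R B3(9))
  have 3: "b \<cdot> p \<cdot> (i \<cdot> (c \<cdot> f) \<boxplus> j \<cdot> h) = zmor C W L" by (simp add: R)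
  have 4: "(e \<cdot> (d \<cdot> p) \<boxplus> g \<cdot> q) \<cdot> (i \<cdot> a) = zmor C L W" by (simp add: R B2)
  have 5: "(i \<cdot> a) \<cdot> (b \<cdot> p) \<boxplus> (i \<cdot> (c \<cdot> f) \<boxplus> j \<cdot> h) \<cdot> (e \<cdot> (d \<cdot> p) \<boxplus> g \<cdot> q) = Idn C S"
  proof -
    have "(i \<cdot> a) \<cdot> (b \<cdot> p) \<boxplus> (i \<cdot> (c \<cdot> f) \<boxplus> j \<cdot> h) \<cdot> (e \<cdot> (d \<cdot> p) \<boxplus> g \<cdot> q) =
      i \<cdot> (a \<cdot> b \<boxplus> c \<cdot> d) \<cdot> p \<boxplus> j \<cdot> q" by (simp add: R)
    also have "\<dots> = Idn C S" unfolding B2(9) using B1(9) by simp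
    finally show ?thesis .
  qed
  have "biprod2 C S L W (i \<cdot> a) (b \<cdot> p) (i \<cdot> (c \<cdot> f) \<boxplus> j \<cdot> h) (e \<cdot> (d \<cdot> p) \<boxplus> g \<cdot> q)"
    unfolding biprod2_def using 1 2 3 4 5 by simp
  then show ?thesis unfolding direct_sum_two by blast
qed

lemma finprod_sandwich:
  fixes n :: nat
  assumes "\<And>k. k < n \<Longrightarrow> f k \<in> X \<leadsto> X" "q \<in> X \<leadsto> T" "j \<in> T \<leadsto> X" "X \<in> Obj C"
  shows "finprod (Hom C X X) f {..<n} \<in> X \<leadsto> X \<and>
    finprod (Hom C T T) (\<lambda>k. q \<cdot> f k \<cdot> j) {..<n} = q \<cdot> finprod (Hom C X X) f {..<n} \<cdot> j"
proof -
  interpret X: comm_group "Hom C X X" using assms(4) by (intro Hom_comm_group)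
  interpret T: comm_group "Hom C T T" using assms(2) by (intro Hom_comm_group) simp_all
  have "(\<forall>k < n. f k \<in> X \<leadsto> X) \<longrightarrow> finprod (Hom C X X) f {..<n} \<in> X \<leadsto> X \<and>
    finprod (Hom C T T) (\<lambda>k. q \<cdot> f k \<cdot> j) {..<n} = q \<cdot> finprod (Hom C X X) f {..<n} \<cdot> j"
  proof (induction n)
    case 0
    then show ?case using assms(2-4) by simp
  next
    case (Suc n)
    show ?case
    proof (intro impI)
      assume p: "\<forall>k < Suc n. f k \<in> X \<leadsto> X"
      have m: "f k \<in> mor C X X" if "k < Suc n" for k using p that by (simp add: mor_iff)
      have m': "q \<cdot> f k \<cdot> j \<in> mor C T T" if "k < Suc n" for k using p that assms(2,3) by (simp add: mor_iff)
      have fn: "f n \<in> X \<leadsto> X" using p by blast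
      have IH: "finprod (Hom C X X) f {..<n} \<in> X \<leadsto> X"
        "finprod (Hom C T T) (\<lambda>k. q \<cdot> f k \<cdot> j) {..<n} = q \<cdot> finprod (Hom C X X) f {..<n} \<cdot> j"
        using Suc.IH p less_SucI by blast+
      have e1: "finprod (Hom C X X) f {..<Suc n} = f n \<boxplus> finprod (Hom C X X) f {..<n}"
        unfolding lessThan_Suc using m fn by (simp add: Pi_iff Hom_mult_addm)
      have e2: "finprod (Hom C T T) (\<lambda>k. q \<cdot> f k \<cdot> j) {..<Suc n} =
          q \<cdot> f n \<cdot> j \<boxplus> finprod (Hom C T T) (\<lambda>k. q \<cdot> f k \<cdot> j) {..<n}"
        unfolding lessThan_Suc using m' fn assms(2,3) by (simp add: Pi_iff Hom_mult_addm)
      show "finprod (Hom C X X) f {..<Suc n} \<in> X \<leadsto> X \<and>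
        finprod (Hom C T T) (\<lambda>k. q \<cdot> f k \<cdot> j) {..<Suc n} = q \<cdot> finprod (Hom C X X) f {..<Suc n} \<cdot> j"
        unfolding e1 e2 IH(2) using fn IH(1) assms(2,3) by (simp add: ringoid_simps)
    qed
  qed
  then show ?thesis using assms(1) by blast
qed

lemma finprod_split_first:
  assumes "\<And>k. k < Suc n \<Longrightarrow> f k \<in> X \<leadsto> X" "X \<in> Obj C"
  shows "finprod (Hom C X X) f {..<Suc n} = f 0 \<boxplus> finprod (Hom C X X) (\<lambda>k. f (Suc k)) {..<n}"
proof -
  interpret X: comm_group "Hom C X X" using assms(2) by (intro Hom_comm_group)
  have m: "f k \<in> mor C X X" if "k < Suc n" for k using assms(1)[OF that] by (simp add: mor_iff)
  have "finprod (Hom C X X) f {..<Suc n} = finprod (Hom C X X) f (insert 0 (Suc ` {..<n}))"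
    by (simp add: lessThan_Suc_eq_insert_0)
  also have "\<dots> = f 0 \<otimes>\<^bsub>Hom C X X\<^esub> finprod (Hom C X X) f (Suc ` {..<n})"
    by (rule X.finprod_insert) (use m in \<open>auto simp: Pi_iff\<close>)
  also have "finprod (Hom C X X) f (Suc ` {..<n}) = finprod (Hom C X X) (\<lambda>k. f (Suc k)) {..<n}"
    by (rule X.finprod_reindex) (use m in \<open>auto simp: Pi_iff\<close>)
  finally show ?thesis using assms(1)[of 0] by (simp add: Hom_mult_addm)
qed

text \<open>The complement of the first summand is obtained by splitting an idempotent, and the remaining injections and
projections restrict to it.\<close>

lemma biproduct_Cons:
  assumes fit: "fitting_property C" and b: "biproduct C X (Y # Ys) \<iota> \<pi>"
  shows "\<exists>T. direct_sum C X [Y, T] \<and> direct_sum C T Ys"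
proof -
  have X: "X \<in> Obj C" and Y: "Y \<in> Obj C" "set Ys \<subseteq> Obj C" using b by (simp_all add: biproduct_def)
  have YO: "(Y # Ys) ! k \<in> Obj C" if "k < Suc (length Ys)" for k
    using Y that nth_mem[of k "Y # Ys"] by auto
  have t: "\<iota> k \<in> (Y # Ys) ! k \<leadsto> X" "\<pi> k \<in> X \<leadsto> (Y # Ys) ! k" if "k < Suc (length Ys)" for k
  proof -
    have "\<iota> k \<in> mor C ((Y # Ys) ! k) X" "\<pi> k \<in> mor C X ((Y # Ys) ! k)" using b that by (simp_all add: biproduct_def)
    then show "\<iota> k \<in> (Y # Ys) ! k \<leadsto> X" "\<pi> k \<in> X \<leadsto> (Y # Ys) ! k" using YO[OF that] X by (simp_all add: mor_iff)
  qed
  have d: "\<pi> j \<cdot> \<iota> k = (if j = k then Idn C ((Y # Ys) ! k) else zmor C ((Y # Ys) ! k) ((Y # Ys) ! j))"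
    if "j < Suc (length Ys)" "k < Suc (length Ys)" for j k
    using b that by (simp add: biproduct_def)
  have s: "finprod (Hom C X X) (\<lambda>k. \<iota> k \<cdot> \<pi> k) {..<Suc (length Ys)} = Idn C X"
    using b by (simp add: biproduct_def)
  have t0: "\<iota> 0 \<in> Y \<leadsto> X" "\<pi> 0 \<in> X \<leadsto> Y" "\<pi> 0 \<cdot> \<iota> 0 = Idn C Y"
    using t[of 0] d[of 0 0] by simp_all
  from retract_complement[OF fit t0] obtain T j q where b2: "biprod2 C X Y T (\<iota> 0) (\<pi> 0) j q" .
  note B = biprod2D[OF b2]
  note [simp] = B(10-)
  let ?F = "finprod (Hom C X X) (\<lambda>k. \<iota> (Suc k) \<cdot> \<pi> (Suc k)) {..<length Ys}"
  have tt: "arr C (\<iota> (Suc k))" "src C (\<iota> (Suc k)) = Ys ! k" "tgt C (\<iota> (Suc k)) = X"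
    "arr C (\<pi> (Suc k))" "src C (\<pi> (Suc k)) = X" "tgt C (\<pi> (Suc k)) = Ys ! k" "Ys ! k \<in> Obj C"
    if "k < length Ys" for k using t[of "Suc k"] that by simp_all
  have F: "?F \<in> X \<leadsto> X" and
    F2: "finprod (Hom C T T) (\<lambda>k. q \<cdot> (\<iota> (Suc k) \<cdot> \<pi> (Suc k)) \<cdot> j) {..<length Ys} = q \<cdot> ?F \<cdot> j"
    using finprod_sandwich[of "length Ys" "\<lambda>k. \<iota> (Suc k) \<cdot> \<pi> (Suc k)" X q T j] by (simp_all add: tt)
  have 1: "\<iota> 0 \<cdot> \<pi> 0 \<boxplus> ?F = Idn C X"
    unfolding s[symmetric] by (rule finprod_split_first[symmetric]) (use t in simp_all)
  have "?F = j \<cdot> q"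
    using 1 unfolding B(9)[symmetric] using F by (subst (asm) addm_cancel_left) simp_all
  then have sum: "finprod (Hom C T T) (\<lambda>k. q \<cdot> (\<iota> (Suc k) \<cdot> \<pi> (Suc k)) \<cdot> j) {..<length Ys} = Idn C T"
    unfolding F2 by (simp add: ringoid_simps B Cmp_reassoc[OF B(6)])
  interpret TT: comm_group "Hom C T T" by (rule Hom_comm_group) simp_all
  have sum': "finprod (Hom C T T) (\<lambda>k. q \<cdot> \<iota> (Suc k) \<cdot> (\<pi> (Suc k) \<cdot> j)) {..<length Ys} = Idn C T"
    unfolding sum[symmetric] by (rule TT.finprod_cong') (auto simp: ringoid_simps tt mor_iff)
  have jq: "\<pi> (Suc k) \<cdot> (j \<cdot> (q \<cdot> \<iota> (Suc l))) = \<pi> (Suc k) \<cdot> \<iota> (Suc l)" if "k < length Ys" "l < length Ys" for k l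
  proof -
    have "\<pi> (Suc k) \<cdot> (\<iota> 0 \<cdot> \<pi> 0 \<boxplus> j \<cdot> q) \<cdot> \<iota> (Suc l) = \<pi> (Suc k) \<cdot> \<iota> (Suc l)"
      unfolding B(9) using tt that by simp
    then show ?thesis using tt that d[of "Suc k" 0] by (simp add: ringoid_simps Cmp_reassoc[OF d])
  qed
  have "biproduct C T Ys (\<lambda>k. q \<cdot> \<iota> (Suc k)) (\<lambda>k. \<pi> (Suc k) \<cdot> j)"
    unfolding biproduct_def
  proof (intro conjI allI impI)
    show "q \<cdot> \<iota> (Suc k) \<in> mor C (Ys ! k) T" "\<pi> (Suc k) \<cdot> j \<in> mor C T (Ys ! k)" if "k < length Ys" for k
      using tt[OF that] by (simp_all add: mor_iff)
    show "\<pi> (Suc k) \<cdot> j \<cdot> (q \<cdot> \<iota> (Suc l)) = (if k = l then Idn C (Ys ! l) else zmor C (Ys ! l) (Ys ! k))"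
      if "k < length Ys" "l < length Ys" for k l
      using tt[OF that(1)] tt[OF that(2)] that jq[OF that] d[of "Suc k" "Suc l"] by (simp add: ringoid_simps)
    show "set Ys \<subseteq> Obj C" using Y by simp
  qed (use sum' in simp_all)
  moreover have "direct_sum C X [Y, T]" unfolding direct_sum_two using b2 by blast
  ultimately show ?thesis unfolding direct_sum_def by blast
qed

lemma direct_sum_list_sum:
  assumes fit: "fitting_property C" and "direct_sum C X Xs" shows "list_sum C X Xs"
  using assms(2)
proof (induction Xs arbitrary: X)
  case Nil
  then obtain \<iota> \<pi> where b: "biproduct C X [] \<iota> \<pi>" unfolding direct_sum_def by blast
  then have X: "X \<in> Obj C" by (simp add: biproduct_def)
  interpret comm_group "Hom C X X" using X by (intro Hom_comm_group)
  have "zmor C X X = Idn C X" using b by (simp add: biproduct_def)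
  then show ?case using X by (simp add: zero_object_iff)
next
  case (Cons Y Ys)
  then obtain \<iota> \<pi> where "biproduct C X (Y # Ys) \<iota> \<pi>" unfolding direct_sum_def by blast
  from biproduct_Cons[OF fit this] obtain T where "direct_sum C X [Y, T]" "direct_sum C T Ys" by blast
  with Cons.IH show ?case by auto
qed

lemma krull_schmidt_list_sum:
  assumes "fitting_property C" "krull_schmidt C" "X \<in> Obj C"
  obtains Xs where "list_sum C X Xs" "\<forall>L \<in> set Xs. local_object C L"
proof -
  obtain Xs where Xs: "direct_sum C X Xs" "\<forall>Y \<in> set Xs. local_ring (End_ring C Y)"
    using assms(2,3) unfolding krull_schmidt_def by blast
  moreover have "set Xs \<subseteq> Obj C" using Xs unfolding direct_sum_def biproduct_def by blast
  ultimately show ?thesis using that[of Xs] direct_sum_list_sum[OF assms(1)] by (auto simp: local_object_def)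
qed

lemma list_sum_Obj: "list_sum C S Xs \<Longrightarrow> S \<in> Obj C \<and> set Xs \<subseteq> Obj C"
proof (induction Xs arbitrary: S)
  case Nil then show ?case by (simp add: zero_object_iff)
next
  case (Cons X Xs)
  then obtain T where T: "direct_sum C S [X, T]" "list_sum C T Xs" by auto
  then show ?case using Cons.IH[OF T(2)] direct_sum_Obj[OF T(1)] by simp
qed

lemma zero_objects_isomorphic:
  assumes "zero_object C Z" "zero_object C Z'" shows "isomorphic C Z Z'"
  by (rule isomorphicI[of "zmor C Z Z'" _ _ "zmor C Z' Z"])
    (use zero_objectD[OF assms(1)] zero_objectD[OF assms(2)] in simp_all)

lemma zero_object_iso: "zero_object C Z \<Longrightarrow> isomorphic C Z Z' \<Longrightarrow> Z' \<in> Obj C \<Longrightarrow> zero_object C Z'"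
proof -
  assume z: "zero_object C Z" and i: "isomorphic C Z Z'" and Z': "Z' \<in> Obj C"
  obtain f g where f: "f \<in> Z \<leadsto> Z'" "g \<in> Z' \<leadsto> Z" "g \<cdot> f = Idn C Z" "f \<cdot> g = Idn C Z'"
    using isomorphicE[OF i zero_objectD(1)[OF z] Z'] by blast
  have "f \<cdot> (Idn C Z \<cdot> g) = Idn C Z'" using f by simp
  then have "Idn C Z' = zmor C Z' Z'" unfolding zero_objectD(2)[OF z] using f by simp
  then show ?thesis using Z' by (simp add: zero_object_iff)
qed

lemma list_sum_iso: "list_sum C S Xs \<Longrightarrow> isomorphic C S S' \<Longrightarrow> S' \<in> Obj C \<Longrightarrow> list_sum C S' Xs"
  by (cases Xs) (auto intro: zero_object_iso direct_sum_iso)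

lemma list_sum_unique:
  "list_sum C S Xs \<Longrightarrow> list_sum C S' Xs' \<Longrightarrow> list_all2 (isomorphic C) Xs Xs' \<Longrightarrow> isomorphic C S S'"
proof (induction Xs arbitrary: S S' Xs')
  case Nil then show ?case using zero_objects_isomorphic by simp
next
  case (Cons X Xs)
  then obtain X' Ys where 1: "Xs' = X' # Ys" "isomorphic C X X'" "list_all2 (isomorphic C) Xs Ys"
    by (auto simp: list_all2_Cons1)
  obtain T where T: "direct_sum C S [X, T]" "list_sum C T Xs" using Cons.prems(1) by auto
  obtain T' where T': "direct_sum C S' [X', T']" "list_sum C T' Ys" using Cons.prems(2) 1(1) by auto
  show ?case by (rule direct_sum_isos[OF T(1) T'(1) 1(2) Cons.IH[OF T(2) T'(2) 1(3)]])
qed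

lemma list_sum_refl: "set Xs \<subseteq> Obj C \<Longrightarrow> list_all2 (isomorphic C) Xs Xs"
  by (induction Xs) (auto intro: isomorphic_refl)

lemma list_sum_same: "list_sum C S Xs \<Longrightarrow> list_sum C S' Xs \<Longrightarrow> isomorphic C S S'"
  using list_sum_unique list_sum_refl list_sum_Obj by blast

end

context additive_category
begin

lemma list_sum_exists: "set Xs \<subseteq> Obj C \<Longrightarrow> \<exists>S. list_sum C S Xs"
proof (induction Xs)
  case Nil then show ?case using ex_zero_object by simp
next
  case (Cons X Xs)
  then obtain T where T: "list_sum C T Xs" by auto
  then obtain S where "direct_sum C S [X, T]" using ex_direct_sum[of X T] Cons.prems list_sum_Obj[OF T] by auto
  then show ?case using T by auto
qed

lemma list_sum_append:
  "\<lbrakk>list_sum C S Xs; list_sum C T Ys; direct_sum C W [S, T]\<rbrakk> \<Longrightarrow> list_sum C W (Xs @ Ys)"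
proof (induction Xs arbitrary: S W)
  case Nil
  then have "isomorphic C W T" using direct_sum_zero_iso[OF direct_sum_sym] by simp
  then show ?case using Nil list_sum_iso[OF Nil(2) isomorphic_sym] direct_sum_Obj[OF Nil(3)] by simp
next
  case (Cons X Xs)
  then obtain S' where S': "direct_sum C S [X, S']" "list_sum C S' Xs" by auto
  obtain V where V: "direct_sum C V [S', T]"
    using ex_direct_sum direct_sum_Obj[OF S'(1)] direct_sum_Obj[OF Cons.prems(3)] by blast
  have "direct_sum C W [X, V]" by (rule direct_sum_assoc[OF Cons.prems(3) S'(1) V])
  moreover have "list_sum C V (Xs @ Ys)" by (rule Cons.IH[OF S'(2) Cons.prems(2) V])
  ultimately show ?case by auto
qed

lemma list_sum_swap:
  assumes "list_sum C W (Xs @ Ys)" shows "list_sum C W (Ys @ Xs)"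
proof -
  have o: "set Xs \<subseteq> Obj C" "set Ys \<subseteq> Obj C" "W \<in> Obj C" using list_sum_Obj[OF assms] by simp_all
  obtain S where S: "list_sum C S Xs" using list_sum_exists o by blast
  obtain T where T: "list_sum C T Ys" using list_sum_exists o by blast
  obtain W' where W': "direct_sum C W' [S, T]" using ex_direct_sum list_sum_Obj[OF S] list_sum_Obj[OF T] by blast
  have "list_sum C W' (Xs @ Ys)" by (rule list_sum_append[OF S T W'])
  then have "isomorphic C W' W" using assms list_sum_same by blast
  moreover have "list_sum C W' (Ys @ Xs)" by (rule list_sum_append[OF T S direct_sum_sym[OF W']])
  ultimately show ?thesis using list_sum_iso o by blast
qed

lemma list_sum_split:
  assumes "list_sum C W (Xs @ Ys)"
  obtains S T where "list_sum C S Xs" "list_sum C T Ys" "direct_sum C W [S, T]"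
proof -
  have o: "set Xs \<subseteq> Obj C" "set Ys \<subseteq> Obj C" "W \<in> Obj C" using list_sum_Obj[OF assms] by simp_all
  obtain S where S: "list_sum C S Xs" using list_sum_exists o by blast
  obtain T where T: "list_sum C T Ys" using list_sum_exists o by blast
  obtain W' where W': "direct_sum C W' [S, T]" using ex_direct_sum list_sum_Obj[OF S] list_sum_Obj[OF T] by blast
  have "isomorphic C W' W" using list_sum_same[OF list_sum_append[OF S T W'] assms] .
  then have "direct_sum C W [S, T]" using direct_sum_iso[OF W'] o by blast
  then show ?thesis using that S T by blast
qed

lemma list_sum_move:
  assumes "list_sum C W (Xs @ X # Ys)" shows "list_sum C W (X # Xs @ Ys)"
proof -
  obtain S T where "list_sum C S (Xs @ [X])" "list_sum C T Ys" "direct_sum C W [S, T]"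
    using list_sum_split[of W "Xs @ [X]" Ys] assms by auto
  then show ?thesis using list_sum_append[OF list_sum_swap[of S Xs "[X]"]] by simp
qed

text \<open>Cancel the summands of \<open>T\<close> one after the other.\<close>

lemma list_sum_cancel:
  "\<lbrakk>list_sum C T Ls; \<forall>L \<in> set Ls. stable_range_one C L; direct_sum C S [T, X]; direct_sum C S [T, Y]\<rbrakk>
    \<Longrightarrow> isomorphic C X Y"
proof (induction Ls arbitrary: S T)
  case Nil
  have "isomorphic C S X" "isomorphic C S Y"
    using direct_sum_zero_iso[OF direct_sum_sym] Nil by simp_all
  then show ?case using direct_sum_Obj[OF Nil(3)] direct_sum_Obj[OF Nil(4)]
    by (blast intro: isomorphic_trans isomorphic_sym)
next
  case (Cons L Ls)
  then obtain T' where T': "direct_sum C T [L, T']" "list_sum C T' Ls" by auto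
  obtain W where W: "direct_sum C W [T', X]"
    using ex_direct_sum direct_sum_Obj[OF T'(1)] direct_sum_Obj[OF Cons.prems(3)] by blast
  obtain W' where W': "direct_sum C W' [T', Y]"
    using ex_direct_sum direct_sum_Obj[OF T'(1)] direct_sum_Obj[OF Cons.prems(4)] by blast
  have "direct_sum C S [L, W]" "direct_sum C S [L, W']"
    by (rule direct_sum_assoc[OF Cons.prems(3) T'(1) W], rule direct_sum_assoc[OF Cons.prems(4) T'(1) W'])
  then have "isomorphic C W' W" using direct_sum_cancel[of L S W' W] Cons.prems(2) by simp
  then have "direct_sum C W [T', Y]" using direct_sum_iso[OF W'] direct_sum_Obj[OF W] by blast
  then show ?case using Cons.IH[OF T'(2) _ W] Cons.prems(2) by simp
qed

end

section \<open>Short exact sequences and projectives\<close>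

context exact_category
begin

lemma sesD:
  assumes "ses C E A i B p D"
  shows "i \<in> A \<leadsto> B" "p \<in> B \<leadsto> D" "p \<cdot> i = zmor C A D" "A \<in> Obj C" "B \<in> Obj C" "D \<in> Obj C"
    "arr C i" "arr C p" "src C i = A" "tgt C i = B" "src C p = B" "tgt C p = D"
    "is_kernel C A i B p D" "is_cokernel C A i B p D"
proof -
  show t: "i \<in> A \<leadsto> B" "p \<in> B \<leadsto> D" "A \<in> Obj C" "B \<in> Obj C" "D \<in> Obj C"
    "arr C i" "arr C p" "src C i = A" "tgt C i = B" "src C p = B" "tgt C p = D"
    using assms unfolding ses_def by (auto simp: mor_iff)
  obtain A' B' D' where o: "A' \<in> Obj C" "B' \<in> Obj C" "D' \<in> Obj C"
    and k: "is_kernel C A' i B' p D'" and c: "is_cokernel C A' i B' p D'"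
    using kernel_cokernel_pairs assms unfolding ses_def by blast
  have "i \<in> A' \<leadsto> B'" "p \<in> B' \<leadsto> D'" using k o unfolding is_kernel_def by (simp_all add: mor_iff)
  then have [simp]: "A' = A" "B' = B" "D' = D" using t by auto
  show "is_kernel C A i B p D" "is_cokernel C A i B p D" using k c by simp_all
  then show "p \<cdot> i = zmor C A D" unfolding is_kernel_def by simp
qed

lemma ses_lift:
  assumes "ses C E A i B p D" "t \<in> T \<leadsto> B" "p \<cdot> t = zmor C T D"
  obtains u where "u \<in> T \<leadsto> A" "i \<cdot> u = t"
proof -
  have o: "T \<in> Obj C" "t \<in> mor C T B" using assms(2) by (simp_all add: mor_iff)
  have "\<exists>!u. u \<in> mor C T A \<and> i \<cdot> u = t"
    using sesD(13)[OF assms(1)] o assms(3) unfolding is_kernel_def by blast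
  then obtain u where "u \<in> mor C T A" "i \<cdot> u = t" by blast
  then show ?thesis using that[of u] o sesD(4)[OF assms(1)] by (simp add: mor_iff)
qed

lemma ses_monic:
  assumes s: "ses C E A i B p D" and u: "u \<in> T \<leadsto> A" "u' \<in> T \<leadsto> A" and e: "i \<cdot> u = i \<cdot> u'"
  shows "u = u'"
proof -
  note [simp] = sesD(4-12)[OF s]
  have 1: "i \<cdot> u \<in> mor C T B" using u by (simp add: mor_iff)
  have "p \<cdot> i \<cdot> u = zmor C A D \<cdot> u" by (simp only: sesD(3)[OF s])
  then have "p \<cdot> (i \<cdot> u) = zmor C T D" using u by (simp add: ringoid_simps)
  then have "\<exists>!v. v \<in> mor C T A \<and> i \<cdot> v = i \<cdot> u"
    using sesD(13)[OF s] 1 u(1) unfolding is_kernel_def by simp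
  moreover have "u \<in> mor C T A" "u' \<in> mor C T A" using u by (simp_all add: mor_iff)
  ultimately show ?thesis using e by metis
qed

lemma ses_extend:
  assumes "ses C E A i B p D" "t \<in> B \<leadsto> T" "t \<cdot> i = zmor C A T"
  obtains u where "u \<in> D \<leadsto> T" "u \<cdot> p = t"
proof -
  have o: "T \<in> Obj C" "t \<in> mor C B T" using assms(2) by (simp_all add: mor_iff)
  have "\<exists>!u. u \<in> mor C D T \<and> u \<cdot> p = t"
    using sesD(14)[OF assms(1)] o assms(3) unfolding is_cokernel_def by blast
  then obtain u where "u \<in> mor C D T" "u \<cdot> p = t" by blast
  then show ?thesis using that[of u] o sesD(6)[OF assms(1)] by (simp add: mor_iff)
qed

lemma ses_epic:
  assumes s: "ses C E A i B p D" and u: "u \<in> D \<leadsto> T" "u' \<in> D \<leadsto> T" and e: "u \<cdot> p = u' \<cdot> p"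
  shows "u = u'"
proof -
  note [simp] = sesD(4-12)[OF s]
  have 1: "u \<cdot> p \<in> mor C B T" using u by (simp add: mor_iff)
  have "u \<cdot> p \<cdot> i = zmor C A T" using u sesD(3)[OF s] by (simp add: ringoid_simps)
  then have "\<exists>!v. v \<in> mor C D T \<and> v \<cdot> p = u \<cdot> p"
    using sesD(14)[OF s] 1 u(1) unfolding is_cokernel_def by simp
  moreover have "u \<in> mor C D T" "u' \<in> mor C D T" using u by (simp_all add: mor_iff)
  ultimately show ?thesis using e by metis
qed

lemma is_kernelI:
  assumes "i \<in> A \<leadsto> B" "p \<in> B \<leadsto> D" "p \<cdot> i = zmor C A D"
    and "\<And>T t. t \<in> T \<leadsto> B \<Longrightarrow> p \<cdot> t = zmor C T D \<Longrightarrow> \<exists>u \<in> T \<leadsto> A. i \<cdot> u = t"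
    and "\<And>T u v. u \<in> T \<leadsto> A \<Longrightarrow> v \<in> T \<leadsto> A \<Longrightarrow> i \<cdot> u = i \<cdot> v \<Longrightarrow> u = v"
  shows "is_kernel C A i B p D"
proof -
  have o: "A \<in> Obj C" "B \<in> Obj C" "D \<in> Obj C" "i \<in> mor C A B" "p \<in> mor C B D"
    using assms(1,2) by (simp_all add: mor_iff)
  have "\<exists>!u. u \<in> mor C T A \<and> i \<cdot> u = t" if a: "T \<in> Obj C" "t \<in> mor C T B" "p \<cdot> t = zmor C T D" for T t
  proof -
    have "t \<in> T \<leadsto> B" using a o by (simp add: mor_iff)
    then obtain u where u: "u \<in> T \<leadsto> A" "i \<cdot> u = t" using assms(4) a(3) by blast
    have "v = u" if "v \<in> mor C T A" "i \<cdot> v = t" for v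
      using assms(5)[of v T u] that a(1) o u by (simp add: mor_iff)
    moreover have "u \<in> mor C T A" using u by (simp add: mor_iff)
    ultimately show ?thesis using u(2) by blast
  qed
  then show ?thesis unfolding is_kernel_def using o assms(3) by blast
qed

lemma is_cokernelI:
  assumes "i \<in> A \<leadsto> B" "p \<in> B \<leadsto> D" "p \<cdot> i = zmor C A D"
    and "\<And>T t. t \<in> B \<leadsto> T \<Longrightarrow> t \<cdot> i = zmor C A T \<Longrightarrow> \<exists>u \<in> D \<leadsto> T. u \<cdot> p = t"
    and "\<And>T u v. u \<in> D \<leadsto> T \<Longrightarrow> v \<in> D \<leadsto> T \<Longrightarrow> u \<cdot> p = v \<cdot> p \<Longrightarrow> u = v"
  shows "is_cokernel C A i B p D"
proof -
  have o: "A \<in> Obj C" "B \<in> Obj C" "D \<in> Obj C" "i \<in> mor C A B" "p \<in> mor C B D"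
    using assms(1,2) by (simp_all add: mor_iff)
  have "\<exists>!u. u \<in> mor C D T \<and> u \<cdot> p = t" if a: "T \<in> Obj C" "t \<in> mor C B T" "t \<cdot> i = zmor C A T" for T t
  proof -
    have "t \<in> B \<leadsto> T" using a o by (simp add: mor_iff)
    then obtain u where u: "u \<in> D \<leadsto> T" "u \<cdot> p = t" using assms(4) a(3) by blast
    have "v = u" if "v \<in> mor C D T" "v \<cdot> p = t" for v
      using assms(5)[of v T u] that a(1) o u by (simp add: mor_iff)
    moreover have "u \<in> mor C D T" using u by (simp add: mor_iff)
    ultimately show ?thesis using u(2) by blast
  qed
  then show ?thesis unfolding is_cokernel_def using o assms(3) by blast
qed

text \<open>Kernels are unique up to isomorphism and \<open>E\<close> is closed under isomorphism, so any kernel of an admissible epic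
completes it to a short exact sequence.\<close>

lemma adm_epic_kernel_ses:
  assumes "adm_epic C E B D p" "A \<in> Obj C" and k: "is_kernel C A i B p D"
  shows "ses C E A i B p D"
proof -
  obtain i' A' where s: "ses C E A' i' B p D" using assms(1) unfolding adm_epic_def by blast
  note [simp] = sesD(4-12)[OF s]
  have i: "i \<in> A \<leadsto> B" "p \<cdot> i = zmor C A D" using k assms(2) unfolding is_kernel_def by (simp_all add: mor_iff)
  obtain u where u: "u \<in> A \<leadsto> A'" "i' \<cdot> u = i" using ses_lift[OF s i] .
  have "\<exists>!v. v \<in> mor C A' A \<and> i \<cdot> v = i'" using k sesD(1,3)[OF s] unfolding is_kernel_def by (simp add: mor_iff)
  then obtain v where v: "v \<in> A' \<leadsto> A" "i \<cdot> v = i'" using assms(2) by (auto simp: mor_iff)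
  have uv: "u \<cdot> v = Idn C A'"
    by (rule ses_monic[OF s, of _ A']) (use u v in \<open>simp_all add: Cmp_reassoc[OF u(2)]\<close>)
  have vu: "v \<cdot> u = Idn C A"
  proof -
    have "\<exists>!w. w \<in> mor C A A \<and> i \<cdot> w = i" using k i assms(2) unfolding is_kernel_def by (simp add: mor_iff)
    moreover have "v \<cdot> u \<in> mor C A A" "i \<cdot> (v \<cdot> u) = i" "Idn C A \<in> mor C A A" "i \<cdot> Idn C A = i"
      using u v i assms(2) by (simp_all add: mor_iff Cmp_reassoc[OF v(2)])
    ultimately show ?thesis by blast
  qed
  have "(i, p) \<in> E"
  proof (rule iso_closed[OF s assms(2) _ _ _ _ _ _ _ ])
    show "iso_mor C A' A v" using u v uv vu assms(2) iso_mor_iff[of A' A v] by auto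
    show "iso_mor C B B (Idn C B)" using iso_mor_iff[of B B "Idn C B"] by auto
    show "iso_mor C D D (Idn C D)" using iso_mor_iff[of D D "Idn C D"] by auto
  qed (use i v assms(2) in \<open>simp_all add: mor_iff\<close>)
  then show ?thesis unfolding ses_def using i assms(2) by (simp add: mor_iff)
qed

lemma adm_monic_cokernel_ses:
  assumes "adm_monic C E A B i" "D \<in> Obj C" and k: "is_cokernel C A i B p D"
  shows "ses C E A i B p D"
proof -
  obtain p' D' where s: "ses C E A i B p' D'" using assms(1) unfolding adm_monic_def by blast
  note [simp] = sesD(4-12)[OF s]
  have p: "p \<in> B \<leadsto> D" "p \<cdot> i = zmor C A D" using k assms(2) unfolding is_cokernel_def by (simp_all add: mor_iff)
  obtain u where u: "u \<in> D' \<leadsto> D" "u \<cdot> p' = p" using ses_extend[OF s p] .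
  have "\<exists>!v. v \<in> mor C D D' \<and> v \<cdot> p = p'" using k sesD(2,3)[OF s] unfolding is_cokernel_def by (simp add: mor_iff)
  then obtain v where v: "v \<in> D \<leadsto> D'" "v \<cdot> p = p'" using assms(2) by (auto simp: mor_iff)
  have vu: "v \<cdot> u = Idn C D'"
    by (rule ses_epic[OF s, of _ D']) (use u v in \<open>simp_all add: ringoid_simps\<close>)
  have uv: "u \<cdot> v = Idn C D"
  proof -
    have "\<exists>!w. w \<in> mor C D D \<and> w \<cdot> p = p" using k p assms(2) unfolding is_cokernel_def by (simp add: mor_iff)
    moreover have "u \<cdot> v \<in> mor C D D" "u \<cdot> v \<cdot> p = p" "Idn C D \<in> mor C D D" "Idn C D \<cdot> p = p"
      using u v p assms(2) by (simp_all add: mor_iff ringoid_simps)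
    ultimately show ?thesis by blast
  qed
  have "(i, p) \<in> E"
  proof (rule iso_closed[OF s _ _ assms(2) _ _ _ _ _ ])
    show "iso_mor C D' D u" using u v uv vu assms(2) iso_mor_iff[of D' D u] by auto
    show "iso_mor C B B (Idn C B)" using iso_mor_iff[of B B "Idn C B"] by auto
    show "iso_mor C A A (Idn C A)" using iso_mor_iff[of A A "Idn C A"] by auto
  qed (use p u assms(2) in \<open>simp_all add: mor_iff\<close>)
  then show ?thesis unfolding ses_def using p assms(2) by (simp add: mor_iff)
qed

text \<open>Left exactness of \<open>Hom(P, -)\<close> is automatic, so only the lifting property remains.\<close>

lemma projectives_iff:
  "P \<in> projectives C E \<longleftrightarrow> P \<in> Obj C \<and>
    (\<forall>A i B p D t. ses C E A i B p D \<longrightarrow> t \<in> P \<leadsto> D \<longrightarrow> (\<exists>s \<in> P \<leadsto> B. p \<cdot> s = t))"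
proof (intro iffI conjI allI impI)
  assume P: "P \<in> projectives C E"
  then show PO: "P \<in> Obj C" by (simp add: projectives_def)
  fix A i B p D t assume s: "ses C E A i B p D" and t: "t \<in> P \<leadsto> D"
  have "short_exact_sequence (Hom C P D) (Hom C P B) (Hom C P A) (\<lambda>t. p \<cdot> t) (\<lambda>t. i \<cdot> t)"
    using P s unfolding projectives_def by blast
  then have "(\<lambda>t. p \<cdot> t) \<in> epi (Hom C P B) (Hom C P D)" by (simp only: short_exact_sequence_iff)
  then have "(\<lambda>t. p \<cdot> t) ` mor C P B = mor C P D" by (simp add: epi_def)
  moreover have "t \<in> mor C P D" using t by (simp add: mor_iff)
  ultimately have "t \<in> (\<lambda>t. p \<cdot> t) ` mor C P B" by blast
  then obtain u where u: "u \<in> mor C P B" "p \<cdot> u = t" by blast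
  then have "u \<in> P \<leadsto> B" using PO sesD(5)[OF s] by (simp add: mor_iff)
  then show "\<exists>s \<in> P \<leadsto> B. p \<cdot> s = t" using u(2) by blast
next
  assume a: "P \<in> Obj C \<and> (\<forall>A i B p D t. ses C E A i B p D \<longrightarrow> t \<in> P \<leadsto> D \<longrightarrow> (\<exists>s \<in> P \<leadsto> B. p \<cdot> s = t))"
  then have PO: "P \<in> Obj C" by blast
  have "short_exact_sequence (Hom C P D) (Hom C P B) (Hom C P A) (\<lambda>t. p \<cdot> t) (\<lambda>t. i \<cdot> t)"
    if s: "ses C E A i B p D" for A i B p D
  proof -
    note S = sesD[OF s]
    note [simp] = S(4-12)
    interpret D: comm_group "Hom C P D" using PO by (intro Hom_comm_group) simp_all
    interpret B: comm_group "Hom C P B" using PO by (intro Hom_comm_group) simp_all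
    interpret A: comm_group "Hom C P A" using PO by (intro Hom_comm_group) simp_all
    have h1: "(\<lambda>t. p \<cdot> t) \<in> hom (Hom C P B) (Hom C P D)"
      using PO by (intro homI) (auto simp: mor_iff Hom_mult_addm ringoid_simps)
    have h2: "(\<lambda>t. i \<cdot> t) \<in> hom (Hom C P A) (Hom C P B)"
      using PO by (intro homI) (auto simp: mor_iff Hom_mult_addm ringoid_simps)
    have e: "(\<lambda>t. p \<cdot> t) ` mor C P B = mor C P D"
    proof
      show "(\<lambda>t. p \<cdot> t) ` mor C P B \<subseteq> mor C P D" using PO by (auto simp: mor_iff)
      show "mor C P D \<subseteq> (\<lambda>t. p \<cdot> t) ` mor C P B"
      proof
        fix t assume "t \<in> mor C P D"
        then have "t \<in> P \<leadsto> D" using PO by (simp add: mor_iff)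
        then obtain u where "u \<in> P \<leadsto> B" "p \<cdot> u = t" using a s by blast
        then show "t \<in> (\<lambda>t. p \<cdot> t) ` mor C P B" using PO by (auto simp: mor_iff)
      qed
    qed
    have inj: "inj_on (\<lambda>t. i \<cdot> t) (mor C P A)"
      by (rule inj_onI, rule ses_monic[OF s, of _ P]) (use PO in \<open>simp_all add: mor_iff\<close>)
    have k: "kernel (Hom C P B) (Hom C P D) (\<lambda>t. p \<cdot> t) = (\<lambda>t. i \<cdot> t) ` mor C P A"
    proof
      show "(\<lambda>t. i \<cdot> t) ` mor C P A \<subseteq> kernel (Hom C P B) (Hom C P D) (\<lambda>t. p \<cdot> t)"
        using PO by (auto simp: kernel_def mor_iff Cmp_reassoc[OF S(3)])
      show "kernel (Hom C P B) (Hom C P D) (\<lambda>t. p \<cdot> t) \<subseteq> (\<lambda>t. i \<cdot> t) ` mor C P A"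
      proof
        fix t assume "t \<in> kernel (Hom C P B) (Hom C P D) (\<lambda>t. p \<cdot> t)"
        then have "t \<in> P \<leadsto> B" "p \<cdot> t = zmor C P D" using PO by (simp_all add: kernel_def mor_iff)
        then obtain u where "u \<in> P \<leadsto> A" "i \<cdot> u = t" by (rule ses_lift[OF s])
        then show "t \<in> (\<lambda>t. i \<cdot> t) ` mor C P A" using PO by (auto simp: mor_iff)
      qed
    qed
    have g: "group (Hom C P A)" "group (Hom C P B)" "group (Hom C P D)" by unfold_locales
    have 1: "group_hom (Hom C P A) (Hom C P B) (\<lambda>t. i \<cdot> t)"
      using g h2 by (simp add: group_hom_def group_hom_axioms_def)
    show ?thesis unfolding short_exact_sequence_iff epi_def mon_def
      using 1 h1 h2 e inj k g by simp
  qed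
  then show "P \<in> projectives C E" using PO unfolding projectives_def by blast
qed

lemma projective_Obj: "P \<in> projectives C E \<Longrightarrow> P \<in> Obj C"
  by (simp add: projectives_def)

lemma projective_lift:
  assumes "P \<in> projectives C E" "ses C E A i B p D" "t \<in> P \<leadsto> D"
  obtains s where "s \<in> P \<leadsto> B" "p \<cdot> s = t"
  using assms unfolding projectives_iff by blast

lemma pullbackE:
  assumes pb: "is_pullback C B D B' D' p f f' p'" and o: "B \<in> Obj C" "D \<in> Obj C" "B' \<in> Obj C" "D' \<in> Obj C"
  shows "p \<in> B \<leadsto> D" "f \<in> D' \<leadsto> D" "f' \<in> B' \<leadsto> B" "p' \<in> B' \<leadsto> D'" "p \<cdot> f' = f \<cdot> p'"
    and "\<lbrakk>u \<in> T \<leadsto> B; v \<in> T \<leadsto> D'; p \<cdot> u = f \<cdot> v\<rbrakk> \<Longrightarrow> \<exists>w \<in> T \<leadsto> B'. f' \<cdot> w = u \<and> p' \<cdot> w = v"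
    and "\<lbrakk>w \<in> T \<leadsto> B'; w' \<in> T \<leadsto> B'; f' \<cdot> w = f' \<cdot> w'; p' \<cdot> w = p' \<cdot> w'\<rbrakk> \<Longrightarrow> w = w'"
proof -
  show t: "p \<in> B \<leadsto> D" "f \<in> D' \<leadsto> D" "f' \<in> B' \<leadsto> B" "p' \<in> B' \<leadsto> D'" "p \<cdot> f' = f \<cdot> p'"
    using pb o unfolding is_pullback_def by (simp_all add: mor_iff)
  have U: "\<exists>!w. w \<in> mor C T B' \<and> f' \<cdot> w = u \<and> p' \<cdot> w = v"
    if "u \<in> T \<leadsto> B" "v \<in> T \<leadsto> D'" "p \<cdot> u = f \<cdot> v" for u v T
  proof -
    have "T \<in> Obj C" "u \<in> mor C T B" "v \<in> mor C T D'" using that by (simp_all add: mor_iff)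
    then show ?thesis using pb that(3) unfolding is_pullback_def by blast
  qed
  show "\<exists>w \<in> T \<leadsto> B'. f' \<cdot> w = u \<and> p' \<cdot> w = v" if a: "u \<in> T \<leadsto> B" "v \<in> T \<leadsto> D'" "p \<cdot> u = f \<cdot> v"
  proof -
    obtain w where "w \<in> mor C T B'" "f' \<cdot> w = u" "p' \<cdot> w = v" using U[OF a] by blast
    moreover have "w \<in> T \<leadsto> B'" using calculation(1) a(1) o by (simp add: mor_iff)
    ultimately show ?thesis by blast
  qed
  show "w = w'" if a: "w \<in> T \<leadsto> B'" "w' \<in> T \<leadsto> B'" "f' \<cdot> w = f' \<cdot> w'" "p' \<cdot> w = p' \<cdot> w'"
  proof -
    have "p \<cdot> (f' \<cdot> w) = f \<cdot> (p' \<cdot> w)" using t a by (simp add: Cmp_reassoc[OF t(5)] ringoid_simps)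
    then have "\<exists>!x. x \<in> mor C T B' \<and> f' \<cdot> x = f' \<cdot> w \<and> p' \<cdot> x = p' \<cdot> w"
      using U[of "f' \<cdot> w" T "p' \<cdot> w"] t a by simp
    moreover have "w \<in> mor C T B'" "w' \<in> mor C T B'" using a by (simp_all add: mor_iff)
    ultimately show ?thesis using a(3,4) by metis
  qed
qed

lemma pushoutE:
  assumes pb: "is_pushout C A B A' B' i f f' i'" and o: "A \<in> Obj C" "B \<in> Obj C" "A' \<in> Obj C" "B' \<in> Obj C"
  shows "i \<in> A \<leadsto> B" "f \<in> A \<leadsto> A'" "f' \<in> B \<leadsto> B'" "i' \<in> A' \<leadsto> B'" "f' \<cdot> i = i' \<cdot> f"
    and "\<lbrakk>u \<in> B \<leadsto> T; v \<in> A' \<leadsto> T; u \<cdot> i = v \<cdot> f\<rbrakk> \<Longrightarrow> \<exists>w \<in> B' \<leadsto> T. w \<cdot> f' = u \<and> w \<cdot> i' = v"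
    and "\<lbrakk>w \<in> B' \<leadsto> T; w' \<in> B' \<leadsto> T; w \<cdot> f' = w' \<cdot> f'; w \<cdot> i' = w' \<cdot> i'\<rbrakk> \<Longrightarrow> w = w'"
proof -
  show t: "i \<in> A \<leadsto> B" "f \<in> A \<leadsto> A'" "f' \<in> B \<leadsto> B'" "i' \<in> A' \<leadsto> B'" "f' \<cdot> i = i' \<cdot> f"
    using pb o unfolding is_pushout_def by (simp_all add: mor_iff)
  have U: "\<exists>!w. w \<in> mor C B' T \<and> w \<cdot> f' = u \<and> w \<cdot> i' = v"
    if "u \<in> B \<leadsto> T" "v \<in> A' \<leadsto> T" "u \<cdot> i = v \<cdot> f" for u v T
  proof -
    have "T \<in> Obj C" "u \<in> mor C B T" "v \<in> mor C A' T" using that by (simp_all add: mor_iff)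
    then show ?thesis using pb that(3) unfolding is_pushout_def by blast
  qed
  show "\<exists>w \<in> B' \<leadsto> T. w \<cdot> f' = u \<and> w \<cdot> i' = v" if a: "u \<in> B \<leadsto> T" "v \<in> A' \<leadsto> T" "u \<cdot> i = v \<cdot> f"
  proof -
    obtain w where "w \<in> mor C B' T" "w \<cdot> f' = u" "w \<cdot> i' = v" using U[OF a] by blast
    moreover have "w \<in> B' \<leadsto> T" using calculation(1) a(1) o by (simp add: mor_iff)
    ultimately show ?thesis by blast
  qed
  show "w = w'" if a: "w \<in> B' \<leadsto> T" "w' \<in> B' \<leadsto> T" "w \<cdot> f' = w' \<cdot> f'" "w \<cdot> i' = w' \<cdot> i'"
  proof -
    have "w \<cdot> (f' \<cdot> i) = w \<cdot> (i' \<cdot> f)" using t(5) by simp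
    then have "(w \<cdot> f') \<cdot> i = (w \<cdot> i') \<cdot> f" using t a by (simp add: ringoid_simps)
    then have "\<exists>!x. x \<in> mor C B' T \<and> x \<cdot> f' = w \<cdot> f' \<and> x \<cdot> i' = w \<cdot> i'"
      using U[of "w \<cdot> f'" T "w \<cdot> i'"] t a by simp
    moreover have "w \<in> mor C B' T" "w' \<in> mor C B' T" using a by (simp_all add: mor_iff)
    ultimately show ?thesis using a(3,4) by metis
  qed
qed

text \<open>The replacement for the connecting homomorphism. Form the pullback \<open>W\<close> of \<open>q : Q \<rightarrow> D\<close> along \<open>g : B \<rightarrow> D\<close>. Its
projection to \<open>B\<close> is an admissible epic with the same kernel \<open>K\<close> as \<open>q\<close>; its projection to \<open>Q\<close> has kernel \<open>A\<close>
and splits since \<open>Q\<close> is projective, so \<open>W\<close> is \<open>A \<oplus> Q\<close>.\<close>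

lemma rotation:
  assumes s: "ses C E A f B g D" and s': "ses C E K j Q q D" and Q: "Q \<in> projectives C E"
  shows "\<exists>W k w. direct_sum C W [A, Q] \<and> ses C E K k W w B"
proof -
  note S = sesD[OF s] and S' = sesD[OF s']
  note [simp] = S(4-12) S'(4-12)
  have "adm_epic C E Q D q" using s' unfolding adm_epic_def by blast
  then have "\<exists>W \<in> Obj C. \<exists>p2 w. is_pullback C Q D W B q g p2 w \<and> adm_epic C E W B w"
    using S(2) by (intro ex_pullback) (simp_all add: mor_iff)
  then obtain W p2 w where W: "W \<in> Obj C" and pb: "is_pullback C Q D W B q g p2 w" and ae: "adm_epic C E W B w"
    by blast
  note PB = pullbackE[OF pb S'(5,6) W S(5)]
  have t: "arr C p2" "arr C w" "src C p2 = W" "tgt C p2 = Q" "src C w = W" "tgt C w = B" using PB by simp_all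
  note [simp] = t W
  obtain l where l: "l \<in> Q \<leadsto> B" "g \<cdot> l = q" using projective_lift[OF Q s S'(2)] .
  have "\<exists>b \<in> Q \<leadsto> W. p2 \<cdot> b = Idn C Q \<and> w \<cdot> b = l" by (rule PB(6)) (use l in simp_all)
  then obtain b where b: "b \<in> Q \<leadsto> W" "p2 \<cdot> b = Idn C Q" "w \<cdot> b = l" by blast
  have "\<exists>u \<in> A \<leadsto> W. p2 \<cdot> u = zmor C A Q \<and> w \<cdot> u = f" by (rule PB(6)) (use S(3) in simp_all)
  then obtain u where u: "u \<in> A \<leadsto> W" "p2 \<cdot> u = zmor C A Q" "w \<cdot> u = f" by blast
  have "\<exists>k \<in> K \<leadsto> W. p2 \<cdot> k = j \<and> w \<cdot> k = zmor C K B" by (rule PB(6)) (use S'(3) in simp_all)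
  then obtain k where k: "k \<in> K \<leadsto> W" "p2 \<cdot> k = j" "w \<cdot> k = zmor C K B" by blast
  have bt: "arr C b" "src C b = Q" "tgt C b = W" "arr C u" "src C u = A" "tgt C u = W"
    "arr C k" "src C k = K" "tgt C k = W" "arr C l" "src C l = Q" "tgt C l = B" using b u k l by simp_all
  note [simp] = bt
  \<comment> \<open>The idempotent complementary to the section \<open>b\<close> of \<open>p2\<close>; it factors through \<open>A\<close>.\<close>
  define x where "x = Idn C W \<boxplus> \<boxminus> (b \<cdot> p2)"
  have x: "arr C x" "src C x = W" "tgt C x = W" unfolding x_def by simp_all
  note [simp] = x
  have p2x: "p2 \<cdot> x = zmor C W Q" unfolding x_def by (simp add: ringoid_simps Cmp_reassoc[OF b(2)])
  have xb: "x \<cdot> b = zmor C Q W" unfolding x_def by (simp add: ringoid_simps b)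
  have xu: "x \<cdot> u = u" unfolding x_def by (simp add: ringoid_simps u)
  have "g \<cdot> (w \<cdot> x) = g \<cdot> w \<cdot> x" by (simp add: Cmp_assoc')
  also have "\<dots> = q \<cdot> p2 \<cdot> x" by (simp only: PB(5))
  also have "\<dots> = zmor C W D" by (simp add: Cmp_assoc' p2x)
  finally have "g \<cdot> (w \<cdot> x) = zmor C W D" .
  then obtain v where v: "v \<in> W \<leadsto> A" "f \<cdot> v = w \<cdot> x" by (rule ses_lift[OF s, rotated]) simp_all
  have vt: "arr C v" "src C v = W" "tgt C v = A" using v by simp_all
  note [simp] = vt
  have vu: "v \<cdot> u = Idn C A"
    by (rule ses_monic[OF s, of _ A]) (simp_all add: Cmp_reassoc[OF v(2)] ringoid_simps xu u)
  have vb: "v \<cdot> b = zmor C Q A"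
    by (rule ses_monic[OF s, of _ Q]) (simp_all add: Cmp_reassoc[OF v(2)] ringoid_simps xb)
  have uv: "u \<cdot> v = x"
    by (rule PB(7)[of _ W]) (simp_all add: Cmp_reassoc[OF u(2)] Cmp_reassoc[OF u(3)] p2x v(2))
  have "u \<cdot> v \<boxplus> b \<cdot> p2 = Idn C W" unfolding uv x_def by (simp add: addm_assoc)
  then have "biprod2 C W A Q u v b p2" unfolding biprod2_def using vu vb u(2) b(2) by simp
  moreover have "is_kernel C K k W w B"
  proof (rule is_kernelI)
    fix T t assume t: "t \<in> T \<leadsto> W" "w \<cdot> t = zmor C T B"
    have tt: "arr C t" "src C t = T" "tgt C t = W" "T \<in> Obj C" using t by simp_all
    note [simp] = tt
    have "q \<cdot> (p2 \<cdot> t) = zmor C T D" by (simp add: Cmp_reassoc[OF PB(5)] ringoid_simps t(2))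
    then obtain m where m: "m \<in> T \<leadsto> K" "j \<cdot> m = p2 \<cdot> t" by (rule ses_lift[OF s', rotated]) simp_all
    have "k \<cdot> m = t"
      by (rule PB(7)[of _ T]) (use m t in \<open>simp_all add: Cmp_reassoc[OF k(2)] Cmp_reassoc[OF k(3)]\<close>)
    then show "\<exists>m \<in> T \<leadsto> K. k \<cdot> m = t" using m by blast
  next
    fix T m m' assume m: "m \<in> T \<leadsto> K" "m' \<in> T \<leadsto> K" "k \<cdot> m = k \<cdot> m'"
    have "p2 \<cdot> (k \<cdot> m) = p2 \<cdot> (k \<cdot> m')" using m by simp
    then have "j \<cdot> m = j \<cdot> m'" using m(1,2) by (simp add: Cmp_reassoc[OF k(2)])
    then show "m = m'" by (rule ses_monic[OF s' m(1,2)])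
  qed (use k in simp_all)
  ultimately show ?thesis using adm_epic_kernel_ses[OF ae S'(4)] unfolding direct_sum_two by blast
qed

text \<open>Pushing out an admissible monic does not change its cokernel.\<close>

lemma pushout_ses:
  assumes s: "ses C E A i B p D" and k: "k \<in> A \<leadsto> A'"
  shows "\<exists>B' k' i' p'. B' \<in> Obj C \<and> is_pushout C A B A' B' i k k' i' \<and> ses C E A' i' B' p' D \<and> p' \<cdot> k' = p"
proof -
  note S = sesD[OF s]
  note [simp] = S(4-12)
  have kt: "arr C k" "src C k = A" "tgt C k = A'" "A' \<in> Obj C" using k by simp_all
  note [simp] = kt
  have "adm_monic C E A B i" using s unfolding adm_monic_def by blast
  then have "\<exists>B' \<in> Obj C. \<exists>k' i'. is_pushout C A B A' B' i k k' i' \<and> adm_monic C E A' B' i'"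
    by (rule ex_pushout) (simp_all add: mor_iff)
  then obtain B' k' i' where o: "B' \<in> Obj C" and po: "is_pushout C A B A' B' i k k' i'"
    and am: "adm_monic C E A' B' i'" by blast
  note PO = pushoutE[OF po S(4,5) kt(4) o]
  have t: "arr C k'" "src C k' = B" "tgt C k' = B'" "arr C i'" "src C i' = A'" "tgt C i' = B'" using PO by simp_all
  note [simp] = t o
  have "\<exists>p' \<in> B' \<leadsto> D. p' \<cdot> k' = p \<and> p' \<cdot> i' = zmor C A' D" by (rule PO(6)) (use S(3) in simp_all)
  then obtain p' where p': "p' \<in> B' \<leadsto> D" "p' \<cdot> k' = p" "p' \<cdot> i' = zmor C A' D" by blast
  have pt: "arr C p'" "src C p' = B'" "tgt C p' = D" using p' by simp_all
  note [simp] = pt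
  have "is_cokernel C A' i' B' p' D"
  proof (rule is_cokernelI)
    fix T t assume t: "t \<in> B' \<leadsto> T" "t \<cdot> i' = zmor C A' T"
    have tt: "arr C t" "src C t = B'" "tgt C t = T" "T \<in> Obj C" using t by simp_all
    note [simp] = tt
    have "t \<cdot> k' \<cdot> i = zmor C A T" by (simp add: ringoid_simps PO(5) Cmp_reassoc[OF t(2)])
    then obtain u where u: "u \<in> D \<leadsto> T" "u \<cdot> p = t \<cdot> k'" by (rule ses_extend[OF s, rotated]) simp_all
    have "u \<cdot> p' = t"
      by (rule PO(7)[of _ T]) (use u t in \<open>simp_all add: ringoid_simps p'\<close>)
    then show "\<exists>u \<in> D \<leadsto> T. u \<cdot> p' = t" using u by blast
  next
    fix T u v assume u: "u \<in> D \<leadsto> T" "v \<in> D \<leadsto> T" "u \<cdot> p' = v \<cdot> p'"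
    have "u \<cdot> p' \<cdot> k' = v \<cdot> p' \<cdot> k'" using u by simp
    then have "u \<cdot> p = v \<cdot> p" using u(1,2) by (simp add: ringoid_simps p')
    then show "u = v" by (rule ses_epic[OF s u(1,2)])
  qed (use p' in simp_all)
  then have "ses C E A' i' B' p' D" by (rule adm_monic_cokernel_ses[OF am S(6)])
  then show ?thesis using o po p'(2) by blast
qed

text \<open>The third isomorphism theorem: for \<open>A \<rightarrow> B \<rightarrow> B'\<close> the quotient \<open>B'/A\<close> is an extension of \<open>B'/B\<close> by \<open>B/A\<close>. The
pushout of \<open>B \<rightarrow> B'\<close> along \<open>B \<rightarrow> B/A\<close> has both required universal properties.\<close>

lemma noether_ses:
  assumes s: "ses C E A f B p D" and s': "ses C E B g B' q F"
  shows "\<exists>G c m h. ses C E A (g \<cdot> f) B' c G \<and> ses C E D m G h F"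
proof -
  note S = sesD[OF s] and S' = sesD[OF s']
  note [simp] = S(4-12) S'(4-12)
  obtain G c m h where G: "G \<in> Obj C" and po: "is_pushout C B B' D G g p c m"
    and s'': "ses C E D m G h F" using pushout_ses[OF s' S(2)] by blast
  note PO = pushoutE[OF po S(5) S'(5) S(6) G]
  have t: "arr C c" "src C c = B'" "tgt C c = G" "arr C m" "src C m = D" "tgt C m = G" using PO by simp_all
  note [simp] = t G
  have "adm_monic C E A B f" "adm_monic C E B B' g" using s s' unfolding adm_monic_def by blast+
  then have am: "adm_monic C E A B' (g \<cdot> f)" by (rule adm_monic_Cmp)
  have "is_cokernel C A (g \<cdot> f) B' c G"
  proof (rule is_cokernelI)
    show "c \<cdot> (g \<cdot> f) = zmor C A G" by (simp add: Cmp_reassoc[OF PO(5)] ringoid_simps S(3))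
  next
    fix T t assume t: "t \<in> B' \<leadsto> T" "t \<cdot> (g \<cdot> f) = zmor C A T"
    have tt: "arr C t" "src C t = B'" "tgt C t = T" "T \<in> Obj C" using t by simp_all
    note [simp] = tt
    have "t \<cdot> g \<cdot> f = zmor C A T" using t(2) by (simp add: ringoid_simps)
    then obtain v where v: "v \<in> D \<leadsto> T" "v \<cdot> p = t \<cdot> g" by (rule ses_extend[OF s, rotated]) simp_all
    have "\<exists>w \<in> G \<leadsto> T. w \<cdot> c = t \<and> w \<cdot> m = v" by (rule PO(6)) (use v t in simp_all)
    then show "\<exists>u \<in> G \<leadsto> T. u \<cdot> c = t" by blast
  next
    fix T u v assume u: "u \<in> G \<leadsto> T" "v \<in> G \<leadsto> T" "u \<cdot> c = v \<cdot> c"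
    have "u \<cdot> c \<cdot> g = v \<cdot> c \<cdot> g" using u by simp
    then have "u \<cdot> m \<cdot> p = v \<cdot> m \<cdot> p" using u(1,2) by (simp add: ringoid_simps PO(5))
    then have "u \<cdot> m = v \<cdot> m" using ses_epic[OF s, of "u \<cdot> m" T "v \<cdot> m"] u(1,2) by simp
    then show "u = v" using PO(7)[OF u(1,2,3)] by simp
  qed simp_all
  then have "ses C E A (g \<cdot> f) B' c G" by (rule adm_monic_cokernel_ses[OF am G])
  then show ?thesis using s'' by blast
qed

end

section \<open>The stable category as a preadditive category\<close>

context exact_category
begin

text \<open>The morphisms that vanish in the stable category.\<close>

definition proj_factors :: "'m \<Rightarrow> bool" where
  "proj_factors f \<longleftrightarrow> arr C f \<and> (\<exists>P \<in> projectives C E. \<exists>a \<in> src C f \<leadsto> P. \<exists>b \<in> P \<leadsto> tgt C f. b \<cdot> a = f)"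

lemma proj_factorsE:
  assumes "proj_factors f"
  obtains P a b where "P \<in> projectives C E" "a \<in> src C f \<leadsto> P" "b \<in> P \<leadsto> tgt C f" "b \<cdot> a = f"
  using assms unfolding proj_factors_def by blast

lemma proj_factorsI:
  assumes "P \<in> projectives C E" "a \<in> X \<leadsto> P" "b \<in> P \<leadsto> Y" shows "proj_factors (b \<cdot> a)"
proof -
  have "a \<in> src C (b \<cdot> a) \<leadsto> P" "b \<in> P \<leadsto> tgt C (b \<cdot> a)" "arr C (b \<cdot> a)" using assms(2,3) by simp_all
  then show ?thesis unfolding proj_factors_def using assms(1) by blast
qed

lemma proj_factors_arr: "proj_factors f \<Longrightarrow> arr C f"
  by (simp add: proj_factors_def)

lemma zero_object_projective:
  assumes z: "zero_object C Z" shows "Z \<in> projectives C E"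
  unfolding projectives_iff
proof (intro conjI allI impI)
  show Z: "Z \<in> Obj C" using z by (rule zero_objectD)
  fix A i B p D t assume s: "ses C E A i B p D" and t: "t \<in> Z \<leadsto> D"
  note [simp] = sesD(4-12)[OF s]
  have "p \<cdot> zmor C Z B = t" using zero_object_maps[OF z t] Z by simp
  moreover have "zmor C Z B \<in> Z \<leadsto> B" using Z by simp
  ultimately show "\<exists>s \<in> Z \<leadsto> B. p \<cdot> s = t" by blast
qed

lemma projective_retract:
  assumes "retract C X P" "P \<in> projectives C E" shows "X \<in> projectives C E"
  unfolding projectives_iff
proof (intro conjI allI impI)
  obtain u r where u: "u \<in> X \<leadsto> P" "r \<in> P \<leadsto> X" "r \<cdot> u = Idn C X" using assms(1) unfolding retract_def by blast
  show "X \<in> Obj C" using u by simp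
  fix A i B p D t assume s: "ses C E A i B p D" and t: "t \<in> X \<leadsto> D"
  note [simp] = sesD(4-12)[OF s]
  have "t \<cdot> r \<in> P \<leadsto> D" using t u by simp
  then obtain v where v: "v \<in> P \<leadsto> B" "p \<cdot> v = t \<cdot> r" by (rule projective_lift[OF assms(2) s])
  have "p \<cdot> (v \<cdot> u) = t \<cdot> r \<cdot> u" using v u t by (simp add: Cmp_reassoc[OF v(2)])
  also have "\<dots> = t" using u t by (simp add: ringoid_simps)
  finally have "p \<cdot> (v \<cdot> u) = t" .
  moreover have "v \<cdot> u \<in> X \<leadsto> B" using v u by simp
  ultimately show "\<exists>s \<in> X \<leadsto> B. p \<cdot> s = t" by blast
qed

lemma projective_direct_sum:
  assumes "direct_sum C S [P, Q]" "P \<in> projectives C E" "Q \<in> projectives C E"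
  shows "S \<in> projectives C E"
  unfolding projectives_iff
proof (intro conjI allI impI)
  obtain i1 p1 i2 p2 where b: "biprod2 C S P Q i1 p1 i2 p2" using assms(1) unfolding direct_sum_two by blast
  note B = biprod2D[OF b]
  note [simp] = B(10-)
  show "S \<in> Obj C" by simp
  fix A i B' p D t assume s: "ses C E A i B' p D" and t: "t \<in> S \<leadsto> D"
  note [simp] = sesD(4-12)[OF s]
  have tt: "t \<cdot> i1 \<in> P \<leadsto> D" "t \<cdot> i2 \<in> Q \<leadsto> D" using t by simp_all
  obtain v where v: "v \<in> P \<leadsto> B'" "p \<cdot> v = t \<cdot> i1" using projective_lift[OF assms(2) s tt(1)] .
  obtain w where w: "w \<in> Q \<leadsto> B'" "p \<cdot> w = t \<cdot> i2" using projective_lift[OF assms(3) s tt(2)] .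
  have "p \<cdot> (v \<cdot> p1 \<boxplus> w \<cdot> p2) = t \<cdot> (i1 \<cdot> p1 \<boxplus> i2 \<cdot> p2)"
    using v w t by (simp add: ringoid_simps Cmp_reassoc[OF v(2)] Cmp_reassoc[OF w(2)])
  also have "\<dots> = t" unfolding B(9) using t by simp
  finally have "p \<cdot> (v \<cdot> p1 \<boxplus> w \<cdot> p2) = t" .
  moreover have "v \<cdot> p1 \<boxplus> w \<cdot> p2 \<in> S \<leadsto> B'" using v w by simp
  ultimately show "\<exists>s \<in> S \<leadsto> B'. p \<cdot> s = t" by blast
qed

lemma proj_factors_zero: "X \<in> Obj C \<Longrightarrow> Y \<in> Obj C \<Longrightarrow> proj_factors (zmor C X Y)"
proof -
  assume o: "X \<in> Obj C" "Y \<in> Obj C"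
  obtain Z where z: "zero_object C Z" using ex_zero_object by blast
  have Z: "Z \<in> Obj C" using z by (rule zero_objectD)
  have "proj_factors (zmor C Z Y \<cdot> zmor C X Z)"
    by (rule proj_factorsI[OF zero_object_projective[OF z], of _ X _ Y]) (use o Z in simp_all)
  then show ?thesis using o Z by simp
qed

lemma proj_factors_add:
  assumes "proj_factors f" "proj_factors g" "src C f = src C g" "tgt C f = tgt C g" shows "proj_factors (f \<boxplus> g)"
proof -
  obtain P a b where 1: "P \<in> projectives C E" "a \<in> src C f \<leadsto> P" "b \<in> P \<leadsto> tgt C f" "b \<cdot> a = f"
    using proj_factorsE[OF assms(1)] .
  obtain Q c d where 2: "Q \<in> projectives C E" "c \<in> src C g \<leadsto> Q" "d \<in> Q \<leadsto> tgt C g" "d \<cdot> c = g"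
    using proj_factorsE[OF assms(2)] .
  obtain S where S: "direct_sum C S [P, Q]" using ex_direct_sum projective_Obj 1(1) 2(1) by blast
  obtain i1 p1 i2 p2 where bp: "biprod2 C S P Q i1 p1 i2 p2" using S unfolding direct_sum_two by blast
  note B = biprod2D[OF bp]
  note [simp] = B(10-)
  have "proj_factors ((b \<cdot> p1 \<boxplus> d \<cdot> p2) \<cdot> (i1 \<cdot> a \<boxplus> i2 \<cdot> c))"
    by (rule proj_factorsI[OF projective_direct_sum[OF S 1(1) 2(1)], of _ "src C f" _ "tgt C f"])
      (use 1 2 assms(3,4) in simp_all)
  moreover have "(b \<cdot> p1 \<boxplus> d \<cdot> p2) \<cdot> (i1 \<cdot> a \<boxplus> i2 \<cdot> c) = f \<boxplus> g"
    using 1(2-) 2(2-) assms(3,4) proj_factors_arr[OF assms(1)] proj_factors_arr[OF assms(2)]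
    by (simp add: ringoid_simps Cmp_reassoc[OF B(5)] Cmp_reassoc[OF B(6)] Cmp_reassoc[OF B(7)] Cmp_reassoc[OF B(8)])
  ultimately show ?thesis by simp
qed

lemma proj_factors_Cmp_left:
  assumes "proj_factors f" "arr C g" "tgt C f = src C g" shows "proj_factors (g \<cdot> f)"
proof -
  obtain P a b where 1: "P \<in> projectives C E" "a \<in> src C f \<leadsto> P" "b \<in> P \<leadsto> tgt C f" "b \<cdot> a = f"
    using proj_factorsE[OF assms(1)] .
  have "proj_factors ((g \<cdot> b) \<cdot> a)" by (rule proj_factorsI[OF 1(1), of _ "src C f" _ "tgt C g"]) (use 1 assms in simp_all)
  moreover have "(g \<cdot> b) \<cdot> a = g \<cdot> f" using 1(2-) assms(2,3) by (simp add: ringoid_simps)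
  ultimately show ?thesis by simp
qed

lemma proj_factors_Cmp_right:
  assumes "proj_factors f" "arr C g" "tgt C g = src C f" shows "proj_factors (f \<cdot> g)"
proof -
  obtain P a b where 1: "P \<in> projectives C E" "a \<in> src C f \<leadsto> P" "b \<in> P \<leadsto> tgt C f" "b \<cdot> a = f"
    using proj_factorsE[OF assms(1)] .
  have "proj_factors (b \<cdot> (a \<cdot> g))" by (rule proj_factorsI[OF 1(1), of _ "src C g" _ "tgt C f"]) (use 1 assms in simp_all)
  moreover have "b \<cdot> (a \<cdot> g) = f \<cdot> g" using 1(2-) assms(2,3) by (simp add: Cmp_reassoc[OF 1(4)])
  ultimately show ?thesis by simp
qed

lemma proj_factors_neg: assumes "proj_factors f" shows "proj_factors (\<boxminus> f)"
proof -
  have "proj_factors (\<boxminus> (Idn C (tgt C f)) \<cdot> f)"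
    by (rule proj_factors_Cmp_left[OF assms]) (use proj_factors_arr[OF assms] in simp_all)
  then show ?thesis using proj_factors_arr[OF assms] by simp
qed

lemma proj_factoring_iff:
  assumes "X \<in> Obj C" "Y \<in> Obj C"
  shows "f \<in> proj_factoring C E X Y \<longleftrightarrow> proj_factors f \<and> src C f = X \<and> tgt C f = Y"
proof
  assume "f \<in> proj_factoring C E X Y"
  then obtain P a b where P: "P \<in> projectives C E" and "a \<in> mor C X P" "b \<in> mor C P Y" and f: "f = b \<cdot> a"
    unfolding proj_factoring_def by blast
  then have t: "a \<in> X \<leadsto> P" "b \<in> P \<leadsto> Y" using projective_Obj[OF P] assms by (simp_all add: mor_iff)
  then have "proj_factors f" unfolding f by (rule proj_factorsI[OF P])
  then show "proj_factors f \<and> src C f = X \<and> tgt C f = Y" using t f by simp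
next
  assume a: "proj_factors f \<and> src C f = X \<and> tgt C f = Y"
  then obtain P a b where P: "P \<in> projectives C E" "a \<in> src C f \<leadsto> P" "b \<in> P \<leadsto> tgt C f" "b \<cdot> a = f"
    using proj_factorsE by blast
  then have "a \<in> mor C X P" "b \<in> mor C P Y" using a projective_Obj[OF P(1)] assms by (auto simp: mor_iff)
  then show "f \<in> proj_factoring C E X Y" unfolding proj_factoring_def using P by blast
qed

lemma subgroup_proj_factoring:
  assumes "X \<in> Obj C" "Y \<in> Obj C" shows "subgroup (proj_factoring C E X Y) (Hom C X Y)"
proof -
  interpret comm_group "Hom C X Y" using assms by (rule Hom_comm_group)
  show ?thesis
  proof (rule subgroupI)
    show "proj_factoring C E X Y \<subseteq> mor C X Y"
      using assms by (auto simp: proj_factoring_iff mor_iff proj_factors_arr)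
    show "proj_factoring C E X Y \<noteq> {}"
      using proj_factors_zero[OF assms] assms proj_factoring_iff[OF assms, of "zmor C X Y"] by auto
    show "inv\<^bsub>Hom C X Y\<^esub> f \<in> proj_factoring C E X Y" if f: "f \<in> proj_factoring C E X Y" for f
    proof -
      have t: "proj_factors f" "src C f = X" "tgt C f = Y" using f assms by (simp_all add: proj_factoring_iff)
      then have "inv\<^bsub>Hom C X Y\<^esub> f = \<boxminus> f" by (simp add: negm_def)
      then show ?thesis using t proj_factors_neg proj_factors_arr assms by (simp add: proj_factoring_iff)
    qed
    show "f \<otimes>\<^bsub>Hom C X Y\<^esub> g \<in> proj_factoring C E X Y"
      if "f \<in> proj_factoring C E X Y" "g \<in> proj_factoring C E X Y" for f g
      using that assms by (simp add: proj_factoring_iff Hom_mult_addm proj_factors_arr proj_factors_add)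
  qed
qed

text \<open>The class of a morphism in the stable category; \<open>cls\<close> is the quotient functor.\<close>

definition cls :: "'m \<Rightarrow> 'm set" where
  "cls f = proj_factoring C E (src C f) (tgt C f) #>\<^bsub>Hom C (src C f) (tgt C f)\<^esub> f"

abbreviation St :: "('o, 'm set) precategory" where "St \<equiv> stable_category C E"

lemma mem_cls:
  assumes "arr C f"
  shows "g \<in> cls f \<longleftrightarrow> arr C g \<and> src C g = src C f \<and> tgt C g = tgt C f \<and> proj_factors (g \<boxplus> \<boxminus> f)"
proof
  assume "g \<in> cls f"
  then obtain h where h: "h \<in> proj_factoring C E (src C f) (tgt C f)" "g = h \<otimes>\<^bsub>Hom C (src C f) (tgt C f)\<^esub> f"
    unfolding cls_def r_coset_def by blast
  then have t: "proj_factors h" "src C h = src C f" "tgt C h = tgt C f" using assms by (simp_all add: proj_factoring_iff)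
  have g: "g = h \<boxplus> f" using h(2) t proj_factors_arr by (simp add: Hom_mult_addm)
  have "g \<boxplus> \<boxminus> f = h" using t proj_factors_arr[OF t(1)] assms unfolding g by (simp add: addm_assoc)
  then show "arr C g \<and> src C g = src C f \<and> tgt C g = tgt C f \<and> proj_factors (g \<boxplus> \<boxminus> f)"
    using t proj_factors_arr[OF t(1)] assms g by simp
next
  assume a: "arr C g \<and> src C g = src C f \<and> tgt C g = tgt C f \<and> proj_factors (g \<boxplus> \<boxminus> f)"
  have "g = (g \<boxplus> \<boxminus> f) \<otimes>\<^bsub>Hom C (src C f) (tgt C f)\<^esub> f"
    using a assms by (simp add: Hom_mult_addm subtract_add_cancel)
  moreover have "g \<boxplus> \<boxminus> f \<in> proj_factoring C E (src C f) (tgt C f)"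
    using a assms by (simp add: proj_factoring_iff)
  ultimately show "g \<in> cls f" unfolding cls_def r_coset_def by blast
qed

lemma cls_eq_iff:
  assumes "arr C f" "arr C g" "src C f = src C g" "tgt C f = tgt C g"
  shows "cls f = cls g \<longleftrightarrow> proj_factors (f \<boxplus> \<boxminus> g)"
proof
  assume "cls f = cls g"
  moreover have "f \<in> cls f" using assms proj_factors_zero by (simp add: mem_cls)
  ultimately show "proj_factors (f \<boxplus> \<boxminus> g)" using assms by (simp add: mem_cls)
next
  have *: "cls f \<subseteq> cls g" if fg: "arr C f" "arr C g" "src C f = src C g" "tgt C f = tgt C g"
    and a: "proj_factors (f \<boxplus> \<boxminus> g)" for f g
  proof
    fix h assume "h \<in> cls f"
    then have h: "arr C h" "src C h = src C f" "tgt C h = tgt C f" "proj_factors (h \<boxplus> \<boxminus> f)" using fg by (simp_all add: mem_cls)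
    have "proj_factors ((h \<boxplus> \<boxminus> f) \<boxplus> (f \<boxplus> \<boxminus> g))" by (rule proj_factors_add) (use a fg h in simp_all)
    then show "h \<in> cls g" using h fg by (simp add: mem_cls addm_assoc)
  qed
  assume a: "proj_factors (f \<boxplus> \<boxminus> g)"
  have "proj_factors (\<boxminus> (f \<boxplus> \<boxminus> g))" using a by (rule proj_factors_neg)
  moreover have "\<boxminus> (f \<boxplus> \<boxminus> g) = g \<boxplus> \<boxminus> f" using assms by (simp add: addm_comm)
  ultimately have "proj_factors (g \<boxplus> \<boxminus> f)" by simp
  then show "cls f = cls g" using * a assms by (metis subset_antisym)
qed

lemma cls_self: "arr C f \<Longrightarrow> f \<in> cls f"
  using proj_factors_zero by (simp add: mem_cls)

lemma Obj_St [simp]: "Obj St = Obj C" by (simp add: stable_category_def)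

lemma Hom_St: "Hom St X Y = Hom C X Y Mod proj_factoring C E X Y" by (simp add: stable_category_def)

lemma mor_St:
  assumes "X \<in> Obj C" "Y \<in> Obj C" shows "mor St X Y = cls ` (X \<leadsto> Y)"
proof -
  have 1: "proj_factoring C E X Y #>\<^bsub>Hom C X Y\<^esub> f = cls f" if "f \<in> mor C X Y" for f
    using that assms by (simp add: cls_def mor_iff)
  have "mor C X Y = X \<leadsto> Y" using assms by (auto simp: mor_iff)
  then show ?thesis unfolding Hom_St carrier_FactGroup using 1 by force
qed

lemma mult_St:
  assumes "f \<in> X \<leadsto> Y" "g \<in> X \<leadsto> Y" shows "cls f \<otimes>\<^bsub>Hom St X Y\<^esub> cls g = cls (f \<boxplus> g)"
proof -
  have o: "X \<in> Obj C" "Y \<in> Obj C" using assms by simp_all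
  interpret comm_group "Hom C X Y" using o by (rule Hom_comm_group)
  interpret normal "proj_factoring C E X Y" "Hom C X Y"
    by (rule subgroup_imp_normal) (rule subgroup_proj_factoring[OF o])
  have "f \<in> mor C X Y" "g \<in> mor C X Y" using assms by (simp_all add: mor_iff)
  then show ?thesis using rcos_sum[of f g] assms by (simp add: Hom_St cls_def Hom_mult_addm)
qed

lemma one_St: assumes "X \<in> Obj C" "Y \<in> Obj C" shows "zmor St X Y = cls (zmor C X Y)"
proof -
  have "zmor St X Y = proj_factoring C E X Y" by (simp add: Hom_St)
  moreover have "\<dots> = cls (zmor C X Y)"
    by (rule Set.set_eqI) (use assms in \<open>auto simp: mem_cls proj_factoring_iff proj_factors_arr\<close>)
  ultimately show ?thesis by simp
qed

lemma Idn_St: "X \<in> Obj C \<Longrightarrow> Idn St X = cls (Idn C X)"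
  by (simp add: stable_category_def cls_def)

text \<open>The union that defines the composition is taken over equal cosets, because morphisms factoring through
projectives form an ideal.\<close>

lemma Cmp_St:
  assumes "arr C f" "arr C g" "tgt C f = src C g" shows "cls g \<cdot>\<^bsub>St\<^esub> cls f = cls (g \<cdot> f)"
proof -
  have 1: "proj_factoring C E X Z #>\<^bsub>Hom C X Z\<^esub> (g' \<cdot> f') = cls (g \<cdot> f)"
    if o: "X \<in> Obj C" "Y \<in> Obj C" "Z \<in> Obj C" and "f' \<in> cls f \<inter> mor C X Y" "g' \<in> cls g \<inter> mor C Y Z" for X Y Z f' g'
  proof -
    have f': "arr C f'" "src C f' = X" "tgt C f' = Y" "src C f = X" "tgt C f = Y" "proj_factors (f' \<boxplus> \<boxminus> f)"
      and g': "arr C g'" "src C g' = Y" "tgt C g' = Z" "src C g = Y" "tgt C g = Z" "proj_factors (g' \<boxplus> \<boxminus> g)"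
      using that assms by (auto simp: mem_cls mor_iff)
    have "proj_factors (g' \<cdot> (f' \<boxplus> \<boxminus> f) \<boxplus> (g' \<boxplus> \<boxminus> g) \<cdot> f)"
      by (rule proj_factors_add[OF proj_factors_Cmp_left[OF f'(6)] proj_factors_Cmp_right[OF g'(6)]]) (use f' g' assms in simp_all)
    also have "g' \<cdot> (f' \<boxplus> \<boxminus> f) \<boxplus> (g' \<boxplus> \<boxminus> g) \<cdot> f = g' \<cdot> f' \<boxplus> \<boxminus> (g \<cdot> f)"
      using f' g' assms by (simp add: ringoid_simps)
    finally have "cls (g' \<cdot> f') = cls (g \<cdot> f)" using f' g' assms by (subst cls_eq_iff) simp_all
    then show ?thesis using f' g' by (simp add: cls_def)
  qed
  let ?A = "{proj_factoring C E X Z #>\<^bsub>Hom C X Z\<^esub> (g' \<cdot> f') |X Y Z f' g'. X \<in> Obj C \<and> Y \<in> Obj C \<and> Z \<in> Obj C \<and>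
              f' \<in> cls f \<inter> mor C X Y \<and> g' \<in> cls g \<inter> mor C Y Z}"
  have m: "f \<in> cls f \<inter> mor C (src C f) (src C g)" "g \<in> cls g \<inter> mor C (src C g) (tgt C g)"
    using assms cls_self by (simp_all add: mor_iff)
  have "?A \<subseteq> {cls (g \<cdot> f)}" using 1 by blast
  moreover have "?A \<noteq> {}" using m assms src_Obj tgt_Obj by blast
  ultimately have "?A = {cls (g \<cdot> f)}" by blast
  then have "\<Union>?A = cls (g \<cdot> f)" by (simp only: cSup_singleton)
  then show ?thesis by (simp add: stable_category_def)
qed

lemma preadditive_St: "preadditive_category St"
proof (rule preadditive_category.intro)
  fix X Y assume o: "X \<in> Obj St" "Y \<in> Obj St"
  then interpret comm_group "Hom C X Y" by (intro Hom_comm_group) simp_all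
  show "comm_group (Hom St X Y)"
    unfolding Hom_St by (rule abelian_FactGroup) (use o in \<open>simp add: subgroup_proj_factoring\<close>)
next
  fix X Y X' Y' F assume o: "X \<in> Obj St" "Y \<in> Obj St" "X' \<in> Obj St" "Y' \<in> Obj St"
    and F: "F \<in> mor St X Y" "F \<in> mor St X' Y'"
  obtain f where f: "f \<in> X \<leadsto> Y" "F = cls f" using F(1) o by (auto simp: mor_St simp del: in_arrows)
  obtain g where g: "g \<in> X' \<leadsto> Y'" "F = cls g" using F(2) o by (auto simp: mor_St simp del: in_arrows)
  have "f \<in> cls f" using f(1) by (intro cls_self) simp
  then have "f \<in> cls g" by (simp only: f(2)[symmetric] g(2)[symmetric])
  then show "X = X' \<and> Y = Y'" using f(1) g(1) by (simp add: mem_cls)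
next
  fix X assume X: "X \<in> Obj St"
  then have "Idn C X \<in> X \<leadsto> X" by simp
  then have "cls (Idn C X) \<in> cls ` (X \<leadsto> X)" by (rule imageI)
  then show "Idn St X \<in> mor St X X" using X by (simp only: Idn_St mor_St Obj_St)
next
  fix X Y Z F G assume o: "X \<in> Obj St" "Y \<in> Obj St" "Z \<in> Obj St" and F: "F \<in> mor St X Y" "G \<in> mor St Y Z"
  obtain f where f: "f \<in> X \<leadsto> Y" "F = cls f" using F(1) o by (auto simp: mor_St simp del: in_arrows)
  obtain g where g: "g \<in> Y \<leadsto> Z" "G = cls g" using F(2) o by (auto simp: mor_St simp del: in_arrows)
  have "g \<cdot> f \<in> X \<leadsto> Z" using f g by simp
  then have "cls (g \<cdot> f) \<in> mor St X Z" using o by (simp only: mor_St Obj_St imageI)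
  then show "G \<cdot>\<^bsub>St\<^esub> F \<in> mor St X Z" using f g by (simp add: Cmp_St)
next
  fix W X Y Z F G H assume o: "W \<in> Obj St" "X \<in> Obj St" "Y \<in> Obj St" "Z \<in> Obj St"
    and F: "F \<in> mor St W X" "G \<in> mor St X Y" "H \<in> mor St Y Z"
  obtain f where f: "f \<in> W \<leadsto> X" "F = cls f" using F(1) o by (auto simp: mor_St simp del: in_arrows)
  obtain g where g: "g \<in> X \<leadsto> Y" "G = cls g" using F(2) o by (auto simp: mor_St simp del: in_arrows)
  obtain h where h: "h \<in> Y \<leadsto> Z" "H = cls h" using F(3) o by (auto simp: mor_St simp del: in_arrows)
  show "H \<cdot>\<^bsub>St\<^esub> G \<cdot>\<^bsub>St\<^esub> F = H \<cdot>\<^bsub>St\<^esub> (G \<cdot>\<^bsub>St\<^esub> F)" using f g h by (simp add: Cmp_St ringoid_simps)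
next
  fix X Y F assume o: "X \<in> Obj St" "Y \<in> Obj St" and F: "F \<in> mor St X Y"
  obtain f where f: "f \<in> X \<leadsto> Y" "F = cls f" using F o by (auto simp: mor_St simp del: in_arrows)
  show "F \<cdot>\<^bsub>St\<^esub> Idn St X = F" "Idn St Y \<cdot>\<^bsub>St\<^esub> F = F" using f o by (simp_all add: Idn_St Cmp_St)
next
  fix X Y Z F F' G assume o: "X \<in> Obj St" "Y \<in> Obj St" "Z \<in> Obj St"
    and F: "F \<in> mor St X Y" "F' \<in> mor St X Y" "G \<in> mor St Y Z"
  obtain f where f: "f \<in> X \<leadsto> Y" "F = cls f" using F(1) o by (auto simp: mor_St simp del: in_arrows)
  obtain f' where f': "f' \<in> X \<leadsto> Y" "F' = cls f'" using F(2) o by (auto simp: mor_St simp del: in_arrows)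
  obtain g where g: "g \<in> Y \<leadsto> Z" "G = cls g" using F(3) o by (auto simp: mor_St simp del: in_arrows)
  have "g \<cdot> f \<in> X \<leadsto> Z" "g \<cdot> f' \<in> X \<leadsto> Z" using f f' g by simp_all
  then show "G \<cdot>\<^bsub>St\<^esub> (F \<otimes>\<^bsub>Hom St X Y\<^esub> F') = (G \<cdot>\<^bsub>St\<^esub> F) \<otimes>\<^bsub>Hom St X Z\<^esub> (G \<cdot>\<^bsub>St\<^esub> F')"
    unfolding f(2) f'(2) g(2) mult_St[OF f(1) f'(1)]
    using f(1) f'(1) g(1) mult_St[of "g \<cdot> f" X Z "g \<cdot> f'"] by (simp add: Cmp_St ringoid_simps)
next
  fix X Y Z F G G' assume o: "X \<in> Obj St" "Y \<in> Obj St" "Z \<in> Obj St"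
    and F: "F \<in> mor St X Y" "G \<in> mor St Y Z" "G' \<in> mor St Y Z"
  obtain f where f: "f \<in> X \<leadsto> Y" "F = cls f" using F(1) o by (auto simp: mor_St simp del: in_arrows)
  obtain g where g: "g \<in> Y \<leadsto> Z" "G = cls g" using F(2) o by (auto simp: mor_St simp del: in_arrows)
  obtain g' where g': "g' \<in> Y \<leadsto> Z" "G' = cls g'" using F(3) o by (auto simp: mor_St simp del: in_arrows)
  have "g \<cdot> f \<in> X \<leadsto> Z" "g' \<cdot> f \<in> X \<leadsto> Z" using f g' g by simp_all
  then show "(G \<otimes>\<^bsub>Hom St Y Z\<^esub> G') \<cdot>\<^bsub>St\<^esub> F = (G \<cdot>\<^bsub>St\<^esub> F) \<otimes>\<^bsub>Hom St X Z\<^esub> (G' \<cdot>\<^bsub>St\<^esub> F)"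
    unfolding f(2) g'(2) g(2) mult_St[OF g(1) g'(1)]
    using f(1) g'(1) g(1) mult_St[of "g \<cdot> f" X Z "g' \<cdot> f"] by (simp add: Cmp_St ringoid_simps)
qed

end

sublocale exact_category \<subseteq> st: preadditive_category "stable_category C E"
  by (rule preadditive_St)

context exact_category
begin

lemma cls_arrows: "f \<in> X \<leadsto> Y \<Longrightarrow> cls f \<in> X \<leadsto>\<^bsub>St\<^esub> Y"
  by (rule st.arrowsI) (auto simp: mor_St)

lemma cls_arr [simp]:
  assumes "arr C f" shows "arr St (cls f)" "src St (cls f) = src C f" "tgt St (cls f) = tgt C f"
  using cls_arrows[of f "src C f" "tgt C f"] assms by simp_all

text \<open>The quotient functor is full: stable identities can be checked on representatives.\<close>

lemma st_arrowsE:
  assumes "F \<in> X \<leadsto>\<^bsub>St\<^esub> Y" obtains f where "f \<in> X \<leadsto> Y" "F = cls f"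
proof -
  have "F \<in> mor St X Y" "X \<in> Obj C" "Y \<in> Obj C" using st.arrowsD[OF assms] by simp_all
  then show ?thesis using that by (auto simp: mor_St simp del: in_arrows)
qed

lemma cls_Cmp: "\<lbrakk>arr C f; arr C g; tgt C f = src C g\<rbrakk> \<Longrightarrow> cls (g \<cdot> f) = cls g \<cdot>\<^bsub>St\<^esub> cls f"
  by (simp add: Cmp_St)

lemma cls_addm:
  assumes "arr C f" "arr C g" "src C f = src C g" "tgt C f = tgt C g"
  shows "cls (f \<boxplus> g) = cls f \<boxplus>\<^bsub>St\<^esub> cls g"
  using mult_St[of f "src C f" "tgt C f" g] assms by (simp add: st.Hom_mult_addm)

lemma cls_zero: "\<lbrakk>X \<in> Obj C; Y \<in> Obj C\<rbrakk> \<Longrightarrow> cls (zmor C X Y) = zmor St X Y"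
  by (simp add: one_St)

lemma cls_Idn: "X \<in> Obj C \<Longrightarrow> cls (Idn C X) = Idn St X"
  by (simp add: Idn_St)

lemma cls_neg: "arr C f \<Longrightarrow> cls (\<boxminus> f) = \<boxminus>\<^bsub>St\<^esub> (cls f)"
  by (rule st.neg_unique) (simp_all flip: cls_addm add: cls_zero)

lemmas cls_simps = cls_Cmp cls_addm cls_zero cls_Idn cls_neg

lemma cls_zero_iff: "\<lbrakk>arr C f; src C f = X; tgt C f = Y\<rbrakk> \<Longrightarrow> cls f = zmor St X Y \<longleftrightarrow> proj_factors f"
  using cls_eq_iff[of f "zmor C X Y"] by (auto simp: cls_zero)

lemma biprod2_cls: "biprod2 C S X Y i p j q \<Longrightarrow> biprod2 St S X Y (cls i) (cls p) (cls j) (cls q)"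
proof -
  assume b: "biprod2 C S X Y i p j q"
  note B = biprod2D[OF b]
  note [simp] = B(10-)
  show ?thesis unfolding biprod2_def by (simp add: cls_simps[symmetric] B)
qed

lemma direct_sum_St: "direct_sum C S [X, Y] \<Longrightarrow> direct_sum St S [X, Y]"
  unfolding direct_sum_two st.direct_sum_two using biprod2_cls by blast

lemma isomorphic_St:
  assumes "isomorphic C X Y" "X \<in> Obj C" "Y \<in> Obj C" shows "isomorphic St X Y"
proof -
  obtain f g where f: "f \<in> X \<leadsto> Y" "g \<in> Y \<leadsto> X" "g \<cdot> f = Idn C X" "f \<cdot> g = Idn C Y"
    using isomorphicE[OF assms] .
  show ?thesis by (rule st.isomorphicI[of "cls f" X Y "cls g"]) (use f in \<open>simp_all flip: cls_Cmp add: cls_Idn\<close>)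
qed

text \<open>An object is projective exactly when its identity factors through a projective.\<close>

lemma projective_iff_zero: "zero_object St P \<longleftrightarrow> P \<in> projectives C E"
proof
  assume P: "P \<in> projectives C E"
  have "proj_factors (Idn C P \<cdot> Idn C P)" by (rule proj_factorsI[OF P, of _ P _ P]) (simp_all add: projective_Obj[OF P])
  then show "zero_object St P" using projective_Obj[OF P]
    by (simp add: st.zero_object_iff cls_zero_iff flip: cls_Idn)
next
  assume "zero_object St P"
  then have P: "P \<in> Obj C" "cls (Idn C P) = zmor St P P" by (simp_all add: st.zero_object_iff cls_Idn)
  then have "proj_factors (Idn C P)" by (simp add: cls_zero_iff)
  then obtain Q a b where "Q \<in> projectives C E" "a \<in> P \<leadsto> Q" "b \<in> Q \<leadsto> P" "b \<cdot> a = Idn C P"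
    using proj_factorsE[of "Idn C P"] P(1) by auto
  then show "P \<in> projectives C E" using projective_retract unfolding retract_def by blast
qed

lemma additive_St: "additive_category St"
proof
  show "\<exists>Z. zero_object St Z" using ex_zero_object zero_object_projective projective_iff_zero by blast
  show "\<exists>S. direct_sum St S [X, Y]" if "X \<in> Obj St" "Y \<in> Obj St" for X Y
    using ex_direct_sum[of X Y] direct_sum_St that by auto
qed

lemma projective_change: "isomorphic St X Y \<Longrightarrow> X \<in> projectives C E \<Longrightarrow> Y \<in> Obj C \<Longrightarrow> Y \<in> projectives C E"
  using st.zero_object_iso projective_iff_zero by simp

lemma direct_sum_projective_iso: "direct_sum C S [X, P] \<Longrightarrow> P \<in> projectives C E \<Longrightarrow> isomorphic St S X"
  by (rule st.direct_sum_zero_iso[of S X P]) (simp_all add: projective_iff_zero direct_sum_St)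

text \<open>The endomorphism ring of \<open>X\<close> in the stable category is a quotient of the one in \<open>C\<close>: a relation
\<open>a' a + d = 1\<close> in the quotient lifts after changing \<open>d\<close> by an element \<open>t\<close> of the ideal.\<close>

lemma stable_range_one_St:
  assumes "stable_range_one C X" shows "stable_range_one St X"
  unfolding stable_range_one_def
proof (intro conjI ballI impI)
  have X: "X \<in> Obj C" using assms by (simp add: stable_range_one_def)
  then show "X \<in> Obj St" by simp
  fix A A' D assume A: "A \<in> X \<leadsto>\<^bsub>St\<^esub> X" and A': "A' \<in> X \<leadsto>\<^bsub>St\<^esub> X" and D: "D \<in> X \<leadsto>\<^bsub>St\<^esub> X"
    and e: "A' \<cdot>\<^bsub>St\<^esub> A \<boxplus>\<^bsub>St\<^esub> D = Idn St X"
  obtain a where a: "a \<in> X \<leadsto> X" "A = cls a" using st_arrowsE[OF A] .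
  obtain a' where a': "a' \<in> X \<leadsto> X" "A' = cls a'" using st_arrowsE[OF A'] .
  obtain d where d: "d \<in> X \<leadsto> X" "D = cls d" using st_arrowsE[OF D] .
  \<comment> \<open>The error of the lifted relation, a morphism that is stably zero.\<close>
  define t where "t = Idn C X \<boxplus> \<boxminus> (a' \<cdot> a \<boxplus> d)"
  have t: "t \<in> X \<leadsto> X" unfolding t_def using a a' d X by simp
  have "cls t = zmor St X X" unfolding t_def using e a a' d X by (simp add: cls_simps del: st.neg_addm neg_addm)
  have ct: "cls (d \<boxplus> t) = D" using \<open>cls t = _\<close> d t by (simp add: cls_simps)
  have "(a' \<cdot> a \<boxplus> d) \<boxplus> (Idn C X \<boxplus> \<boxminus> (a' \<cdot> a \<boxplus> d)) = (a' \<cdot> a \<boxplus> d) \<boxplus> (\<boxminus> (a' \<cdot> a \<boxplus> d) \<boxplus> Idn C X)"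
    using a a' d X by (subst (4) addm_comm) (simp_all del: neg_addm)
  also have "\<dots> = Idn C X" using a a' d X by (simp del: neg_addm)
  finally have "a' \<cdot> a \<boxplus> (d \<boxplus> t) = Idn C X" unfolding t_def[symmetric] using a a' d t by (simp add: addm_assoc)
  moreover have "d \<boxplus> t \<in> X \<leadsto> X" using d t by simp
  ultimately obtain y where y: "y \<in> X \<leadsto> X" "automorphism C X (a \<boxplus> y \<cdot> (d \<boxplus> t))"
    using assms a(1) a'(1) unfolding stable_range_one_def by blast
  obtain w where w: "w \<in> X \<leadsto> X" "w \<cdot> (a \<boxplus> y \<cdot> (d \<boxplus> t)) = Idn C X" "(a \<boxplus> y \<cdot> (d \<boxplus> t)) \<cdot> w = Idn C X"
    using automorphismE[OF y(2)] by blast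
  have "cls (a \<boxplus> y \<cdot> (d \<boxplus> t)) = cls a \<boxplus>\<^bsub>St\<^esub> cls y \<cdot>\<^bsub>St\<^esub> cls (d \<boxplus> t)"
    using y(1) a(1) \<open>d \<boxplus> t \<in> X \<leadsto> X\<close> by (simp add: cls_addm[of a] cls_Cmp)
  also have "\<dots> = A \<boxplus>\<^bsub>St\<^esub> cls y \<cdot>\<^bsub>St\<^esub> D" by (simp only: ct a(2))
  finally have c: "cls (a \<boxplus> y \<cdot> (d \<boxplus> t)) = A \<boxplus>\<^bsub>St\<^esub> cls y \<cdot>\<^bsub>St\<^esub> D" .
  have v: "a \<boxplus> y \<cdot> (d \<boxplus> t) \<in> X \<leadsto> X" using a(1) y(1) \<open>d \<boxplus> t \<in> X \<leadsto> X\<close> by simp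
  have "automorphism St X (cls (a \<boxplus> y \<cdot> (d \<boxplus> t)))"
    by (rule st.automorphismI[of _ _ "cls w"])
      (use v w in \<open>simp_all only: cls_arrows in_arrows cls_Cmp[symmetric] cls_Idn\<close>)
  then show "\<exists>Y \<in> X \<leadsto>\<^bsub>St\<^esub> X. automorphism St X (A \<boxplus>\<^bsub>St\<^esub> Y \<cdot>\<^bsub>St\<^esub> D)"
    unfolding c using cls_arrows[OF y(1)] by blast
qed

end

sublocale exact_category \<subseteq> st: additive_category "stable_category C E"
  by (rule additive_St)

section \<open>Syzygies as a functor on the stable category\<close>

context exact_category
begin

text \<open>Since a morphism determines its source and target, two morphisms suffice to record a short exact sequence with
projective middle term.\<close>

definition presentation :: "'m \<Rightarrow> 'm \<Rightarrow> bool" where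
  "presentation i p \<longleftrightarrow> src C p \<in> projectives C E \<and> ses C E (src C i) i (src C p) p (tgt C p)"

text \<open>The morphism \<open>u\<close> between the presented objects lifts to the projective terms, inducing \<open>u'\<close> on the syzygies.\<close>

definition lifts :: "'m \<Rightarrow> 'm \<Rightarrow> 'm \<Rightarrow> 'm \<Rightarrow> 'm \<Rightarrow> 'm \<Rightarrow> bool" where
  "lifts i p i' p' u u' \<longleftrightarrow> u \<in> tgt C p \<leadsto> tgt C p' \<and> u' \<in> src C i \<leadsto> src C i' \<and>
     (\<exists>v \<in> src C p \<leadsto> src C p'. p' \<cdot> v = u \<cdot> p \<and> v \<cdot> i = i' \<cdot> u')"

text \<open>The action of the syzygy functor on stable morphisms, relative to chosen presentations of source and target; by
\<open>lifts_unique\<close> all choices agree.\<close>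

definition Omega :: "'m \<Rightarrow> 'm \<Rightarrow> 'm \<Rightarrow> 'm \<Rightarrow> 'm set \<Rightarrow> 'm set" where
  "Omega i p i' p' F = (SOME F'. \<exists>u u'. lifts i p i' p' u u' \<and> F = cls u \<and> F' = cls u')"

lemma presentationD:
  assumes "presentation i p"
  shows "src C p \<in> projectives C E" "ses C E (src C i) i (src C p) p (tgt C p)"
    "p \<cdot> i = zmor C (src C i) (tgt C p)" "arr C i" "arr C p" "tgt C i = src C p"
  using assms sesD(3,7,8,10)[of "src C i" i "src C p" p "tgt C p"] unfolding presentation_def by auto

lemma liftsE:
  assumes "lifts i p i' p' u u'"
  obtains v where "arr C u" "src C u = tgt C p" "tgt C u = tgt C p'" "arr C u'" "src C u' = src C i" "tgt C u' = src C i'"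
    "arr C v" "src C v = src C p" "tgt C v = src C p'" "p' \<cdot> v = u \<cdot> p" "v \<cdot> i = i' \<cdot> u'"
  using assms unfolding lifts_def by auto

lemma liftsI:
  assumes "u \<in> tgt C p \<leadsto> tgt C p'" "u' \<in> src C i \<leadsto> src C i'" "v \<in> src C p \<leadsto> src C p'"
    "p' \<cdot> v = u \<cdot> p" "v \<cdot> i = i' \<cdot> u'"
  shows "lifts i p i' p' u u'"
  using assms unfolding lifts_def by blast

lemma lifts_exists:
  assumes p: "presentation i p" and p': "presentation i' p'" and u: "u \<in> tgt C p \<leadsto> tgt C p'"
  shows "\<exists>u'. lifts i p i' p' u u'"
proof -
  note A = presentationD[OF p] and B = presentationD[OF p']
  note [simp] = A(4-6) B(4-6)
  have "u \<cdot> p \<in> src C p \<leadsto> tgt C p'" using u by simp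
  then obtain v where v: "v \<in> src C p \<leadsto> src C p'" "p' \<cdot> v = u \<cdot> p" by (rule projective_lift[OF A(1) B(2)])
  have "p' \<cdot> (v \<cdot> i) = zmor C (src C i) (tgt C p')" using u v by (simp add: Cmp_reassoc[OF v(2)] ringoid_simps A(3))
  then obtain u' where u': "u' \<in> src C i \<leadsto> src C i'" "i' \<cdot> u' = v \<cdot> i"
    by (rule ses_lift[OF B(2), rotated]) (use v in simp_all)
  show ?thesis using liftsI[OF u u'(1) v u'(2)[symmetric]] by blast
qed

lemma lifts_comp:
  assumes p: "presentation i p" and p': "presentation i' p'" and p'': "presentation i'' p''"
    and u: "lifts i p i' p' u u'" and w: "lifts i' p' i'' p'' w w'"
  shows "lifts i p i'' p'' (w \<cdot> u) (w' \<cdot> u')"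
proof -
  note [simp] = presentationD(4-6)[OF p] presentationD(4-6)[OF p'] presentationD(4-6)[OF p'']
  obtain v where v: "arr C u" "src C u = tgt C p" "tgt C u = tgt C p'" "arr C u'" "src C u' = src C i" "tgt C u' = src C i'"
    "arr C v" "src C v = src C p" "tgt C v = src C p'" "p' \<cdot> v = u \<cdot> p" "v \<cdot> i = i' \<cdot> u'" using liftsE[OF u] .
  obtain x where x: "arr C w" "src C w = tgt C p'" "tgt C w = tgt C p''" "arr C w'" "src C w' = src C i'" "tgt C w' = src C i''"
    "arr C x" "src C x = src C p'" "tgt C x = src C p''" "p'' \<cdot> x = w \<cdot> p'" "x \<cdot> i' = i'' \<cdot> w'" using liftsE[OF w] .
  show ?thesis
    by (rule liftsI[of _ _ _ _ _ _ "x \<cdot> v"])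
      (use v x in \<open>simp_all add: ringoid_simps Cmp_reassoc[OF x(10)] Cmp_reassoc[OF x(11)]\<close>)
qed

lemma lifts_add:
  assumes p: "presentation i p" and p': "presentation i' p'" and u: "lifts i p i' p' u u'" and w: "lifts i p i' p' w w'"
  shows "lifts i p i' p' (u \<boxplus> w) (u' \<boxplus> w')"
proof -
  note [simp] = presentationD(4-6)[OF p] presentationD(4-6)[OF p']
  obtain v where v: "arr C u" "src C u = tgt C p" "tgt C u = tgt C p'" "arr C u'" "src C u' = src C i" "tgt C u' = src C i'"
    "arr C v" "src C v = src C p" "tgt C v = src C p'" "p' \<cdot> v = u \<cdot> p" "v \<cdot> i = i' \<cdot> u'" using liftsE[OF u] .
  obtain x where x: "arr C w" "src C w = tgt C p" "tgt C w = tgt C p'" "arr C w'" "src C w' = src C i" "tgt C w' = src C i'"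
    "arr C x" "src C x = src C p" "tgt C x = src C p'" "p' \<cdot> x = w \<cdot> p" "x \<cdot> i = i' \<cdot> w'" using liftsE[OF w] .
  show ?thesis
    by (rule liftsI[of _ _ _ _ _ _ "v \<boxplus> x"]) (use v x in \<open>simp_all add: ringoid_simps\<close>)
qed

lemma lifts_Idn:
  assumes p: "presentation i p" shows "lifts i p i p (Idn C (tgt C p)) (Idn C (src C i))"
  by (rule liftsI[of _ _ _ _ _ _ "Idn C (src C p)"]) (use presentationD(4-6)[OF p] in simp_all)

lemma lifts_zero:
  assumes p: "presentation i p" and p': "presentation i' p'"
  shows "lifts i p i' p' (zmor C (tgt C p) (tgt C p')) (zmor C (src C i) (src C i'))"
  by (rule liftsI[of _ _ _ _ _ _ "zmor C (src C p) (src C p')"])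
    (use presentationD(4-6)[OF p] presentationD(4-6)[OF p'] in simp_all)

text \<open>The difference of two lifts of stably equal morphisms factors, after removing the part coming from a
projective through which \<open>u - w\<close> factors, through the kernel of the target presentation. On syzygies it thus
factors through the projective term of the source presentation.\<close>

lemma lifts_unique:
  assumes p: "presentation i p" and p': "presentation i' p'" and u: "lifts i p i' p' u u'" and w: "lifts i p i' p' w w'"
    and uw: "cls u = cls w"
  shows "cls u' = cls w'"
proof -
  note A = presentationD[OF p] and B = presentationD[OF p']
  note [simp] = A(4-6) B(4-6)
  obtain v where v: "arr C u" "src C u = tgt C p" "tgt C u = tgt C p'" "arr C u'" "src C u' = src C i" "tgt C u' = src C i'"
    "arr C v" "src C v = src C p" "tgt C v = src C p'" "p' \<cdot> v = u \<cdot> p" "v \<cdot> i = i' \<cdot> u'" using liftsE[OF u] .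
  obtain x where x: "arr C w" "src C w = tgt C p" "tgt C w = tgt C p'" "arr C w'" "src C w' = src C i" "tgt C w' = src C i'"
    "arr C x" "src C x = src C p" "tgt C x = src C p'" "p' \<cdot> x = w \<cdot> p" "x \<cdot> i = i' \<cdot> w'" using liftsE[OF w] .
  have "proj_factors (u \<boxplus> \<boxminus> w)" using uw v x by (subst (asm) cls_eq_iff) simp_all
  then obtain Q a b where Q: "Q \<in> projectives C E" "a \<in> tgt C p \<leadsto> Q" "b \<in> Q \<leadsto> tgt C p'" "b \<cdot> a = u \<boxplus> \<boxminus> w"
    using proj_factorsE[of "u \<boxplus> \<boxminus> w"] v(1-3) x(1-3) by auto
  obtain c where c: "c \<in> Q \<leadsto> src C p'" "p' \<cdot> c = b" using projective_lift[OF Q(1) B(2) Q(3)] .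
  \<comment> \<open>Correcting the difference of the lifts by the lift of \<open>b \<cdot> a\<close> makes it vanish on composing with \<open>p'\<close>.\<close>
  define y where "y = v \<boxplus> \<boxminus> x \<boxplus> \<boxminus> (c \<cdot> (a \<cdot> p))"
  have y: "y \<in> src C p \<leadsto> src C p'" unfolding y_def using v x c Q by simp
  have "p' \<cdot> y = (u \<boxplus> \<boxminus> w) \<cdot> p \<boxplus> \<boxminus> (b \<cdot> a \<cdot> p)"
    unfolding y_def using v x c Q(2,3) by (simp add: ringoid_simps Cmp_reassoc[OF c(2)])
  also have "\<dots> = zmor C (src C p) (tgt C p')" unfolding Q(4) using v x by (simp del: neg_addm)
  finally have "p' \<cdot> y = zmor C (src C p) (tgt C p')" .
  with y obtain z where z: "z \<in> src C p \<leadsto> src C i'" "i' \<cdot> z = y" by (rule ses_lift[OF B(2)])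
  have "u' \<boxplus> \<boxminus> w' = z \<cdot> i"
  proof (rule ses_monic[OF B(2), of _ "src C i"])
    have "i' \<cdot> (z \<cdot> i) = y \<cdot> i" using z by (simp add: Cmp_reassoc[OF z(2)])
    also have "\<dots> = i' \<cdot> (u' \<boxplus> \<boxminus> w')" unfolding y_def using v x c Q(2,3) by (simp add: ringoid_simps A(3))
    finally show "i' \<cdot> (u' \<boxplus> \<boxminus> w') = i' \<cdot> (z \<cdot> i)" by simp
  qed (use v x z in simp_all)
  moreover have "proj_factors (z \<cdot> i)" by (rule proj_factorsI[OF A(1), of _ "src C i" _ "src C i'"]) (use z in simp_all)
  ultimately show ?thesis using v x by (subst cls_eq_iff) simp_all
qed

lemma Omega_eq:
  assumes "presentation i p" "presentation i' p'" "lifts i p i' p' u u'" shows "Omega i p i' p' (cls u) = cls u'"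
proof -
  have "\<exists>F' v v'. lifts i p i' p' v v' \<and> cls u = cls v \<and> F' = cls v'" using assms(3) by blast
  then have "\<exists>v v'. lifts i p i' p' v v' \<and> cls u = cls v \<and> Omega i p i' p' (cls u) = cls v'"
    unfolding Omega_def by (rule someI_ex)
  then show ?thesis using lifts_unique[OF assms] by metis
qed

lemma Omega_obtain:
  assumes "presentation i p" "presentation i' p'" "F \<in> tgt C p \<leadsto>\<^bsub>St\<^esub> tgt C p'"
  obtains u u' where "lifts i p i' p' u u'" "F = cls u" "Omega i p i' p' F = cls u'"
proof -
  obtain u where u: "u \<in> tgt C p \<leadsto> tgt C p'" "F = cls u" using st_arrowsE[OF assms(3)] .
  obtain u' where "lifts i p i' p' u u'" using lifts_exists[OF assms(1,2) u(1)] by blast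
  then show ?thesis using that u(2) Omega_eq[OF assms(1,2)] by blast
qed

lemma Omega_arrows:
  assumes "presentation i p" "presentation i' p'" "F \<in> tgt C p \<leadsto>\<^bsub>St\<^esub> tgt C p'"
  shows "Omega i p i' p' F \<in> src C i \<leadsto>\<^bsub>St\<^esub> src C i'"
proof -
  obtain u u' where u: "lifts i p i' p' u u'" "Omega i p i' p' F = cls u'" using Omega_obtain[OF assms] .
  then have "u' \<in> src C i \<leadsto> src C i'" unfolding lifts_def by blast
  then show ?thesis unfolding u(2) by (rule cls_arrows)
qed

lemma Omega_comp:
  assumes "presentation i p" "presentation i' p'" "presentation i'' p''" "F \<in> tgt C p \<leadsto>\<^bsub>St\<^esub> tgt C p'" "G \<in> tgt C p' \<leadsto>\<^bsub>St\<^esub> tgt C p''"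
  shows "Omega i p i'' p'' (G \<cdot>\<^bsub>St\<^esub> F) = Omega i' p' i'' p'' G \<cdot>\<^bsub>St\<^esub> Omega i p i' p' F"
proof -
  obtain u u' where u: "lifts i p i' p' u u'" "F = cls u" "Omega i p i' p' F = cls u'" using Omega_obtain[OF assms(1,2,4)] .
  obtain w w' where w: "lifts i' p' i'' p'' w w'" "G = cls w" "Omega i' p' i'' p'' G = cls w'" using Omega_obtain[OF assms(2,3,5)] .
  have t: "u \<in> tgt C p \<leadsto> tgt C p'" "u' \<in> src C i \<leadsto> src C i'" "w \<in> tgt C p' \<leadsto> tgt C p''" "w' \<in> src C i' \<leadsto> src C i''"
    using u(1) w(1) unfolding lifts_def by blast+
  have "Omega i p i'' p'' (cls (w \<cdot> u)) = cls (w' \<cdot> u')"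
    by (rule Omega_eq[OF assms(1,3) lifts_comp[OF assms(1-3) u(1) w(1)]])
  moreover have "cls (w \<cdot> u) = G \<cdot>\<^bsub>St\<^esub> F" "cls (w' \<cdot> u') = cls w' \<cdot>\<^bsub>St\<^esub> cls u'"
    unfolding u(2) w(2) using t by (simp_all add: cls_Cmp)
  ultimately show ?thesis unfolding u(3) w(3) by simp
qed

lemma Omega_add:
  assumes "presentation i p" "presentation i' p'" "F \<in> tgt C p \<leadsto>\<^bsub>St\<^esub> tgt C p'" "G \<in> tgt C p \<leadsto>\<^bsub>St\<^esub> tgt C p'"
  shows "Omega i p i' p' (F \<boxplus>\<^bsub>St\<^esub> G) = Omega i p i' p' F \<boxplus>\<^bsub>St\<^esub> Omega i p i' p' G"
proof -
  obtain u u' where u: "lifts i p i' p' u u'" "F = cls u" "Omega i p i' p' F = cls u'" using Omega_obtain[OF assms(1,2,3)] .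
  obtain w w' where w: "lifts i p i' p' w w'" "G = cls w" "Omega i p i' p' G = cls w'" using Omega_obtain[OF assms(1,2,4)] .
  have t: "u \<in> tgt C p \<leadsto> tgt C p'" "u' \<in> src C i \<leadsto> src C i'" "w \<in> tgt C p \<leadsto> tgt C p'" "w' \<in> src C i \<leadsto> src C i'"
    using u(1) w(1) unfolding lifts_def by blast+
  have "Omega i p i' p' (cls (u \<boxplus> w)) = cls (u' \<boxplus> w')"
    by (rule Omega_eq[OF assms(1,2) lifts_add[OF assms(1,2) u(1) w(1)]])
  moreover have "cls (u \<boxplus> w) = F \<boxplus>\<^bsub>St\<^esub> G" "cls (u' \<boxplus> w') = cls u' \<boxplus>\<^bsub>St\<^esub> cls w'"
    unfolding u(2) w(2) using t by (simp_all add: cls_addm)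
  ultimately show ?thesis unfolding u(3) w(3) by simp
qed

lemma Omega_Idn: "presentation i p \<Longrightarrow> Omega i p i p (Idn St (tgt C p)) = Idn St (src C i)"
  using Omega_eq[OF _ _ lifts_Idn, of i p] presentationD(4,5) by (simp add: cls_Idn)

lemma Omega_zero: "presentation i p \<Longrightarrow> presentation i' p' \<Longrightarrow>
    Omega i p i' p' (zmor St (tgt C p) (tgt C p')) = zmor St (src C i) (src C i')"
  using Omega_eq[OF _ _ lifts_zero, of i p i' p'] presentationD(4,5) by (simp add: cls_zero)

lemma syzygy_presentationE:
  assumes "is_syzygy C E K M" obtains i p where "presentation i p" "src C i = K" "tgt C p = M"
proof -
  obtain P i p where "P \<in> projectives C E" and s: "ses C E K i P p M" using assms unfolding is_syzygy_def by blast
  then show ?thesis using that[of i p] sesD(9,11,12)[OF s] by (simp add: presentation_def)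
qed

lemma syzygy_Obj: "is_syzygy C E K M \<Longrightarrow> K \<in> Obj C \<and> M \<in> Obj C"
  unfolding is_syzygy_def ses_def by blast

lemma syzygy_retract:
  assumes K: "is_syzygy C E K X" and K': "is_syzygy C E K' X'" and "retract St X X'"
  shows "retract St K K'"
proof -
  obtain i p where p: "presentation i p" "src C i = K" "tgt C p = X" using syzygy_presentationE[OF K] .
  obtain i' p' where p': "presentation i' p'" "src C i' = K'" "tgt C p' = X'" using syzygy_presentationE[OF K'] .
  obtain F G where F: "F \<in> X \<leadsto>\<^bsub>St\<^esub> X'" "G \<in> X' \<leadsto>\<^bsub>St\<^esub> X" "G \<cdot>\<^bsub>St\<^esub> F = Idn St X"
    using assms(3) unfolding retract_def by blast
  note F' = F[folded p(3) p'(3)]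
  have "Omega i' p' i p G \<cdot>\<^bsub>St\<^esub> Omega i p i' p' F = Idn St (src C i)"
    unfolding Omega_comp[OF p(1) p'(1) p(1) F'(1,2), symmetric] F'(3) by (rule Omega_Idn[OF p(1)])
  then show ?thesis using Omega_arrows[OF p(1) p'(1) F'(1)] Omega_arrows[OF p'(1) p(1) F'(2)]
    unfolding retract_def p(2) p'(2) by blast
qed

text \<open>With \<open>X = X'\<close> this is Schanuel's lemma in stable form: a syzygy is unique up to stable isomorphism.\<close>

lemma syzygy_iso:
  assumes K: "is_syzygy C E K X" and K': "is_syzygy C E K' X'" and "isomorphic St X X'"
  shows "isomorphic St K K'"
proof -
  obtain i p where p: "presentation i p" "src C i = K" "tgt C p = X" using syzygy_presentationE[OF K] .
  obtain i' p' where p': "presentation i' p'" "src C i' = K'" "tgt C p' = X'" using syzygy_presentationE[OF K'] .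
  obtain F G where F: "F \<in> X \<leadsto>\<^bsub>St\<^esub> X'" "G \<in> X' \<leadsto>\<^bsub>St\<^esub> X" "G \<cdot>\<^bsub>St\<^esub> F = Idn St X" "F \<cdot>\<^bsub>St\<^esub> G = Idn St X'"
    by (rule st.isomorphicE[OF assms(3)]) (use syzygy_Obj[OF K] syzygy_Obj[OF K'] in simp_all)
  note F' = F[folded p(3) p'(3)]
  have 1: "Omega i' p' i p G \<cdot>\<^bsub>St\<^esub> Omega i p i' p' F = Idn St (src C i)"
    unfolding Omega_comp[OF p(1) p'(1) p(1) F'(1,2), symmetric] F'(3) by (rule Omega_Idn[OF p(1)])
  have 2: "Omega i p i' p' F \<cdot>\<^bsub>St\<^esub> Omega i' p' i p G = Idn St (src C i')"
    unfolding Omega_comp[OF p'(1) p(1) p'(1) F'(2,1), symmetric] F'(4) by (rule Omega_Idn[OF p'(1)])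
  show ?thesis using st.isomorphicI[OF Omega_arrows[OF p(1) p'(1) F'(1)] Omega_arrows[OF p'(1) p(1) F'(2)] 1 2]
    unfolding p(2) p'(2) .
qed

text \<open>An additive functor preserves biproducts, so no direct sum of presentations has to be formed.\<close>

lemma syzygy_direct_sum:
  assumes K: "is_syzygy C E K S" and K1: "is_syzygy C E K1 X" and K2: "is_syzygy C E K2 Y"
    and "direct_sum St S [X, Y]"
  shows "direct_sum St K [K1, K2]"
proof -
  obtain i p where p: "presentation i p" "src C i = K" "tgt C p = S" using syzygy_presentationE[OF K] .
  obtain i1 p1 where p1: "presentation i1 p1" "src C i1 = K1" "tgt C p1 = X" using syzygy_presentationE[OF K1] .
  obtain i2 p2 where p2: "presentation i2 p2" "src C i2 = K2" "tgt C p2 = Y" using syzygy_presentationE[OF K2] .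
  obtain a b c d where b: "biprod2 St S X Y a b c d" using assms(4) unfolding st.direct_sum_two by blast
  note B = st.biprod2D[OF b, folded p(3) p1(3) p2(3)]
  have ab: "a \<cdot>\<^bsub>St\<^esub> b \<in> tgt C p \<leadsto>\<^bsub>St\<^esub> tgt C p" "c \<cdot>\<^bsub>St\<^esub> d \<in> tgt C p \<leadsto>\<^bsub>St\<^esub> tgt C p"
    using B(10-) by simp_all
  have "biprod2 St (src C i) (src C i1) (src C i2) (Omega i1 p1 i p a) (Omega i p i1 p1 b) (Omega i2 p2 i p c) (Omega i p i2 p2 d)"
    unfolding biprod2_def
    unfolding Omega_comp[OF p1(1) p(1) p1(1) B(1,2), symmetric] Omega_comp[OF p2(1) p(1) p2(1) B(3,4), symmetric]
      Omega_comp[OF p2(1) p(1) p1(1) B(3,2), symmetric] Omega_comp[OF p1(1) p(1) p2(1) B(1,4), symmetric]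
      Omega_comp[OF p(1) p1(1) p(1) B(2,1), symmetric] Omega_comp[OF p(1) p2(1) p(1) B(4,3), symmetric]
      Omega_add[OF p(1) p(1) ab, symmetric] B(5-9)
    by (intro conjI Omega_arrows Omega_Idn Omega_zero p(1) p1(1) p2(1) B(1-4))
  then show ?thesis unfolding st.direct_sum_two p(2) p1(2) p2(2) by blast
qed

lemma syzygy_projective:
  assumes K: "is_syzygy C E K P" and P: "P \<in> projectives C E" shows "K \<in> projectives C E"
proof -
  obtain i p where p: "presentation i p" "src C i = K" "tgt C p = P" using syzygy_presentationE[OF K] .
  have "Idn St (tgt C p) = zmor St (tgt C p) (tgt C p)"
    using P[folded projective_iff_zero] p(3) by (simp add: st.zero_object_iff)
  then have "Idn St K = zmor St K K" using Omega_Idn[OF p(1)] Omega_zero[OF p(1) p(1)] p(2) by simp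
  then show ?thesis using syzygy_Obj[OF K] by (simp add: st.zero_object_iff flip: projective_iff_zero)
qed

lemma stable_retract_projective:
  assumes "retract St X P" "P \<in> projectives C E" shows "X \<in> projectives C E"
proof -
  obtain F G where F: "F \<in> X \<leadsto>\<^bsub>St\<^esub> P" "G \<in> P \<leadsto>\<^bsub>St\<^esub> X" "G \<cdot>\<^bsub>St\<^esub> F = Idn St X"
    using assms(1) unfolding retract_def by blast
  have "F = zmor St X P"
  proof -
    have "Idn St P \<cdot>\<^bsub>St\<^esub> F = zmor St X P"
      using assms(2)[folded projective_iff_zero] F(1) by (simp add: st.zero_object_iff)
    then show ?thesis using F(1) by simp
  qed
  then have "Idn St X = zmor St X X" using F by simp
  then show ?thesis using F(1) by (simp add: st.zero_object_iff flip: projective_iff_zero)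
qed

text \<open>A section of \<open>p\<close> exists by projectivity of \<open>D\<close> and provides all biproduct data.\<close>

lemma projective_cokernel_splits:
  assumes s: "ses C E A i B p D" and D: "D \<in> projectives C E"
  shows "direct_sum C B [A, D]"
proof -
  note S = sesD[OF s]
  note [simp] = S(4-12)
  have "Idn C D \<in> D \<leadsto> D" by simp
  then obtain t where t: "t \<in> D \<leadsto> B" "p \<cdot> t = Idn C D" by (rule projective_lift[OF D s])
  have "p \<cdot> (Idn C B \<boxplus> \<boxminus> (t \<cdot> p)) = zmor C B D" using t by (simp add: ringoid_simps Cmp_reassoc[OF t(2)])
  then obtain r where r: "r \<in> B \<leadsto> A" "i \<cdot> r = Idn C B \<boxplus> \<boxminus> (t \<cdot> p)"
    by (rule ses_lift[OF s, rotated]) (use t in simp_all)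
  have ri: "r \<cdot> i = Idn C A"
    by (rule ses_monic[OF s, of _ A]) (use r t S(3) in \<open>simp_all add: Cmp_reassoc[OF r(2)] ringoid_simps\<close>)
  have rt: "r \<cdot> t = zmor C D A"
    by (rule ses_monic[OF s, of _ D]) (use r t in \<open>simp_all add: Cmp_reassoc[OF r(2)] ringoid_simps\<close>)
  have "i \<cdot> r \<boxplus> t \<cdot> p = Idn C B" unfolding r(2) using t by (simp add: addm_assoc)
  then have "biprod2 C B A D i r t p" unfolding biprod2_def using r(1) t ri rt S(3) by simp
  then show ?thesis unfolding direct_sum_two by blast
qed

end

section \<open>Stable triangles and bounded projective dimension\<close>

context exact_category
begin

text \<open>Exact sequences up to stable isomorphism of their terms; only objects are recorded, which is all that the
estimates of projective dimensions use.\<close>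

definition triangle :: "'o \<Rightarrow> 'o \<Rightarrow> 'o \<Rightarrow> bool" where
  "triangle A B D \<longleftrightarrow> A \<in> Obj C \<and> B \<in> Obj C \<and> D \<in> Obj C \<and> (\<exists>A' B' D' i p. ses C E A' i B' p D' \<and>
     isomorphic St A' A \<and> isomorphic St B' B \<and> isomorphic St D' D)"

lemma stable_iso_trans:
  "isomorphic St X Y \<Longrightarrow> isomorphic St Y Z \<Longrightarrow> X \<in> Obj C \<Longrightarrow> Y \<in> Obj C \<Longrightarrow> Z \<in> Obj C \<Longrightarrow> isomorphic St X Z"
  by (rule st.isomorphic_trans[of X Y Z]) simp_all

lemma stable_iso_sym: "isomorphic St X Y \<Longrightarrow> X \<in> Obj C \<Longrightarrow> Y \<in> Obj C \<Longrightarrow> isomorphic St Y X"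
  by (rule st.isomorphic_sym) simp_all

lemma triangle_projective:
  assumes "triangle A B D" "D \<in> projectives C E" shows "isomorphic St A B"
proof -
  obtain A' B' D' i p where s: "ses C E A' i B' p D'"
    and iso: "isomorphic St A' A" "isomorphic St B' B" "isomorphic St D' D"
    and o: "A \<in> Obj C" "B \<in> Obj C" "D \<in> Obj C" using assms(1) unfolding triangle_def by blast
  note o' = sesD(4-6)[OF s]
  have "isomorphic St D D'" by (rule stable_iso_sym) (use iso(3) o o' in simp_all)
  then have P: "D' \<in> projectives C E" using assms(2) o'(3) by (rule projective_change)
  have "isomorphic St B' A'" by (rule direct_sum_projective_iso[OF projective_cokernel_splits[OF s P] P])
  then have "isomorphic St B' A" using iso(1) o o' stable_iso_trans by blast
  then have "isomorphic St A B'" using o o' stable_iso_sym by blast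
  then show ?thesis using iso(2) o o' stable_iso_trans by blast
qed

end

text \<open>The syzygy form of \<open>pd M \<le> k\<close>. The recursion asks for one suitable syzygy; by \<open>pdim_le_syzygy\<close> every
syzygy is then suitable.\<close>

primrec pdim_le :: "('o, 'm) precategory \<Rightarrow> ('m \<times> 'm) set \<Rightarrow> nat \<Rightarrow> 'o set" where
  "pdim_le C E 0 = projectives C E"
| "pdim_le C E (Suc k) = {M \<in> Obj C. \<exists>K. is_syzygy C E K M \<and> K \<in> pdim_le C E k}"

context exact_IT_context
begin

lemma syzygy_exists: "M \<in> Obj C \<Longrightarrow> \<exists>K. is_syzygy C E K M"
  using enough_projectives unfolding enough_projectives_def is_syzygy_def adm_epic_def by blast

lemma syzygy_is_syzygy: "M \<in> Obj C \<Longrightarrow> is_syzygy C E (syzygy C E M) M"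
  unfolding syzygy_def by (rule someI_ex[OF syzygy_exists])

lemma syzygy_in_Obj [simp]: "M \<in> Obj C \<Longrightarrow> syzygy C E M \<in> Obj C"
  using syzygy_is_syzygy syzygy_Obj by blast

lemma syzygy_pow_Obj [simp]: "M \<in> Obj C \<Longrightarrow> (syzygy C E ^^ k) M \<in> Obj C"
  by (induction k) simp_all

lemma pdim_le_Obj: "M \<in> pdim_le C E k \<Longrightarrow> M \<in> Obj C"
  by (cases k) (simp_all add: projective_Obj)

text \<open>Syzygies preserve stable retracts, so the bound passes down the recursion. In particular \<open>pdim_le\<close> depends
on the stable isomorphism class only and on no choice of syzygies.\<close>

lemma pdim_le_retract: "\<lbrakk>X' \<in> pdim_le C E k; retract St X X'\<rbrakk> \<Longrightarrow> X \<in> pdim_le C E k"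
proof (induction k arbitrary: X X')
  case 0 then show ?case using stable_retract_projective by simp
next
  case (Suc k)
  then obtain K' where K': "is_syzygy C E K' X'" "K' \<in> pdim_le C E k" by auto
  have X: "X \<in> Obj C" using Suc.prems(2) unfolding retract_def by auto
  obtain K where K: "is_syzygy C E K X" using syzygy_exists[OF X] by blast
  have "K \<in> pdim_le C E k" using Suc.IH[OF K'(2) syzygy_retract[OF K K'(1) Suc.prems(2)]] .
  then show ?case using K X by auto
qed

lemma pdim_le_iso:
  assumes "X' \<in> pdim_le C E k" "isomorphic St X X'" "X \<in> Obj C" shows "X \<in> pdim_le C E k"
  by (rule pdim_le_retract[OF assms(1) st.isomorphic_retract[OF assms(2)]]) (use assms pdim_le_Obj in simp_all)

lemma pdim_le_iso_iff:
  assumes "isomorphic St X X'" "X \<in> Obj C" "X' \<in> Obj C" shows "X \<in> pdim_le C E k \<longleftrightarrow> X' \<in> pdim_le C E k"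
  using pdim_le_iso assms stable_iso_sym by blast

lemma pdim_le_syzygy:
  assumes "is_syzygy C E K X" shows "X \<in> pdim_le C E (Suc k) \<longleftrightarrow> K \<in> pdim_le C E k"
proof
  assume "X \<in> pdim_le C E (Suc k)"
  then obtain K' where K': "is_syzygy C E K' X" "K' \<in> pdim_le C E k" by auto
  have "isomorphic St X X" using st.isomorphic_refl syzygy_Obj[OF assms] by simp
  then show "K \<in> pdim_le C E k" using pdim_le_iso[OF K'(2) syzygy_iso[OF assms K'(1)]] syzygy_Obj[OF assms] by blast
qed (use assms syzygy_Obj[OF assms] in auto)

lemma pdim_le_Suc: "X \<in> pdim_le C E k \<Longrightarrow> X \<in> pdim_le C E (Suc k)"
proof (induction k arbitrary: X)
  case 0
  then have P: "X \<in> projectives C E" by simp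
  obtain K where K: "is_syzygy C E K X" using syzygy_exists[OF projective_Obj[OF P]] by blast
  then show ?case using pdim_le_syzygy[OF K, of 0] syzygy_projective[OF K P] by simp
next
  case (Suc k)
  obtain K where K: "is_syzygy C E K X" using syzygy_exists[OF pdim_le_Obj[OF Suc.prems]] by blast
  then show ?case using pdim_le_syzygy[OF K] Suc by blast
qed

lemma pdim_le_mono: "k \<le> l \<Longrightarrow> X \<in> pdim_le C E k \<Longrightarrow> X \<in> pdim_le C E l"
  by (induction l rule: dec_induct) (simp_all only: pdim_le_Suc)

lemma pdim_le_syzygy_same: "is_syzygy C E K X \<Longrightarrow> X \<in> pdim_le C E k \<Longrightarrow> K \<in> pdim_le C E k"
  using pdim_le_Suc pdim_le_syzygy by blast

lemma pdim_le_syzygy_pow: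
  assumes "X \<in> Obj C" shows "X \<in> pdim_le C E (n + k) \<longleftrightarrow> (syzygy C E ^^ n) X \<in> pdim_le C E k"
proof (induction n arbitrary: k)
  case (Suc n)
  show ?case using Suc.IH[of "Suc k"] pdim_le_syzygy[OF syzygy_is_syzygy, of "(syzygy C E ^^ n) X" k] assms by simp
qed simp

lemma triangle_rotate:
  assumes "triangle A B D" "is_syzygy C E K D" shows "triangle K A B"
proof -
  obtain A' B' D' i p where s: "ses C E A' i B' p D'"
    and iso: "isomorphic St A' A" "isomorphic St B' B" "isomorphic St D' D"
    and o: "A \<in> Obj C" "B \<in> Obj C" "D \<in> Obj C" using assms(1) unfolding triangle_def by blast
  note o' = sesD(4-6)[OF s]
  obtain K' where K': "is_syzygy C E K' D'" using syzygy_exists[OF o'(3)] by blast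
  then obtain Q j q where Q: "Q \<in> projectives C E" and s': "ses C E K' j Q q D'" unfolding is_syzygy_def by blast
  obtain W k w where W: "direct_sum C W [A', Q]" and s'': "ses C E K' k W w B'" using rotation[OF s s' Q] by blast
  have "isomorphic St K' K" by (rule syzygy_iso[OF K' assms(2) iso(3)])
  moreover have "isomorphic St W A"
    using stable_iso_trans[OF direct_sum_projective_iso[OF W Q] iso(1)] direct_sum_Obj[OF W] o by blast
  ultimately show ?thesis unfolding triangle_def using s'' iso(2) o syzygy_Obj[OF assms(2)] by blast
qed

text \<open>Three rotations apply the syzygy functor to every term.\<close>

lemma triangle_syzygy:
  assumes "triangle A B D" "is_syzygy C E A' A" "is_syzygy C E B' B" "is_syzygy C E D' D" shows "triangle A' B' D'"
  by (rule triangle_rotate[OF triangle_rotate[OF triangle_rotate[OF assms(1,4)] assms(3)] assms(2)])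

lemma triangle_syzygy_pow:
  "triangle A B D \<Longrightarrow> triangle ((syzygy C E ^^ k) A) ((syzygy C E ^^ k) B) ((syzygy C E ^^ k) D)"
proof (induction k)
  case (Suc k)
  then have t: "triangle ((syzygy C E ^^ k) A) ((syzygy C E ^^ k) B) ((syzygy C E ^^ k) D)" by simp
  then show ?case using triangle_syzygy[OF t] syzygy_is_syzygy unfolding triangle_def by simp
qed simp

lemma triangle_Obj: "triangle A B D \<Longrightarrow> A \<in> Obj C \<and> B \<in> Obj C \<and> D \<in> Obj C"
  by (simp add: triangle_def)

text \<open>Apply syzygies until the outer terms are projective; then the sequence splits.\<close>

lemma pdim_le_extension: "\<lbrakk>triangle A B D; A \<in> pdim_le C E k; D \<in> pdim_le C E k\<rbrakk> \<Longrightarrow> B \<in> pdim_le C E k"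
proof (induction k arbitrary: A B D)
  case 0
  then have "isomorphic St A B" using triangle_projective by simp
  then show ?case using 0 projective_change triangle_Obj by fastforce
next
  case (Suc k)
  obtain A' where A: "is_syzygy C E A' A" using syzygy_exists triangle_Obj[OF Suc.prems(1)] by blast
  obtain B' where B: "is_syzygy C E B' B" using syzygy_exists triangle_Obj[OF Suc.prems(1)] by blast
  obtain D' where D: "is_syzygy C E D' D" using syzygy_exists triangle_Obj[OF Suc.prems(1)] by blast
  have "B' \<in> pdim_le C E k"
    using Suc.IH[OF triangle_syzygy[OF Suc.prems(1) A B D]] Suc.prems(2,3) pdim_le_syzygy[OF A] pdim_le_syzygy[OF D] by blast
  then show ?case using pdim_le_syzygy[OF B] by blast
qed

text \<open>Two rotations turn \<open>A \<rightarrow> B \<rightarrow> D\<close> into \<open>\<Omega>B \<rightarrow> \<Omega>D \<rightarrow> A\<close>, an extension whose outer terms are under control.\<close>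

lemma pdim_le_third:
  assumes t: "triangle A B D" and A: "A \<in> pdim_le C E k" and B: "B \<in> pdim_le C E k" shows "D \<in> pdim_le C E (Suc k)"
proof -
  obtain B' where B': "is_syzygy C E B' B" using syzygy_exists triangle_Obj[OF t] by blast
  obtain D' where D': "is_syzygy C E D' D" using syzygy_exists triangle_Obj[OF t] by blast
  have "triangle B' D' A" by (rule triangle_rotate[OF triangle_rotate[OF t D'] B'])
  then have "D' \<in> pdim_le C E k" by (rule pdim_le_extension[OF _ pdim_le_syzygy_same[OF B' B] A])
  then show ?thesis using pdim_le_syzygy[OF D'] by blast
qed

end

section \<open>Projective dimension measured by Ext and by syzygies\<close>

lemma trivial_quotient_iff:
  fixes G (structure)
  assumes G: "comm_group G" and N: "subgroup N G"
  shows "trivial_group (G Mod N) \<longleftrightarrow> carrier G \<subseteq> N"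
proof -
  interpret comm_group G by (rule G)
  have c: "carrier (G Mod N) = (\<lambda>x. N #> x) ` carrier G" by (rule carrier_FactGroup)
  have "N #> x = N \<longleftrightarrow> x \<in> N" if "x \<in> carrier G" for x
    using that N coset_join1 coset_join2 subgroup.subset by metis
  moreover have "\<one> \<in> carrier G" "N #> \<one> = N" using N by (auto simp: subgroup.subset coset_mult_one)
  ultimately have "carrier (G Mod N) = {N} \<longleftrightarrow> carrier G \<subseteq> N" unfolding c by auto
  moreover have "group (G Mod N)" using abelian_FactGroup[OF N] by (rule comm_group.axioms(2))
  ultimately show ?thesis by (simp add: trivial_group_def)
qed

context exact_category
begin

lemma Hom_cohomology_trivial_iff:
  assumes o: "B \<in> Obj C" and P: "\<And>k. P k \<in> Obj C" and d: "\<And>k. d k \<in> P (Suc k) \<leadsto> P k"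
    and dd: "d k \<cdot> d (Suc k) = zmor C (P (Suc (Suc k))) (P k)"
  shows "trivial_group (Hom_cohomology C P d B (Suc k)) \<longleftrightarrow>
    (\<forall>f \<in> P (Suc k) \<leadsto> B. f \<cdot> d (Suc k) = zmor C (P (Suc (Suc k))) B \<longrightarrow> (\<exists>g \<in> P k \<leadsto> B. f = g \<cdot> d k))"
proof -
  have hom: "(\<lambda>f. f \<cdot> d k) \<in> hom (Hom C (P k) B) (Hom C (P (Suc k)) B)" for k
    using o P d[of k] by (intro homI) (auto simp: mor_iff Hom_mult_addm ringoid_simps)
  have g: "comm_group (Hom C (P k) B)" for k using P o by (intro Hom_comm_group)
  interpret H: comm_group "Hom C (P (Suc k)) B" by (rule g)
  interpret h1: group_hom "Hom C (P (Suc k)) B" "Hom C (P (Suc (Suc k))) B" "\<lambda>f. f \<cdot> d (Suc k)"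
    using g hom by (simp add: group_hom_def group_hom_axioms_def comm_group.axioms(2))
  interpret h0: group_hom "Hom C (P k) B" "Hom C (P (Suc k)) B" "\<lambda>f. f \<cdot> d k"
    using g hom by (simp add: group_hom_def group_hom_axioms_def comm_group.axioms(2))
  let ?Z = "Hom_cocycles C P d B (Suc k)" and ?N = "Hom_coboundaries C P d B (Suc k)"
  have Z: "subgroup ?Z (Hom C (P (Suc k)) B)" unfolding Hom_cocycles_def by (rule h1.subgroup_kernel)
  have N: "subgroup ?N (Hom C (P (Suc k)) B)"
    using h0.img_is_subgroup by simp
  have "?N \<subseteq> ?Z"
  proof
    fix f assume "f \<in> ?N"
    then obtain g where g: "g \<in> mor C (P k) B" "f = g \<cdot> d k" by auto
    then have "f \<cdot> d (Suc k) = zmor C (P (Suc (Suc k))) B"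
      using P o d[of k] d[of "Suc k"] by (simp add: mor_iff Cmp_assoc' dd)
    then show "f \<in> ?Z" using g P o d[of k] by (simp add: Hom_cocycles_def kernel_def mor_iff)
  qed
  then have NZ: "subgroup ?N ((Hom C (P (Suc k)) B)\<lparr>carrier := ?Z\<rparr>)" by (rule H.subgroup_incl[OF N Z])
  have "comm_group ((Hom C (P (Suc k)) B)\<lparr>carrier := ?Z\<rparr>)"
    by (rule group.group_comm_groupI[OF subgroup.subgroup_is_group[OF Z H.is_group]])
      (simp add: H.m_comm subgroup.mem_carrier[OF Z])
  then have "trivial_group (Hom_cohomology C P d B (Suc k)) \<longleftrightarrow> ?Z \<subseteq> ?N"
    unfolding Hom_cohomology_def using trivial_quotient_iff[OF _ NZ] by simp
  also have "\<dots> \<longleftrightarrow> (\<forall>f \<in> P (Suc k) \<leadsto> B. f \<cdot> d (Suc k) = zmor C (P (Suc (Suc k))) B \<longrightarrow> (\<exists>g \<in> P k \<leadsto> B. f = g \<cdot> d k))"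
  proof -
    have m: "mor C (P k) B = P k \<leadsto> B" for k using P o by (auto simp: mor_iff)
    have 1: "?Z = {f \<in> P (Suc k) \<leadsto> B. f \<cdot> d (Suc k) = zmor C (P (Suc (Suc k))) B}"
      unfolding Hom_cocycles_def kernel_def m ..
    have 2: "?N = (\<lambda>f. f \<cdot> d k) ` (P k \<leadsto> B)" unfolding Hom_coboundaries.simps m ..
    show ?thesis unfolding 1 2 by blast
  qed
  finally show ?thesis .
qed

end

context exact_IT_context
begin

text \<open>Splice the presentations of the iterated syzygies.\<close>

lemma proj_resolution_exists:
  assumes X: "X \<in> Obj C" shows "\<exists>P d. proj_resolution C E X P d"
proof -
  let ?K = "\<lambda>n. (syzygy C E ^^ n) X"
  have "\<forall>n. \<exists>P i p. P \<in> projectives C E \<and> ses C E (?K (Suc n)) i P p (?K n)"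
  proof
    fix n
    have "is_syzygy C E (?K (Suc n)) (?K n)" using syzygy_is_syzygy[of "?K n"] X by simp
    then show "\<exists>P i p. P \<in> projectives C E \<and> ses C E (?K (Suc n)) i P p (?K n)" unfolding is_syzygy_def by blast
  qed
  then obtain P i p where r: "\<And>n. P n \<in> projectives C E \<and> ses C E (?K (Suc n)) (i n) (P n) (p n) (?K n)" by metis
  have "proj_resolution C E X P (\<lambda>n. i n \<cdot> p (Suc n))"
    unfolding proj_resolution_def
    by (intro exI[of _ ?K] exI[of _ i] exI[of _ p]) (use r in simp)
  then show ?thesis by blast
qed

text \<open>Let \<open>K\<^sub>n\<close> be the syzygies of the resolution. If \<open>Ext\<^sup>n\<^sup>+\<^sup>1(X, K\<^sub>n\<^sub>+\<^sub>1) = 0\<close>, then the cocycle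
\<open>P\<^sub>n\<^sub>+\<^sub>1 \<rightarrow> K\<^sub>n\<^sub>+\<^sub>1\<close> is a coboundary, which is a retraction of \<open>K\<^sub>n\<^sub>+\<^sub>1 \<rightarrow> P\<^sub>n\<close>; so \<open>K\<^sub>n\<close> is a summand of \<open>P\<^sub>n\<close>.
Conversely, if \<open>K\<^sub>n\<close> is projective then all later sequences \<open>K\<^sub>m\<^sub>+\<^sub>1 \<rightarrow> P\<^sub>m \<rightarrow> K\<^sub>m\<close> split, and cocycles extend.\<close>

lemma Ext_trivial_iff:
  assumes X: "X \<in> Obj C"
  shows "(\<forall>j > n. \<forall>Z \<in> Obj C. trivial_group (Ext C E j X Z)) \<longleftrightarrow> X \<in> pdim_le C E n"
proof -
  obtain P d where Pd: "chosen_resolution C E X = (P, d)" by fastforce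
  have "\<exists>R. proj_resolution C E X (fst R) (snd R)" using proj_resolution_exists[OF X] by simp
  then have "proj_resolution C E X (fst (chosen_resolution C E X)) (snd (chosen_resolution C E X))"
    unfolding chosen_resolution_def by (rule someI_ex)
  then have "proj_resolution C E X P d" unfolding Pd by simp
  then obtain K i p where K0: "K 0 = X" and r: "\<And>n. P n \<in> projectives C E"
    "\<And>n. ses C E (K (Suc n)) (i n) (P n) (p n) (K n)" and dn: "\<And>n. d n = i n \<cdot> p (Suc n)"
    unfolding proj_resolution_def by blast
  have t: "arr C (i n)" "arr C (p n)" "src C (i n) = K (Suc n)" "tgt C (i n) = P n" "src C (p n) = P n"
    "tgt C (p n) = K n" "K n \<in> Obj C" "P n \<in> Obj C" "p n \<cdot> i n = zmor C (K (Suc n)) (K n)" for n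
    using sesD[OF r(2)[of n]] by simp_all
  note [simp] = t
  have syz: "is_syzygy C E (K (Suc n)) (K n)" for n unfolding is_syzygy_def using r by blast
  have KP: "X \<in> pdim_le C E (n + k) \<longleftrightarrow> K n \<in> pdim_le C E k" for n k
  proof (induction n arbitrary: k)
    case 0 then show ?case using K0 by simp
  next
    case (Suc n) show ?case using Suc.IH[of "Suc k"] pdim_le_syzygy[OF syz[of n]] by simp
  qed
  have dt: "d k \<in> P (Suc k) \<leadsto> P k" for k unfolding dn by simp
  have dd: "d k \<cdot> d (Suc k) = zmor C (P (Suc (Suc k))) (P k)" for k
    unfolding dn by (simp add: ringoid_simps Cmp_reassoc[OF t(9)])
  have Ext: "trivial_group (Ext C E (Suc k) X Z) \<longleftrightarrow>
    (\<forall>f \<in> P (Suc k) \<leadsto> Z. f \<cdot> d (Suc k) = zmor C (P (Suc (Suc k))) Z \<longrightarrow> (\<exists>g \<in> P k \<leadsto> Z. f = g \<cdot> d k))"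
    if "Z \<in> Obj C" for k Z
    unfolding Ext_def Pd prod.case Let_def
    by (rule Hom_cohomology_trivial_iff[where P = P and d = d and B = Z and k = k, OF that t(8) dt dd])
  show ?thesis
  proof
    assume a: "\<forall>j > n. \<forall>Z \<in> Obj C. trivial_group (Ext C E j X Z)"
    have "trivial_group (Ext C E (Suc n) X (K (Suc n)))" using a by simp
    then have "\<forall>f \<in> P (Suc n) \<leadsto> K (Suc n). f \<cdot> d (Suc n) = zmor C (P (Suc (Suc n))) (K (Suc n)) \<longrightarrow>
      (\<exists>g \<in> P n \<leadsto> K (Suc n). f = g \<cdot> d n)" by (simp only: Ext t(7))
    moreover have "p (Suc n) \<in> P (Suc n) \<leadsto> K (Suc n)" by simp
    moreover have "p (Suc n) \<cdot> d (Suc n) = zmor C (P (Suc (Suc n))) (K (Suc n))"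
      unfolding dn by (simp add: Cmp_reassoc[OF t(9)])
    ultimately obtain g where g: "g \<in> P n \<leadsto> K (Suc n)" "p (Suc n) = g \<cdot> d n" by blast
    have gi: "g \<cdot> i n = Idn C (K (Suc n))"
      by (rule ses_epic[OF r(2)[of "Suc n"], of _ "K (Suc n)"]) (use g in \<open>simp_all add: dn ringoid_simps\<close>)
    have "(Idn C (P n) \<boxplus> \<boxminus> (i n \<cdot> g)) \<cdot> i n = zmor C (K (Suc n)) (P n)" using g(1) gi by (simp add: ringoid_simps)
    then obtain s where s: "s \<in> K n \<leadsto> P n" "s \<cdot> p n = Idn C (P n) \<boxplus> \<boxminus> (i n \<cdot> g)"
      by (rule ses_extend[OF r(2)[of n], rotated]) (use g in simp_all)
    have "p n \<cdot> s = Idn C (K n)"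
      by (rule ses_epic[OF r(2)[of n], of _ "K n"]) (use s g(1) in \<open>simp_all add: ringoid_simps Cmp_reassoc[OF t(9)]\<close>)
    then have "retract C (K n) (P n)" unfolding retract_def using s(1) by (intro bexI[of _ s] bexI[of _ "p n"]) simp_all
    then have "K n \<in> projectives C E" by (rule projective_retract[OF _ r(1)])
    then show "X \<in> pdim_le C E n" using KP[of n 0] by simp
  next
    assume a: "X \<in> pdim_le C E n"
    show "\<forall>j > n. \<forall>Z \<in> Obj C. trivial_group (Ext C E j X Z)"
    proof (intro allI impI ballI)
      fix j Z assume j: "j > n" and Z: "Z \<in> Obj C"
      then obtain m where m: "j = Suc m" "n \<le> m" by (cases j) auto
      have "X \<in> pdim_le C E (m + 0)" using pdim_le_mono[OF m(2) a] by simp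
      then have "K m \<in> projectives C E" unfolding KP by simp
      moreover have "Idn C (K m) \<in> K m \<leadsto> K m" by simp
      ultimately obtain s where s: "s \<in> K m \<leadsto> P m" "p m \<cdot> s = Idn C (K m)"
        using projective_lift[OF _ r(2)] by blast
      have "p m \<cdot> (Idn C (P m) \<boxplus> \<boxminus> (s \<cdot> p m)) = zmor C (P m) (K m)" using s by (simp add: ringoid_simps Cmp_reassoc[OF s(2)])
      then obtain u where u: "u \<in> P m \<leadsto> K (Suc m)" "i m \<cdot> u = Idn C (P m) \<boxplus> \<boxminus> (s \<cdot> p m)"
        by (rule ses_lift[OF r(2), rotated]) (use s in simp_all)
      have ui: "u \<cdot> i m = Idn C (K (Suc m))"
        by (rule ses_monic[OF r(2)[of m], of _ "K (Suc m)"]) (use u s(1) in \<open>simp_all add: Cmp_reassoc[OF u(2)] ringoid_simps\<close>)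
      show "trivial_group (Ext C E j X Z)"
        unfolding m(1) Ext[OF Z]
      proof (intro ballI impI)
        fix f assume f: "f \<in> P (Suc m) \<leadsto> Z" "f \<cdot> d (Suc m) = zmor C (P (Suc (Suc m))) Z"
        have "f \<cdot> i (Suc m) = zmor C (K (Suc (Suc m))) Z"
          by (rule ses_epic[OF r(2)[of "Suc (Suc m)"], of _ Z]) (use f Z in \<open>simp_all add: dn ringoid_simps\<close>)
        then obtain g where g: "g \<in> K (Suc m) \<leadsto> Z" "g \<cdot> p (Suc m) = f" using ses_extend[OF r(2) f(1)] by blast
        have "g \<cdot> u \<in> P m \<leadsto> Z" using g(1) u(1) by simp
        moreover have "f = g \<cdot> u \<cdot> d m" using g u(1) by (simp add: dn ringoid_simps Cmp_reassoc[OF ui])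
        ultimately show "\<exists>g \<in> P m \<leadsto> Z. f = g \<cdot> d m" by blast
      qed
    qed
  qed
qed

lemma pd_le_iff:
  assumes X: "X \<in> Obj C" shows "pd C E X \<le> enat n \<longleftrightarrow> X \<in> pdim_le C E n"
proof -
  have e: "pd C E X = Inf {enat n |n. X \<in> pdim_le C E n}" unfolding pd_def using Ext_trivial_iff[OF X] by simp
  show ?thesis
  proof
    assume "X \<in> pdim_le C E n"
    then show "pd C E X \<le> enat n" unfolding e by (intro Inf_lower) blast
  next
    assume le: "pd C E X \<le> enat n"
    have ne: "{enat n |n. X \<in> pdim_le C E n} \<noteq> {}"
    proof
      assume "{enat n |n. X \<in> pdim_le C E n} = {}"
      then have "pd C E X = \<infinity>" unfolding e by (simp only: Inf_enat_def if_True simp_thms)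
      with le show False by simp
    qed
    then have "Inf {enat n |n. X \<in> pdim_le C E n} \<in> {enat n |n. X \<in> pdim_le C E n}"
      by (simp only: Inf_enat_def if_False) (rule LeastI_ex, blast)
    then obtain m where "pd C E X = enat m" "X \<in> pdim_le C E m" unfolding e by blast
    with le show "X \<in> pdim_le C E n" using pdim_le_mono by simp
  qed
qed

lemma pd_finite_iff:
  assumes X: "X \<in> Obj C" shows "pd C E X < \<infinity> \<longleftrightarrow> (\<exists>n. X \<in> pdim_le C E n)"
  using pd_le_iff[OF X] by (cases "pd C E X") (auto simp flip: pd_le_iff[OF X])

end

section \<open>Extensions with stably isomorphic terms\<close>

context exact_category
begin

text \<open>Split sequences belong to \<open>E\<close>: the sequence \<open>0 \<rightarrow> Y \<rightarrow> Y\<close> does by the axiom on identities, and its pushout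
along \<open>0 \<rightarrow> X\<close> is isomorphic to the split one.\<close>

lemma biprod2_ses:
  assumes b: "biprod2 C S X Y i p j q" shows "ses C E X i S q Y"
proof -
  note B = biprod2D[OF b]
  note [simp] = B(10-)
  have "adm_epic C E Y Y (Idn C Y)" by (rule Idn_adm_epic) simp
  then obtain k K where s: "ses C E K k Y (Idn C Y) Y" unfolding adm_epic_def by blast
  note S = sesD[OF s]
  note [simp] = S(4) S(7,9,10)
  have k: "k = zmor C K Y" using S(3) by simp
  \<comment> \<open>The kernel of an identity is a zero object.\<close>
  have "Idn C K = zmor C K K" by (rule ses_monic[OF s, of _ K]) (simp_all add: k)
  then have K: "zero_object C K" by (simp add: zero_object_iff)
  have "zmor C K X \<in> K \<leadsto> X" by simp
  from pushout_ses[OF s this] obtain B' v i' p' where B': "B' \<in> Obj C"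
    and po: "is_pushout C K Y X B' k (zmor C K X) v i'" and s': "ses C E X i' B' p' Y" and pv: "p' \<cdot> v = Idn C Y" by blast
  note S' = sesD[OF s']
  note [simp] = S'(5,7-12)
  note PO = pushoutE[OF po S(4) B(23) B(22) B']
  have vt: "arr C v" "src C v = Y" "tgt C v = B'" using PO(3) by simp_all
  note [simp] = vt
  have "\<exists>w \<in> B' \<leadsto> S. w \<cdot> v = j \<and> w \<cdot> i' = i" by (rule PO(6)) (simp_all add: k)
  then obtain w where w: "w \<in> B' \<leadsto> S" "w \<cdot> v = j" "w \<cdot> i' = i" by blast
  have wt: "arr C w" "src C w = B'" "tgt C w = S" using w by simp_all
  note [simp] = wt
  define u where "u = i' \<cdot> p \<boxplus> v \<cdot> q"
  have u: "arr C u" "src C u = S" "tgt C u = B'" unfolding u_def by simp_all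
  note [simp] = u
  have wu: "w \<cdot> u = Idn C S" unfolding u_def by (simp add: ringoid_simps Cmp_reassoc[OF w(2)] Cmp_reassoc[OF w(3)] B(9))
  have uj: "u \<cdot> j = v" "u \<cdot> i = i'" unfolding u_def by (simp_all add: ringoid_simps B)
  have uw: "u \<cdot> w = Idn C B'" by (rule PO(7)[of _ B']) (simp_all add: ringoid_simps w uj)
  have qw: "p' = q \<cdot> w" by (rule PO(7)[of _ Y]) (simp_all add: ringoid_simps w B pv S'(3))
  have "(i, q) \<in> E"
  proof (rule iso_closed[OF s' _ _ _ _ _ _ _ _])
    show "iso_mor C X X (Idn C X)" using iso_mor_iff[of X X "Idn C X"] by auto
    show "iso_mor C Y Y (Idn C Y)" using iso_mor_iff[of Y Y "Idn C Y"] by auto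
    show "iso_mor C B' S w" using iso_mor_iff[of B' S w] wu uw u by auto
  qed (simp_all add: mor_iff w(3) qw)
  then show ?thesis unfolding ses_def by (simp add: mor_iff)
qed

lemma ses_triangle: "ses C E A i B p D \<Longrightarrow> triangle A B D"
proof -
  assume s: "ses C E A i B p D"
  have "isomorphic St A A" "isomorphic St B B" "isomorphic St D D"
    by (rule st.isomorphic_refl; simp add: sesD(4-6)[OF s])+
  then show ?thesis unfolding triangle_def using s sesD(4-6)[OF s] by blast
qed

lemma endpow_cls: "a \<in> X \<leadsto> X \<Longrightarrow> endpow St X (cls a) k = cls (endpow C X a k)"
  by (induction k) (simp_all add: cls_Idn cls_Cmp)

text \<open>A stable idempotent of \<open>W\<close> need not lift to an idempotent, but any lift \<open>g\<close> has a Fitting decomposition. Stably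
its nilpotent part is zero and its invertible part an identity, so the summand on which \<open>g\<close> is invertible
represents the given stable retract.\<close>

lemma stable_summand_lift:
  assumes fit: "fitting_property C" and r: "retract St Y W"
  obtains Y' where "direct_summand C Y' W" "isomorphic St Y' Y"
proof -
  obtain F G where F: "F \<in> Y \<leadsto>\<^bsub>St\<^esub> W" and G: "G \<in> W \<leadsto>\<^bsub>St\<^esub> Y" and GF: "G \<cdot>\<^bsub>St\<^esub> F = Idn St Y"
    using r unfolding retract_def by blast
  obtain s where s: "s \<in> Y \<leadsto> W" "F = cls s" using st_arrowsE[OF F] .
  obtain r where r: "r \<in> W \<leadsto> Y" "G = cls r" using st_arrowsE[OF G] .
  have sr: "s \<cdot> r \<in> W \<leadsto> W" using s r by simp
  obtain A N i p j q \<theta> \<theta>' \<alpha> k where b: "biprod2 C W A N i p j q" and th: "\<theta> \<in> A \<leadsto> A" "\<theta>' \<in> A \<leadsto> A"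
    "\<theta>' \<cdot> \<theta> = Idn C A" and al: "\<alpha> \<in> N \<leadsto> N" "endpow C N \<alpha> k = zmor C N N"
    and e: "s \<cdot> r = i \<cdot> (\<theta> \<cdot> p) \<boxplus> j \<cdot> (\<alpha> \<cdot> q)" using fitting_decomposition[OF fit sr] by metis
  note B = biprod2D[OF b]
  note [simp] = B(10-)
  have idem: "cls (s \<cdot> r) \<cdot>\<^bsub>St\<^esub> cls (s \<cdot> r) = cls (s \<cdot> r)"
    using s r F G by (simp add: cls_Cmp st.ringoid_simps st.Cmp_reassoc[OF GF[unfolded s(2) r(2)]])
  have "cls i \<cdot>\<^bsub>St\<^esub> cls p = cls (s \<cdot> r)"
  proof (rule st.idempotent_fitting[OF biprod2_cls[OF b] _ _ _ _ _ _ idem])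
    show "cls \<theta> \<in> A \<leadsto>\<^bsub>St\<^esub> A" "cls \<theta>' \<in> A \<leadsto>\<^bsub>St\<^esub> A" "cls \<alpha> \<in> N \<leadsto>\<^bsub>St\<^esub> N"
      by (rule cls_arrows, fact)+
    show "cls \<theta>' \<cdot>\<^bsub>St\<^esub> cls \<theta> = Idn St A" using th by (simp flip: cls_Cmp add: cls_Idn)
    show "endpow St N (cls \<alpha>) k = zmor St N N" using al by (simp add: endpow_cls cls_zero)
    show "cls (s \<cdot> r) = cls i \<cdot>\<^bsub>St\<^esub> (cls \<theta> \<cdot>\<^bsub>St\<^esub> cls p) \<boxplus>\<^bsub>St\<^esub> cls j \<cdot>\<^bsub>St\<^esub> (cls \<alpha> \<cdot>\<^bsub>St\<^esub> cls q)"
      unfolding e using th al by (simp add: cls_simps)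
  qed
  then have ip: "cls i \<cdot>\<^bsub>St\<^esub> cls p = F \<cdot>\<^bsub>St\<^esub> G" using s r by (simp add: cls_Cmp)
  have pi: "cls p \<cdot>\<^bsub>St\<^esub> cls i = Idn St A" using B(5) by (simp flip: cls_Cmp add: cls_Idn)
  have "isomorphic St A Y"
  proof (rule st.isomorphicI[of "G \<cdot>\<^bsub>St\<^esub> cls i" A Y "cls p \<cdot>\<^bsub>St\<^esub> F"])
    show "G \<cdot>\<^bsub>St\<^esub> cls i \<in> A \<leadsto>\<^bsub>St\<^esub> Y" "cls p \<cdot>\<^bsub>St\<^esub> F \<in> Y \<leadsto>\<^bsub>St\<^esub> A" using F G by simp_all
    have "cls p \<cdot>\<^bsub>St\<^esub> F \<cdot>\<^bsub>St\<^esub> (G \<cdot>\<^bsub>St\<^esub> cls i) = cls p \<cdot>\<^bsub>St\<^esub> (F \<cdot>\<^bsub>St\<^esub> G) \<cdot>\<^bsub>St\<^esub> cls i"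
      using F G by (simp add: st.ringoid_simps)
    also have "\<dots> = Idn St A" unfolding ip[symmetric] using pi by (simp add: st.ringoid_simps)
    finally show "cls p \<cdot>\<^bsub>St\<^esub> F \<cdot>\<^bsub>St\<^esub> (G \<cdot>\<^bsub>St\<^esub> cls i) = Idn St A" .
    have "G \<cdot>\<^bsub>St\<^esub> cls i \<cdot>\<^bsub>St\<^esub> (cls p \<cdot>\<^bsub>St\<^esub> F) = G \<cdot>\<^bsub>St\<^esub> (cls i \<cdot>\<^bsub>St\<^esub> cls p) \<cdot>\<^bsub>St\<^esub> F"
      using F G by (simp add: st.ringoid_simps)
    also have "\<dots> = Idn St Y" unfolding ip using F G GF by (simp add: st.ringoid_simps st.Cmp_reassoc[OF GF])
    finally show "G \<cdot>\<^bsub>St\<^esub> cls i \<cdot>\<^bsub>St\<^esub> (cls p \<cdot>\<^bsub>St\<^esub> F) = Idn St Y" .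
  qed
  moreover have "direct_summand C A W" unfolding direct_summand_iff direct_sum_two using b by blast
  ultimately show ?thesis using that by blast
qed

end

context exact_IT_context
begin

text \<open>Push out \<open>f\<close> along the section \<open>X \<rightarrow> S'\<close> found in the previous step, and compose. The new cokernel is an extension of \<open>Z\<close> by the previous one, and the
retraction to \<open>X\<close> extends to the pushout so that the component \<open>X \<rightarrow> X\<close> is multiplied by \<open>\<tau> \<cdot> f\<close>.\<close>

lemma extension_powers:
  assumes s: "ses C E X f S g Z" and t: "\<tau> \<in> S \<leadsto> X" and k: "\<kappa> \<in> X \<leadsto> S" "\<tau> \<cdot> \<kappa> = Idn C X" and Z: "Z \<in> pdim_le C E r"
  shows "\<exists>S' h c Z' t k. ses C E X h S' c Z' \<and> Z' \<in> pdim_le C E r \<and> t \<in> S' \<leadsto> X \<and> k \<in> X \<leadsto> S' \<and>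
    t \<cdot> k = Idn C X \<and> t \<cdot> h = endpow C X (\<tau> \<cdot> f) (Suc m)"
proof (induction m)
  case 0
  have "endpow C X (\<tau> \<cdot> f) (Suc 0) = \<tau> \<cdot> f" using t sesD(1)[OF s] by simp
  then show ?case using assms by metis
next
  case (Suc m)
  then obtain S' h c Z' t' k' where s': "ses C E X h S' c Z'" and Z': "Z' \<in> pdim_le C E r"
    and t': "t' \<in> S' \<leadsto> X" and k': "k' \<in> X \<leadsto> S'" "t' \<cdot> k' = Idn C X"
    and th: "t' \<cdot> h = endpow C X (\<tau> \<cdot> f) (Suc m)" by blast
  note [simp] = sesD(4-12)[OF s] sesD(4-12)[OF s']
  obtain S'' v f' p' where S'': "S'' \<in> Obj C" and po: "is_pushout C X S S' S'' f k' v f'"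
    and s'': "ses C E S' f' S'' p' Z" using pushout_ses[OF s k'(1)] by blast
  note PO = pushoutE[OF po sesD(4,5)[OF s] sesD(5)[OF s'] S'']
  note [simp] = sesD(4-12)[OF s'']
  obtain G c' a b where G: "ses C E X (f' \<cdot> h) S'' c' G" and G': "ses C E Z' a G b Z"
    using noether_ses[OF s' s''] by blast
  have G'': "G \<in> pdim_le C E r" by (rule pdim_le_extension[OF ses_triangle[OF G'] Z' Z])
  have al: "\<tau> \<cdot> f \<in> X \<leadsto> X" using t by simp
  have "\<exists>w \<in> S'' \<leadsto> X. w \<cdot> v = \<tau> \<and> w \<cdot> f' = (\<tau> \<cdot> f) \<cdot> t'"
    by (rule PO(6)) (use t t' k' in \<open>simp_all add: ringoid_simps\<close>)
  then obtain w where w: "w \<in> S'' \<leadsto> X" "w \<cdot> v = \<tau>" "w \<cdot> f' = (\<tau> \<cdot> f) \<cdot> t'" by blast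
  have "v \<cdot> \<kappa> \<in> X \<leadsto> S''" using PO(3) k(1) by simp
  moreover have "w \<cdot> (v \<cdot> \<kappa>) = Idn C X" using w(1) PO(3) k by (simp add: Cmp_reassoc[OF w(2)])
  moreover have "w \<cdot> (f' \<cdot> h) = endpow C X (\<tau> \<cdot> f) (Suc (Suc m))"
  proof -
    have "w \<cdot> (f' \<cdot> h) = (\<tau> \<cdot> f) \<cdot> t' \<cdot> h" using w(1) by (simp add: Cmp_reassoc[OF w(3)])
    also have "\<dots> = (\<tau> \<cdot> f) \<cdot> (t' \<cdot> h)" using t t' by (intro Cmp_assoc') simp_all
    also have "\<dots> = endpow C X (\<tau> \<cdot> f) (Suc (Suc m))"
      unfolding th endpow_commute[OF al] by simp
    finally show ?thesis .
  qed
  ultimately show ?case using G G'' w(1) by blast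
qed

text \<open>The core of the Igusa--Todorov argument. Fitting's property decomposes \<open>\<tau> \<cdot> f\<close> as an automorphism \<open>\<theta>\<close> of
a summand \<open>A\<close> of \<open>X\<close> plus a nilpotent \<open>\<alpha>\<close> on the complement \<open>Y\<close>. Once the power of \<open>\<alpha>\<close> vanishes,
\<open>extension_powers\<close> makes \<open>Y\<close> a retract of an iterated self-extension of \<open>Z\<close>. On the other hand
\<open>A \<rightarrow> X \<rightarrow> S\<close> is a split monomorphism because \<open>\<theta>\<close> is invertible, and its cokernel \<open>G\<close> is a stable retract of
\<open>Y\<close> and an extension of \<open>Z\<close> by \<open>Y\<close>.\<close>

lemma stably_split_extension:
  assumes fit: "fitting_property C" and s: "ses C E X f S g Z" and t: "\<tau> \<in> S \<leadsto> X"
    and k: "\<kappa> \<in> X \<leadsto> S" "\<tau> \<cdot> \<kappa> = Idn C X" and kt: "cls (\<kappa> \<cdot> \<tau>) = Idn St S" and Z: "Z \<in> pdim_le C E r"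
  shows "\<exists>Y. direct_summand C Y X \<and> Y \<in> pdim_le C E r \<and> (\<forall>l. Y \<in> pdim_le C E l \<longrightarrow> Z \<in> pdim_le C E (Suc l))"
proof -
  note S = sesD[OF s]
  note [simp] = S(4-12)
  have tt: "arr C \<tau>" "src C \<tau> = S" "tgt C \<tau> = X" "arr C \<kappa>" "src C \<kappa> = X" "tgt C \<kappa> = S" using t k by simp_all
  note [simp] = tt
  have al: "\<tau> \<cdot> f \<in> X \<leadsto> X" by simp
  obtain A Y i p j q \<theta> \<theta>' \<alpha> n where b: "biprod2 C X A Y i p j q" and th: "\<theta> \<in> A \<leadsto> A" "\<theta>' \<in> A \<leadsto> A"
    "\<theta>' \<cdot> \<theta> = Idn C A" "\<theta> \<cdot> \<theta>' = Idn C A" and nil: "\<alpha> \<in> Y \<leadsto> Y" "endpow C Y \<alpha> n = zmor C Y Y"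
    and e: "\<tau> \<cdot> f = i \<cdot> (\<theta> \<cdot> p) \<boxplus> j \<cdot> (\<alpha> \<cdot> q)" using fitting_decomposition[OF fit al] by metis
  note B = biprod2D[OF b]
  note [simp] = B(10-)
  have tht: "arr C \<theta>" "src C \<theta> = A" "tgt C \<theta> = A" "arr C \<theta>'" "src C \<theta>' = A" "tgt C \<theta>' = A"
    "arr C \<alpha>" "src C \<alpha> = Y" "tgt C \<alpha> = Y" using th nil by simp_all
  note [simp] = tht
  have Y1: "direct_summand C Y X" unfolding direct_summand_iff direct_sum_two using biprod2_swap[OF b] by blast
  have qa: "q \<cdot> (\<tau> \<cdot> f) = \<alpha> \<cdot> q" unfolding e by (simp add: ringoid_simps Cmp_reassoc[OF B(6)] Cmp_reassoc[OF B(8)])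
  have pa: "p \<cdot> (\<tau> \<cdot> f) = \<theta> \<cdot> p" unfolding e by (simp add: ringoid_simps Cmp_reassoc[OF B(5)] Cmp_reassoc[OF B(7)])
  obtain S' h c Z' t' k' where s': "ses C E X h S' c Z'" and Z': "Z' \<in> pdim_le C E r"
    and t': "t' \<in> S' \<leadsto> X" and k': "k' \<in> X \<leadsto> S'" "t' \<cdot> k' = Idn C X"
    and th': "t' \<cdot> h = endpow C X (\<tau> \<cdot> f) (Suc n)" using extension_powers[OF s t k Z, of n] by blast
  note [simp] = sesD(4-12)[OF s']
  have "endpow C Y \<alpha> (Suc n) = zmor C Y Y" using nil by simp
  then have "q \<cdot> (t' \<cdot> h) = zmor C X Y"
    unfolding th' endpow_intertwine[OF al nil(1) B(4) qa] by simp
  then have "q \<cdot> t' \<cdot> h = zmor C X Y" using t' by (simp add: ringoid_simps)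
  then obtain u where u: "u \<in> Z' \<leadsto> Y" "u \<cdot> c = q \<cdot> t'"
    by (rule ses_extend[OF s', rotated]) (use t' in simp_all)
  have "u \<cdot> (c \<cdot> (k' \<cdot> j)) = Idn C Y"
    using u t' k' by (simp add: Cmp_reassoc[OF u(2)] ringoid_simps Cmp_reassoc[OF k'(2)] B(6))
  then have "cls u \<cdot>\<^bsub>St\<^esub> cls (c \<cdot> (k' \<cdot> j)) = Idn St Y"
    using u(1) k'(1) by (simp flip: cls_Cmp add: cls_Idn)
  moreover have "cls u \<in> Z' \<leadsto>\<^bsub>St\<^esub> Y" "cls (c \<cdot> (k' \<cdot> j)) \<in> Y \<leadsto>\<^bsub>St\<^esub> Z'" using u(1) k'(1) by simp_all
  \<comment> \<open>The composite \<open>Y \<rightarrow> X \<rightarrow> S' \<rightarrow> Z' \<rightarrow> Y\<close> is the identity.\<close>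
  ultimately have "retract St Y Z'" unfolding retract_def by blast
  then have Y2: "Y \<in> pdim_le C E r" by (rule pdim_le_retract[OF Z'])
  obtain G c' m h' where G: "ses C E A (f \<cdot> i) S c' G" and G': "ses C E Y m G h' Z"
    using noether_ses[OF biprod2_ses[OF b] s] by blast
  note [simp] = sesD(4-12)[OF G]
  have cfi: "c' \<cdot> (f \<cdot> i) = zmor C A G" by (rule sesD(3)[OF G])
  \<comment> \<open>A retraction of \<open>f \<cdot> i\<close>; the induced \<open>\<sigma>\<close> below is a section of \<open>c'\<close>.\<close>
  define \<rho> where "\<rho> = \<theta>' \<cdot> (p \<cdot> \<tau>)"
  have rt: "arr C \<rho>" "src C \<rho> = S" "tgt C \<rho> = A" unfolding \<rho>_def by simp_all
  note [simp] = rt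
  have ptf: "p \<cdot> (\<tau> \<cdot> (f \<cdot> i)) = \<theta>"
  proof -
    have "p \<cdot> (\<tau> \<cdot> (f \<cdot> i)) = p \<cdot> (\<tau> \<cdot> f) \<cdot> i" by (simp add: ringoid_simps)
    also have "\<dots> = \<theta>" unfolding pa by (simp add: ringoid_simps B(5))
    finally show ?thesis .
  qed
  have rfi: "\<rho> \<cdot> (f \<cdot> i) = Idn C A" unfolding \<rho>_def by (simp add: ringoid_simps ptf th(3))
  have "(Idn C S \<boxplus> \<boxminus> (f \<cdot> (i \<cdot> \<rho>))) \<cdot> (f \<cdot> i) = zmor C A S"
    by (simp add: ringoid_simps rfi)
  then obtain \<sigma> where sg: "\<sigma> \<in> G \<leadsto> S" "\<sigma> \<cdot> c' = Idn C S \<boxplus> \<boxminus> (f \<cdot> (i \<cdot> \<rho>))"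
    by (rule ses_extend[OF G, rotated]) simp_all
  have st: "arr C \<sigma>" "src C \<sigma> = G" "tgt C \<sigma> = S" using sg by simp_all
  note [simp] = st
  have "c' \<cdot> (f \<cdot> (i \<cdot> \<rho>)) = zmor C S G"
  proof -
    have "c' \<cdot> (f \<cdot> (i \<cdot> \<rho>)) = c' \<cdot> (f \<cdot> i) \<cdot> \<rho>" by (simp add: ringoid_simps)
    then show ?thesis unfolding cfi by simp
  qed
  note cfr = this
  have cs: "c' \<cdot> \<sigma> = Idn C G"
    by (rule ses_epic[OF G, of _ G]) (simp_all add: ringoid_simps sg(2) cfr)
  have "p \<cdot> (\<tau> \<cdot> (f \<cdot> (i \<cdot> \<rho>))) = p \<cdot> \<tau>"
  proof -
    have "p \<cdot> (\<tau> \<cdot> (f \<cdot> (i \<cdot> \<rho>))) = (p \<cdot> (\<tau> \<cdot> (f \<cdot> i))) \<cdot> \<rho>" by (simp add: ringoid_simps)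
    also have "\<dots> = p \<cdot> \<tau>" unfolding ptf \<rho>_def by (simp add: Cmp_reassoc[OF th(4)])
    finally show ?thesis .
  qed
  note ptr = this
  have pts: "p \<cdot> (\<tau> \<cdot> \<sigma>) = zmor C G A"
    by (rule ses_epic[OF G, of _ A]) (simp_all add: ringoid_simps sg(2) ptr)
  \<comment> \<open>The section \<open>\<sigma>\<close> has no component in \<open>A\<close>, so stably it passes through \<open>Y\<close>.\<close>
  have ts: "\<tau> \<cdot> \<sigma> = j \<cdot> (q \<cdot> (\<tau> \<cdot> \<sigma>))"
  proof -
    have "(i \<cdot> p \<boxplus> j \<cdot> q) \<cdot> (\<tau> \<cdot> \<sigma>) = \<tau> \<cdot> \<sigma>" unfolding B(9) by simp
    then show ?thesis by (simp add: ringoid_simps pts)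
  qed
  have "cls (c' \<cdot> (\<kappa> \<cdot> j)) \<cdot>\<^bsub>St\<^esub> cls (q \<cdot> (\<tau> \<cdot> \<sigma>)) = cls (c' \<cdot> (\<kappa> \<cdot> (j \<cdot> (q \<cdot> (\<tau> \<cdot> \<sigma>)))))"
    by (simp flip: cls_Cmp add: ringoid_simps)
  also have "\<dots> = cls (c' \<cdot> ((\<kappa> \<cdot> \<tau>) \<cdot> \<sigma>))" unfolding ts[symmetric] by (simp add: ringoid_simps)
  also have "\<dots> = cls c' \<cdot>\<^bsub>St\<^esub> (cls (\<kappa> \<cdot> \<tau>) \<cdot>\<^bsub>St\<^esub> cls \<sigma>)" by (simp add: cls_Cmp[of _ c'] cls_Cmp[of \<sigma>])
  also have "\<dots> = Idn St G" unfolding kt using cs by (simp flip: cls_Cmp add: cls_Idn)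
  finally have "cls (c' \<cdot> (\<kappa> \<cdot> j)) \<cdot>\<^bsub>St\<^esub> cls (q \<cdot> (\<tau> \<cdot> \<sigma>)) = Idn St G" .
  moreover have "cls (c' \<cdot> (\<kappa> \<cdot> j)) \<in> Y \<leadsto>\<^bsub>St\<^esub> G" "cls (q \<cdot> (\<tau> \<cdot> \<sigma>)) \<in> G \<leadsto>\<^bsub>St\<^esub> Y" by simp_all
  ultimately have "retract St G Y" unfolding retract_def by blast
  then have "Z \<in> pdim_le C E (Suc l)" if "Y \<in> pdim_le C E l" for l
    using pdim_le_third[OF ses_triangle[OF G'] that] pdim_le_retract[OF that] by blast
  then show ?thesis using Y1 Y2 by blast
qed

text \<open>A stable isomorphism \<open>X \<rightarrow> B'\<close> becomes a split monomorphism of \<open>C\<close> after adding to \<open>B'\<close> a projective \<open>Q\<close> that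
absorbs the error term.\<close>

lemma stable_iso_split:
  assumes o: "X \<in> Obj C" "B' \<in> Obj C" and XB: "isomorphic St X B'"
  obtains Q W i1 p1 i2 p2 \<tau> \<kappa> where "Q \<in> projectives C E" "biprod2 C W B' Q i1 p1 i2 p2"
    "\<tau> \<in> W \<leadsto> X" "\<kappa> \<in> X \<leadsto> W" "\<tau> \<cdot> \<kappa> = Idn C X" "cls (\<kappa> \<cdot> \<tau>) = Idn St W"
proof -
  note [simp] = o
  obtain \<Psi> \<Phi> where P: "\<Psi> \<in> X \<leadsto>\<^bsub>St\<^esub> B'" "\<Phi> \<in> B' \<leadsto>\<^bsub>St\<^esub> X" "\<Phi> \<cdot>\<^bsub>St\<^esub> \<Psi> = Idn St X" "\<Psi> \<cdot>\<^bsub>St\<^esub> \<Phi> = Idn St B'"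
    by (rule st.isomorphicE[OF XB]) simp_all
  obtain \<psi> where ps: "\<psi> \<in> X \<leadsto> B'" "\<Psi> = cls \<psi>" using st_arrowsE[OF P(1)] .
  obtain \<phi> where ph: "\<phi> \<in> B' \<leadsto> X" "\<Phi> = cls \<phi>" using st_arrowsE[OF P(2)] .
  have t1: "arr C \<psi>" "src C \<psi> = X" "tgt C \<psi> = B'" "arr C \<phi>" "src C \<phi> = B'" "tgt C \<phi> = X" using ps ph by simp_all
  note [simp] = t1
  have "cls (Idn C X) = cls (\<phi> \<cdot> \<psi>)" using P(3) ps ph by (simp add: cls_Cmp cls_Idn)
  then have "proj_factors (Idn C X \<boxplus> \<boxminus> (\<phi> \<cdot> \<psi>))" by (subst (asm) cls_eq_iff) simp_all
  \<comment> \<open>The error of \<open>\<phi> \<cdot> \<psi> = 1\<close> factors through a projective \<open>Q\<close>.\<close>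
  then obtain Q a b where Q: "Q \<in> projectives C E" "a \<in> X \<leadsto> Q" "b \<in> Q \<leadsto> X" "b \<cdot> a = Idn C X \<boxplus> \<boxminus> (\<phi> \<cdot> \<psi>)"
    using proj_factorsE[of "Idn C X \<boxplus> \<boxminus> (\<phi> \<cdot> \<psi>)"] by auto
  have t2: "arr C a" "src C a = X" "tgt C a = Q" "arr C b" "src C b = Q" "tgt C b = X" "Q \<in> Obj C" using Q by simp_all
  note [simp] = t2
  obtain W where W: "direct_sum C W [B', Q]" using ex_direct_sum[of B' Q] by auto
  then obtain i1 p1 i2 p2 where bp: "biprod2 C W B' Q i1 p1 i2 p2" unfolding direct_sum_two by blast
  note B = biprod2D[OF bp]
  note [simp] = B(10-)
  define \<tau> where "\<tau> = \<phi> \<cdot> p1 \<boxplus> b \<cdot> p2"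
  define \<kappa> where "\<kappa> = i1 \<cdot> \<psi> \<boxplus> i2 \<cdot> a"
  have tk: "\<tau> \<in> W \<leadsto> X" "\<kappa> \<in> X \<leadsto> W" unfolding \<tau>_def \<kappa>_def by simp_all
  have "\<tau> \<cdot> \<kappa> = \<phi> \<cdot> \<psi> \<boxplus> b \<cdot> a" unfolding \<tau>_def \<kappa>_def
    by (simp add: ringoid_simps Cmp_reassoc[OF B(5)] Cmp_reassoc[OF B(6)] Cmp_reassoc[OF B(7)] Cmp_reassoc[OF B(8)])
  also have "\<dots> = \<phi> \<cdot> \<psi> \<boxplus> (\<boxminus> (\<phi> \<cdot> \<psi>) \<boxplus> Idn C X)" unfolding Q(4) by (subst (2) addm_comm) simp_all
  also have "\<dots> = Idn C X" by simp
  finally have tk1: "\<tau> \<cdot> \<kappa> = Idn C X" .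
  have Q0: "zero_object St Q" using Q(1) projective_iff_zero by simp
  have "cls a = Idn St Q \<cdot>\<^bsub>St\<^esub> cls a" by simp
  then have za: "cls a = zmor St X Q" unfolding st.zero_objectD(2)[OF Q0] by simp
  have "cls p2 = Idn St Q \<cdot>\<^bsub>St\<^esub> cls p2" by simp
  then have zp: "cls p2 = zmor St W Q" unfolding st.zero_objectD(2)[OF Q0] by simp
  have one: "cls i1 \<cdot>\<^bsub>St\<^esub> cls p1 = Idn St W" using biprod2D(9)[OF bp, THEN arg_cong[of _ _ cls]] zp by (simp add: cls_simps)
  have "cls (\<kappa> \<cdot> \<tau>) = cls i1 \<cdot>\<^bsub>St\<^esub> (\<Psi> \<cdot>\<^bsub>St\<^esub> (\<Phi> \<cdot>\<^bsub>St\<^esub> cls p1))"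
    unfolding \<tau>_def \<kappa>_def ps(2) ph(2) by (simp add: cls_simps za zp st.ringoid_simps)
  also have "\<dots> = Idn St W" using P(1,2) one by (simp add: st.Cmp_reassoc[OF P(4)])
  finally have "cls (\<kappa> \<cdot> \<tau>) = Idn St W" .
  then show ?thesis using that[OF Q(1) bp tk(1,2) tk1] by blast
qed

text \<open>Replace \<open>B\<close> by \<open>B \<oplus> Q\<close> so that the stable isomorphism becomes a retraction; this changes \<open>D\<close> only by an extension
with the projective \<open>Q\<close>.\<close>

lemma stably_equal_terms:
  assumes fit: "fitting_property C" and t: "triangle A B D" and AB: "isomorphic St A B" and D: "D \<in> pdim_le C E r"
  shows "\<exists>X Y. isomorphic St X A \<and> X \<in> Obj C \<and> direct_summand C Y X \<and> Y \<in> pdim_le C E r \<and>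
    (\<forall>l. Y \<in> pdim_le C E l \<longrightarrow> D \<in> pdim_le C E (Suc l))"
proof -
  obtain X B' D' f g where s: "ses C E X f B' g D'"
    and iso: "isomorphic St X A" "isomorphic St B' B" "isomorphic St D' D"
    and o: "A \<in> Obj C" "B \<in> Obj C" "D \<in> Obj C" using t unfolding triangle_def by blast
  note S = sesD[OF s]
  note [simp] = S(4-12)
  have "isomorphic St X B" using stable_iso_trans[OF iso(1) AB] o by simp
  then have "isomorphic St X B'" using stable_iso_trans stable_iso_sym[OF iso(2)] o by simp
  then obtain Q W i1 p1 i2 p2 \<tau> \<kappa> where Q: "Q \<in> projectives C E" and bp: "biprod2 C W B' Q i1 p1 i2 p2"
    and tk: "\<tau> \<in> W \<leadsto> X" "\<kappa> \<in> X \<leadsto> W" and tk1: "\<tau> \<cdot> \<kappa> = Idn C X" and kt: "cls (\<kappa> \<cdot> \<tau>) = Idn St W"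
    by (rule stable_iso_split[OF S(4,5)])
  obtain G c m h where G: "ses C E X (i1 \<cdot> f) W c G" and G': "ses C E D' m G h Q"
    using noether_ses[OF s biprod2_ses[OF bp]] by blast
  have "isomorphic St D' G" by (rule triangle_projective[OF ses_triangle[OF G'] Q])
  then have "isomorphic St G D'" using stable_iso_sym sesD(4,5)[OF G'] by blast
  then have GD: "isomorphic St G D" using stable_iso_trans[OF _ iso(3)] sesD(4,5)[OF G'] o by blast
  then have Gr: "G \<in> pdim_le C E r" using pdim_le_iso[OF D] sesD(5)[OF G'] by blast
  obtain Y where Y: "direct_summand C Y X" "Y \<in> pdim_le C E r" "\<forall>l. Y \<in> pdim_le C E l \<longrightarrow> G \<in> pdim_le C E (Suc l)"
    using stably_split_extension[OF fit G tk tk1 kt Gr] by blast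
  have "D \<in> pdim_le C E (Suc l)" if "Y \<in> pdim_le C E l" for l
    using Y(3) that pdim_le_iso_iff[OF GD] sesD(5)[OF G'] o by blast
  then show ?thesis using iso(1) S(4) Y(1,2) by blast
qed

end

section \<open>Finitely generated abelian groups\<close>

text \<open>The union of the chain is generated by its least positive element, which occurs at some stage.\<close>

lemma int_subgroup_chain:
  fixes J :: "nat \<Rightarrow> int set"
  assumes "\<And>m. 0 \<in> J m" "\<And>m x y. x \<in> J m \<Longrightarrow> y \<in> J m \<Longrightarrow> x - y \<in> J m" "\<And>m. J m \<subseteq> J (Suc m)"
  shows "\<exists>k. \<forall>m \<ge> k. J m = J k"
proof (cases "\<exists>m. \<exists>x \<in> J m. x > 0")
  case False
  have "J m = {0}" for m
  proof -
    have "x = 0" if x: "x \<in> J m" for x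
    proof -
      have "0 - x \<in> J m" using assms(1,2) x by blast
      then have "\<not> 0 - x > 0" "\<not> x > 0" using False x by blast+
      then show ?thesis by linarith
    qed
    then show ?thesis using assms(1) by blast
  qed
  then show ?thesis by simp
next
  case True
  have mono: "J m \<subseteq> J m'" if "m \<le> m'" for m m' using that assms(3) by (rule lift_Suc_mono_le[rotated])
  define P where "P g \<longleftrightarrow> g > 0 \<and> (\<exists>m. int g \<in> J m)" for g
  obtain m x where mx: "x \<in> J m" "x > 0" using True by blast
  then have "P (nat x)" unfolding P_def by auto
  then have g: "P (LEAST g. P g)" by (rule LeastI)
  define g where "g = (LEAST g. P g)"
  obtain k where k: "int g \<in> J k" "g > 0" using g unfolding P_def g_def by blast
  \<comment> \<open>All multiples of the least positive element occur at the stage where it occurs.\<close>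
  have mult: "c * int g \<in> J k" for c :: int
  proof -
    have neg: "- x \<in> J k" if "x \<in> J k" for x using assms(2)[OF assms(1) that] by simp
    have nat: "int n * int g \<in> J k" for n
    proof (induction n)
      case (Suc n)
      have "int n * int g - (- int g) \<in> J k" by (rule assms(2)[OF Suc neg[OF k(1)]])
      then show ?case by (simp add: algebra_simps)
    qed (use assms(1) in simp)
    show ?thesis using nat[of "nat c"] neg[OF nat[of "nat (- c)"]] by (cases "c \<ge> 0") auto
  qed
  have "J m \<subseteq> J k" if m: "m \<ge> k" for m
  proof
    fix x assume x: "x \<in> J m"
    have "x - (x div int g) * int g \<in> J m" using assms(2)[OF x] mult mono[OF m] by blast
    then have r: "x mod int g \<in> J m" by (simp add: minus_div_mult_eq_mod)
    have "x mod int g = 0"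
    proof (rule ccontr)
      assume "x mod int g \<noteq> 0"
      moreover have pos: "x mod int g \<ge> 0" using k(2) by simp
      ultimately have "x mod int g > 0" by linarith
      then have "P (nat (x mod int g))" unfolding P_def using r by auto
      then have "g \<le> nat (x mod int g)" unfolding g_def by (rule Least_le)
      then have "int g \<le> x mod int g" using pos by (simp add: le_nat_iff)
      moreover have "x mod int g < int g" using k(2) by simp
      ultimately show False by linarith
    qed
    then have "x = (x div int g) * int g" by (metis add.right_neutral div_mult_mod_eq)
    then show "x \<in> J k" using mult by metis
  qed
  then show ?thesis using mono by blast
qed

context comm_group
begin

lemma generate_insert_decompose:
  assumes a: "a \<in> carrier G" and A: "A \<subseteq> carrier G" and x: "x \<in> generate G (insert a A)"
  shows "\<exists>z :: int. \<exists>h \<in> generate G A. x = a [^] z \<otimes> h"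
  using x
proof (induction rule: generate.induct)
  case one
  show ?case by (rule exI[of _ 0], rule bexI[of _ \<one>]) (simp_all add: generate.one)
next
  case (incl h)
  show ?case
  proof (cases "h = a")
    case True show ?thesis by (rule exI[of _ 1], rule bexI[of _ \<one>]) (simp_all add: generate.one True a)
  next
    case False
    then have "h \<in> A" using incl by simp
    then show ?thesis using A by (intro exI[of _ 0] bexI[of _ h]) (auto intro: generate.incl)
  qed
next
  case (inv h)
  show ?case
  proof (cases "h = a")
    case True
    show ?thesis by (rule exI[of _ "-1"], rule bexI[of _ \<one>]) (simp_all add: generate.one True a int_pow_neg)
  next
    case False
    then have "h \<in> A" using inv by simp
    then show ?thesis using A by (intro exI[of _ 0] bexI[of _ "inv h"]) (auto intro: generate.inv)
  qed
next
  case (eng h1 h2)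
  then obtain z1 h1' z2 h2' where e: "h1 = a [^] (z1::int) \<otimes> h1'" "h2 = a [^] (z2::int) \<otimes> h2'"
    "h1' \<in> generate G A" "h2' \<in> generate G A" by blast
  have c: "h1' \<in> carrier G" "h2' \<in> carrier G" using e generate_in_carrier[OF A] by blast+
  have "h1 \<otimes> h2 = a [^] (z1 + z2) \<otimes> (h1' \<otimes> h2')"
    using a c unfolding e(1,2) by (simp add: int_pow_mult m_ac)
  then show ?case using generate.eng[OF e(3,4)] by blast
qed

text \<open>Finitely generated abelian groups are Noetherian. Induction on the number of generators: two nested
subgroups coincide if they have the same intersection with the group generated by \<open>A\<close> and the same exponents of
\<open>a\<close>.\<close>

lemma finitely_generated_chain:
  assumes "finite A" "A \<subseteq> carrier G" "\<And>m. subgroup (N m) G" "\<And>m. N m \<subseteq> N (Suc m)" "\<And>m. N m \<subseteq> generate G A"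
  shows "\<exists>k. \<forall>m \<ge> k. N m = N (k::nat)"
  using assms
proof (induction A arbitrary: N rule: finite_induct)
  case empty
  have "N m = {\<one>}" for m using empty(4)[of m] subgroup.one_closed[OF empty(2)[of m]] generate_empty by auto
  then show ?case by simp
next
  case (insert a A)
  have a: "a \<in> carrier G" and A: "A \<subseteq> carrier G" using insert.prems(1) by simp_all
  note sub = insert.prems(2) and asc = insert.prems(3) and le = insert.prems(4)
  have mono: "N m \<subseteq> N m'" if "m \<le> m'" for m m' using that asc by (rule lift_Suc_mono_le[rotated])
  have H: "subgroup (generate G A) G" by (rule generate_is_subgroup[OF A])
  have cH: "h \<in> carrier G" if "h \<in> generate G A" for h using generate_in_carrier[OF A that] .
  obtain k1 where k1: "\<forall>m \<ge> k1. N m \<inter> generate G A = N k1 \<inter> generate G A"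
    using insert.IH[OF A, of "\<lambda>m. N m \<inter> generate G A"] subgroups_Inter_pair[OF sub H] asc by blast
  define J where "J m = {z :: int. \<exists>h \<in> generate G A. a [^] z \<otimes> h \<in> N m}" for m
  have "\<exists>k. \<forall>m \<ge> k. J m = J k"
  proof (rule int_subgroup_chain)
    show "0 \<in> J m" for m
      unfolding J_def using generate.one subgroup.one_closed[OF sub] by (auto intro!: bexI[of _ \<one>])
    show "J m \<subseteq> J (Suc m)" for m unfolding J_def using asc by blast
    show "x - y \<in> J m" if xy: "x \<in> J m" "y \<in> J m" for m x y
    proof -
      obtain h where h: "h \<in> generate G A" "a [^] x \<otimes> h \<in> N m" using xy unfolding J_def by blast
      obtain k where k: "k \<in> generate G A" "a [^] y \<otimes> k \<in> N m" using xy unfolding J_def by blast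
      have "a [^] x \<otimes> h \<otimes> inv (a [^] y \<otimes> k) \<in> N m"
        using h k subgroup.m_closed[OF sub] subgroup.m_inv_closed[OF sub] by blast
      also have "a [^] x \<otimes> h \<otimes> inv (a [^] y \<otimes> k) = a [^] (x - y) \<otimes> (h \<otimes> inv k)"
        using a cH[OF h(1)] cH[OF k(1)] by (simp add: inv_mult int_pow_diff m_ac)
      finally show ?thesis unfolding J_def
        using h(1) k(1) subgroup.m_closed[OF H] subgroup.m_inv_closed[OF H] by blast
    qed
  qed
  then obtain k2 where k2: "\<forall>m \<ge> k2. J m = J k2" by blast
  define k where "k = max k1 k2"
  have "N m \<subseteq> N k" if m: "m \<ge> k" for m
  proof
    fix x assume x: "x \<in> N m"
    then obtain z h where z: "h \<in> generate G A" "x = a [^] (z::int) \<otimes> h"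
      using generate_insert_decompose[OF a A] le by blast
    then have "z \<in> J m" using x unfolding J_def by blast
    then have "z \<in> J k" using k2 m unfolding k_def by (metis max.cobounded2 order_trans)
    then obtain h' where h': "h' \<in> generate G A" "a [^] z \<otimes> h' \<in> N k" unfolding J_def by blast
    have c: "x \<in> carrier G" "a [^] z \<otimes> h' \<in> carrier G" using x h'(2) subgroup.mem_carrier[OF sub] by blast+
    have "x \<otimes> inv (a [^] z \<otimes> h') \<in> N m"
      using x h'(2) mono[OF m] subgroup.m_closed[OF sub] subgroup.m_inv_closed[OF sub] by blast
    moreover have "x \<otimes> inv (a [^] z \<otimes> h') = h \<otimes> inv h'"
    proof -
      have "x \<otimes> inv (a [^] z \<otimes> h') = (a [^] z \<otimes> inv (a [^] z)) \<otimes> (h \<otimes> inv h')"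
        using a cH[OF z(1)] cH[OF h'(1)] unfolding z(2) by (simp add: inv_mult m_ac del: r_inv)
      then show ?thesis using a cH[OF z(1)] cH[OF h'(1)] by simp
    qed
    moreover have "h \<otimes> inv h' \<in> generate G A"
      using z(1) h'(1) subgroup.m_closed[OF H] subgroup.m_inv_closed[OF H] by blast
    ultimately have "x \<otimes> inv (a [^] z \<otimes> h') \<in> N m \<inter> generate G A" by simp
    also have "N m \<inter> generate G A = N k \<inter> generate G A" using k1 m unfolding k_def by (metis max.cobounded1 order_trans)
    finally have "x \<otimes> inv (a [^] z \<otimes> h') \<otimes> (a [^] z \<otimes> h') \<in> N k"
      using h'(2) subgroup.m_closed[OF sub] by blast
    then show "x \<in> N k" using c by (simp add: m_assoc)
  qed
  then show ?case using mono by blast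
qed

text \<open>The kernels of the powers of \<open>L\<close> on a finitely generated subgroup form an ascending chain; where it is constant,
\<open>L\<close> is injective on the images.\<close>

lemma endomorphism_eventually_iso:
  assumes fin: "finite A" "A \<subseteq> carrier G" and L: "L \<in> hom G G"
  shows "\<exists>k. \<forall>m \<ge> k. L \<in> iso (G\<lparr>carrier := (L ^^ m) ` generate G A\<rparr>) (G\<lparr>carrier := (L ^^ Suc m) ` generate G A\<rparr>)"
proof -
  have H: "subgroup (generate G A) G" by (rule generate_is_subgroup[OF fin(2)])
  have Lm: "(L ^^ m) \<in> hom G G" for m
  proof (induction m)
    case 0 show ?case by (simp add: hom_def)
  next
    case (Suc m)
    show ?case
      by (rule homI) (simp_all add: hom_in_carrier[OF Suc] hom_in_carrier[OF L] hom_mult[OF Suc] hom_mult[OF L])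
  qed
  have gh: "group_hom G G (L ^^ m)" for m using Lm is_group by (simp add: group_hom_def group_hom_axioms_def)
  define N where "N m = kernel G G (L ^^ m) \<inter> generate G A" for m
  have mem: "x \<in> N m \<longleftrightarrow> x \<in> generate G A \<and> (L ^^ m) x = \<one>" for x m
    unfolding N_def kernel_def using subgroup.mem_carrier[OF H] by auto
  have "\<exists>k. \<forall>m \<ge> k. N m = N k"
  proof (rule finitely_generated_chain[OF fin])
    show "subgroup (N m) G" for m
      unfolding N_def by (rule subgroups_Inter_pair[OF group_hom.subgroup_kernel[OF gh] H])
    show "N m \<subseteq> generate G A" for m unfolding N_def by blast
    show "N m \<subseteq> N (Suc m)" for m using hom_one[OF L is_group is_group] by (auto simp: mem)
  qed
  then obtain k where k: "\<forall>m \<ge> k. N m = N k" by blast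
  have "L \<in> iso (G\<lparr>carrier := (L ^^ m) ` generate G A\<rparr>) (G\<lparr>carrier := (L ^^ Suc m) ` generate G A\<rparr>)" if m: "m \<ge> k" for m
  proof -
    have sub: "(L ^^ m) ` generate G A \<subseteq> carrier G" for m
      using subgroup.subset[OF H] hom_carrier[OF Lm[of m]] by blast
    have im: "L ` ((L ^^ m) ` generate G A) = (L ^^ Suc m) ` generate G A" by (simp add: image_image)
    have inj: "inj_on L ((L ^^ m) ` generate G A)"
    proof (rule inj_onI)
      fix x y assume "x \<in> (L ^^ m) ` generate G A" "y \<in> (L ^^ m) ` generate G A" and e: "L x = L y"
      then obtain a b where a: "a \<in> generate G A" "x = (L ^^ m) a" and b: "b \<in> generate G A" "y = (L ^^ m) b" by blast
      have c: "a \<in> carrier G" "b \<in> carrier G" using a b subgroup.mem_carrier[OF H] by blast+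
      have eq: "(L ^^ l) (a \<otimes> inv b) = (L ^^ l) a \<otimes> inv ((L ^^ l) b)" for l
        using c group_hom.hom_inv[OF gh] hom_mult[OF Lm] by simp
      have cc: "(L ^^ l) a \<in> carrier G" "(L ^^ l) b \<in> carrier G" for l using c hom_in_carrier[OF Lm] by blast+
      have "(L ^^ Suc m) (a \<otimes> inv b) = \<one>" unfolding eq using e a b cc[of "Suc m"] by simp
      then have "a \<otimes> inv b \<in> N (Suc m)"
        using a(1) b(1) subgroup.m_closed[OF H] subgroup.m_inv_closed[OF H] by (simp add: mem)
      also have "N (Suc m) = N m" using k m by (metis le_SucI)
      finally have "(L ^^ m) a \<otimes> inv ((L ^^ m) b) = \<one>" unfolding eq[symmetric] by (simp add: mem)
      then have "(L ^^ m) a = (L ^^ m) b" using cc by (metis inv_closed inv_equality inv_inv)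
      then show "x = y" using a b by simp
    qed
    have "L \<in> hom (G\<lparr>carrier := (L ^^ m) ` generate G A\<rparr>) (G\<lparr>carrier := (L ^^ Suc m) ` generate G A\<rparr>)"
      using im by (intro homI) (auto simp: hom_mult[OF L] hom_in_carrier[OF Lm] subgroup.mem_carrier[OF H])
    then show ?thesis using im inj by (simp add: iso_def bij_betw_def)
  qed
  then show ?thesis by blast
qed

end

section \<open>Stable isomorphism and equality in the Grothendieck group\<close>

locale fitting_IT_context = exact_IT_context C E for C :: "('o, 'm) precategory" (structure) and E +
  assumes fitting: "fitting_property C"

context fitting_IT_context
begin

abbreviation FG :: "('o set \<Rightarrow>\<^sub>0 int) monoid" where "FG \<equiv> free_Abelian_group (isoclass C ` Obj C)"
abbreviation KG :: "('o set \<Rightarrow>\<^sub>0 int) set monoid" where "KG \<equiv> K_group C E"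
abbreviation kc :: "'o \<Rightarrow> ('o set \<Rightarrow>\<^sub>0 int) set" where "kc \<equiv> K_class C E"
abbreviation fr :: "'o \<Rightarrow> ('o set \<Rightarrow>\<^sub>0 int)" where "fr X \<equiv> frag_of (isoclass C X)"

lemma isoclass_eq_iff:
  assumes "X \<in> Obj C" "Y \<in> Obj C" shows "isoclass C X = isoclass C Y \<longleftrightarrow> isomorphic C X Y"
proof
  assume "isoclass C X = isoclass C Y"
  moreover have "Y \<in> isoclass C Y" using assms isomorphic_refl by (simp add: isoclass_def)
  ultimately have "Y \<in> isoclass C X" by (simp only:)
  then show "isomorphic C X Y" by (simp add: isoclass_def)
next
  assume i: "isomorphic C X Y"
  then have i': "isomorphic C Y X" using isomorphic_sym assms by blast
  show "isoclass C X = isoclass C Y"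
    unfolding isoclass_def using isomorphic_trans[OF i] isomorphic_trans[OF i'] assms by blast
qed

lemma fr_carrier [simp]: "X \<in> Obj C \<Longrightarrow> fr X \<in> carrier FG"
  by simp

lemma K_relations_carrier: "K_relations C E \<subseteq> carrier FG"
proof -
  interpret group FG by simp
  have m: "x - y \<in> carrier FG" if "x \<in> carrier FG" "y \<in> carrier FG" for x y :: "'o set \<Rightarrow>\<^sub>0 int"
    using that keys_diff[of x y] by auto
  show ?thesis unfolding K_relations_def
    using direct_sum_Obj projective_Obj by (fastforce intro!: m fr_carrier simp del: carrier_free_Abelian_group_iff)
qed

lemma K_subgroup_subgroup: "subgroup (K_subgroup C E) FG"
  unfolding K_subgroup_def by (rule group.generate_is_subgroup[OF group_free_Abelian_group K_relations_carrier])

lemma K_subgroup_normal: "K_subgroup C E \<lhd> FG"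
  by (rule comm_group.subgroup_imp_normal[OF abelian_free_Abelian_group K_subgroup_subgroup])

lemma KG_comm_group: "comm_group KG"
  unfolding K_group_def by (rule comm_group.abelian_FactGroup[OF abelian_free_Abelian_group K_subgroup_subgroup])

lemma coset_eq_iff:
  assumes x: "x \<in> carrier FG" and y: "y \<in> carrier FG"
  shows "K_subgroup C E #>\<^bsub>FG\<^esub> x = K_subgroup C E #>\<^bsub>FG\<^esub> y \<longleftrightarrow> x - y \<in> K_subgroup C E"
proof -
  interpret F: comm_group FG by (rule abelian_free_Abelian_group)
  have mem: "u \<in> K_subgroup C E #>\<^bsub>FG\<^esub> v \<longleftrightarrow> u - v \<in> K_subgroup C E" for u v
  proof -
    have "u \<in> K_subgroup C E #>\<^bsub>FG\<^esub> v \<longleftrightarrow> (\<exists>h \<in> K_subgroup C E. u = h + v)" by (auto simp: r_coset_def)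
    also have "\<dots> \<longleftrightarrow> u - v \<in> K_subgroup C E"
      by (metis add_diff_cancel_right' diff_add_cancel)
    finally show ?thesis .
  qed
  show ?thesis
  proof
    assume "K_subgroup C E #>\<^bsub>FG\<^esub> x = K_subgroup C E #>\<^bsub>FG\<^esub> y"
    moreover have "x \<in> K_subgroup C E #>\<^bsub>FG\<^esub> x"
      using subgroup.one_closed[OF K_subgroup_subgroup] by (simp add: mem)
    ultimately show "x - y \<in> K_subgroup C E" by (simp add: mem)
  next
    assume "x - y \<in> K_subgroup C E"
    then have "x \<in> K_subgroup C E #>\<^bsub>FG\<^esub> y" by (simp add: mem)
    then show "K_subgroup C E #>\<^bsub>FG\<^esub> x = K_subgroup C E #>\<^bsub>FG\<^esub> y"
      using F.repr_independence[OF _ y K_subgroup_subgroup] by simp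
  qed
qed

lemma kc_carrier [simp]: "X \<in> Obj C \<Longrightarrow> kc X \<in> carrier KG"
  unfolding K_class_def K_group_def carrier_FactGroup by (rule imageI) simp

lemma kc_direct_sum:
  assumes d: "direct_sum C S [X, Y]" shows "kc S = kc X \<otimes>\<^bsub>KG\<^esub> kc Y"
proof -
  have o: "S \<in> Obj C" "X \<in> Obj C" "Y \<in> Obj C" using direct_sum_Obj[OF d] by simp_all
  have "kc X \<otimes>\<^bsub>KG\<^esub> kc Y = K_subgroup C E #>\<^bsub>FG\<^esub> (fr X + fr Y)"
    unfolding K_class_def K_group_def mult_FactGroup
    using normal.rcos_sum[OF K_subgroup_normal fr_carrier[OF o(2)] fr_carrier[OF o(3)]] by simp
  also have "\<dots> = kc S" unfolding K_class_def
  proof (rule coset_eq_iff[THEN iffD2, symmetric])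
    show "fr X + fr Y \<in> carrier FG"
      using monoid.m_closed[of FG "fr X" "fr Y"] fr_carrier o group_free_Abelian_group
      by (metis group.is_monoid mult_free_Abelian_group)
    have "fr S - fr X - fr Y \<in> K_relations C E" unfolding K_relations_def using d by blast
    then have "fr S - fr X - fr Y \<in> K_subgroup C E" unfolding K_subgroup_def by (rule generate.incl)
    then show "fr S - (fr X + fr Y) \<in> K_subgroup C E" by (simp add: diff_diff_add)
  qed (use o in simp)
  finally show ?thesis by simp
qed

lemma kc_projective: assumes P: "P \<in> projectives C E" shows "kc P = \<one>\<^bsub>KG\<^esub>"
proof -
  have "fr P \<in> K_relations C E" unfolding K_relations_def using P by blast
  then have "fr P \<in> K_subgroup C E" unfolding K_subgroup_def by (rule generate.incl)
  then have "K_subgroup C E #>\<^bsub>FG\<^esub> fr P = K_subgroup C E"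
    using subgroup.rcos_const[OF K_subgroup_subgroup group_free_Abelian_group] by blast
  then show ?thesis unfolding K_class_def K_group_def by simp
qed

text \<open>\<open>X\<close> is a summand of \<open>Y \<oplus> Q\<close> with \<open>Q\<close> projective, and the complement is stably zero, hence projective.\<close>

lemma stably_isomorphic_kc:
  assumes o: "X \<in> Obj C" "Y \<in> Obj C" and i: "isomorphic St X Y" shows "kc X = kc Y"
proof -
  obtain Q W i1 p1 i2 p2 \<tau> \<kappa> where Q: "Q \<in> projectives C E" and bp: "biprod2 C W Y Q i1 p1 i2 p2"
    and tk: "\<tau> \<in> W \<leadsto> X" "\<kappa> \<in> X \<leadsto> W" "\<tau> \<cdot> \<kappa> = Idn C X" and kt: "cls (\<kappa> \<cdot> \<tau>) = Idn St W"
    using stable_iso_split[OF o i] .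
  obtain R j q where b: "biprod2 C W X R \<kappa> \<tau> j q" using retract_complement[OF fitting tk(2,1,3)] .
  note B = biprod2D[OF b]
  note [simp] = B(10-)
  have "cls (\<kappa> \<cdot> \<tau>) \<boxplus>\<^bsub>St\<^esub> cls (j \<cdot> q) = Idn St W" using arg_cong[OF B(9), of cls] by (simp add: cls_addm cls_Idn)
  then have "Idn St W \<boxplus>\<^bsub>St\<^esub> cls (j \<cdot> q) = Idn St W \<boxplus>\<^bsub>St\<^esub> zmor St W W" unfolding kt by simp
  then have jq: "cls (j \<cdot> q) = zmor St W W" by (subst (asm) st.addm_cancel_left) simp_all
  have "Idn C R = q \<cdot> (j \<cdot> q) \<cdot> j" by (simp add: ringoid_simps B Cmp_reassoc[OF B(6)])
  then have "Idn St R = cls q \<cdot>\<^bsub>St\<^esub> cls (j \<cdot> q) \<cdot>\<^bsub>St\<^esub> cls j" by (simp add: cls_Cmp flip: cls_Idn)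
  then have "Idn St R = zmor St R R" unfolding jq by simp
  then have R: "R \<in> projectives C E" by (simp add: st.zero_object_iff flip: projective_iff_zero)
  interpret K: comm_group KG by (rule KG_comm_group)
  have d: "direct_sum C W [Y, Q]" "direct_sum C W [X, R]" unfolding direct_sum_two using bp b by blast+
  have "kc W = kc Y" using kc_direct_sum[OF d(1)] kc_projective[OF Q] o by simp
  moreover have "kc W = kc X" using kc_direct_sum[OF d(2)] kc_projective[OF R] o by simp
  ultimately show ?thesis by simp
qed

abbreviation frs :: "'o list \<Rightarrow> ('o set \<Rightarrow>\<^sub>0 int)" where "frs Xs \<equiv> sum_list (map fr Xs)"

lemma lookup_frs: "Poly_Mapping.lookup (frs Xs) c = int (length (filter (\<lambda>X. isoclass C X = c) Xs))"
  by (induction Xs) (auto simp: Poly_Mapping.lookup_add lookup_single when_def)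

text \<open>A formal sum of isomorphism classes with nonnegative coefficients determines its summands up to order.\<close>

lemma list_sum_frs_isomorphic:
  "\<lbrakk>frs Us = frs Vs; list_sum C U Us; list_sum C V Vs\<rbrakk> \<Longrightarrow> isomorphic C U V"
proof (induction Us arbitrary: U V Vs)
  case Nil
  have "Vs = []"
  proof (cases Vs)
    case (Cons v vs)
    have "Poly_Mapping.lookup (frs Vs) (isoclass C v) = 0" unfolding Nil(1)[symmetric] by simp
    then show ?thesis unfolding lookup_frs Cons by simp
  qed simp
  then show ?case using Nil zero_objects_isomorphic by simp
next
  case (Cons u us)
  have "Poly_Mapping.lookup (frs Vs) (isoclass C u) > 0"
    unfolding Cons.prems(1)[symmetric] lookup_frs by simp
  then have "filter (\<lambda>X. isoclass C X = isoclass C u) Vs \<noteq> []" unfolding lookup_frs by auto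
  then obtain v where v: "v \<in> set Vs" "isoclass C v = isoclass C u" by (auto simp: filter_empty_conv)
  then obtain as bs where Vs: "Vs = as @ v # bs" by (meson split_list)
  have "list_sum C V (v # as @ bs)" using list_sum_move Cons.prems(3) unfolding Vs by blast
  then obtain V1 where V1: "direct_sum C V [v, V1]" "list_sum C V1 (as @ bs)" by auto
  obtain U1 where U1: "direct_sum C U [u, U1]" "list_sum C U1 us" using Cons.prems(2) by auto
  have "frs us = frs (as @ bs)" using Cons.prems(1) v(2) unfolding Vs by (simp add: algebra_simps)
  then have "isomorphic C U1 V1" by (rule Cons.IH[OF _ U1(2) V1(2)])
  moreover have "isomorphic C u v" using v(2) isoclass_eq_iff direct_sum_Obj[OF V1(1)] direct_sum_Obj[OF U1(1)] by metis
  ultimately show ?case using direct_sum_isos[OF U1(1) V1(1)] by blast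
qed

lemma list_sum_single: "X \<in> Obj C \<Longrightarrow> list_sum C X [X]"
proof -
  assume X: "X \<in> Obj C"
  obtain Z where Z: "zero_object C Z" using ex_zero_object by blast
  then obtain S where S: "direct_sum C S [X, Z]" using ex_direct_sum X zero_objectD(1) by blast
  have "isomorphic C S X" by (rule direct_sum_zero_iso[OF S Z])
  then have "direct_sum C X [X, Z]" using direct_sum_iso[OF S] X by blast
  then show ?thesis using Z by auto
qed

text \<open>The property shared by all elements of the subgroup of relations from which stable isomorphism is recovered.\<close>

definition balanced :: "('o set \<Rightarrow>\<^sub>0 int) \<Rightarrow> bool" where
  "balanced z \<longleftrightarrow> (\<exists>Xs Ys S T. list_sum C S Xs \<and> list_sum C T Ys \<and> isomorphic St S T \<and> z = frs Xs - frs Ys)"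

lemma balanced_neg: "balanced z \<Longrightarrow> balanced (- z)"
proof -
  assume "balanced z"
  then obtain Xs Ys S T where a: "list_sum C S Xs" "list_sum C T Ys" "isomorphic St S T" "z = frs Xs - frs Ys"
    unfolding balanced_def by blast
  have "isomorphic St T S" using stable_iso_sym a(3) list_sum_Obj[OF a(1)] list_sum_Obj[OF a(2)] by blast
  moreover have "- z = frs Ys - frs Xs" using a(4) by simp
  ultimately show ?thesis unfolding balanced_def using a(1,2) by blast
qed

lemma balanced_add: "balanced z \<Longrightarrow> balanced z' \<Longrightarrow> balanced (z + z')"
proof -
  assume "balanced z" "balanced z'"
  then obtain Xs Ys S T Xs' Ys' S' T' where a: "list_sum C S Xs" "list_sum C T Ys" "isomorphic St S T" "z = frs Xs - frs Ys"
    and b: "list_sum C S' Xs'" "list_sum C T' Ys'" "isomorphic St S' T'" "z' = frs Xs' - frs Ys'"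
    unfolding balanced_def by blast
  obtain W where W: "direct_sum C W [S, S']" using ex_direct_sum list_sum_Obj[OF a(1)] list_sum_Obj[OF b(1)] by blast
  obtain W' where W': "direct_sum C W' [T, T']" using ex_direct_sum list_sum_Obj[OF a(2)] list_sum_Obj[OF b(2)] by blast
  have "isomorphic St W W'" by (rule st.direct_sum_isos[OF direct_sum_St[OF W] direct_sum_St[OF W'] a(3) b(3)])
  moreover have "list_sum C W (Xs @ Xs')" "list_sum C W' (Ys @ Ys')"
    by (rule list_sum_append[OF a(1) b(1) W], rule list_sum_append[OF a(2) b(2) W'])
  moreover have "z + z' = frs (Xs @ Xs') - frs (Ys @ Ys')" unfolding a(4) b(4) by simp
  ultimately show ?thesis unfolding balanced_def by blast
qed

lemma balanced_relation: assumes "z \<in> K_relations C E" shows "balanced z"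
proof -
  consider N S T where "direct_sum C N [S, T]" "z = fr N - fr S - fr T" | P where "P \<in> projectives C E" "z = fr P"
    using assms unfolding K_relations_def by blast
  then show ?thesis
  proof cases
    case 1
    note o = direct_sum_Obj[OF 1(1)]
    have "list_sum C N [N]" "list_sum C N [S, T]" using list_sum_single o 1(1) by auto
    moreover have "isomorphic St N N" using st.isomorphic_refl o by simp
    moreover have "z = frs [N] - frs [S, T]" using 1(2) by simp
    ultimately show ?thesis unfolding balanced_def by blast
  next
    case 2
    obtain Z where Z: "zero_object C Z" using ex_zero_object by blast
    have "zero_object St P" "zero_object St Z" using 2(1) zero_object_projective[OF Z] projective_iff_zero by blast+
    then have "isomorphic St P Z" by (rule st.zero_objects_isomorphic)
    moreover have "list_sum C P [P]" using list_sum_single[OF projective_Obj[OF 2(1)]] .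
    moreover have "list_sum C Z []" using Z by simp
    moreover have "z = frs [P] - frs []" using 2(2) by simp
    ultimately show ?thesis unfolding balanced_def by blast
  qed
qed

lemma K_subgroup_balanced: "z \<in> K_subgroup C E \<Longrightarrow> balanced z"
  unfolding K_subgroup_def
proof (induction rule: generate.induct)
  case one
  obtain Z where Z: "zero_object C Z" using ex_zero_object by blast
  have "isomorphic St Z Z" using st.isomorphic_refl zero_objectD(1)[OF Z] by simp
  then show ?case unfolding balanced_def using Z by (intro exI[of _ "[]"] exI[of _ Z]) simp
next
  case (incl h) then show ?case by (rule balanced_relation)
next
  case (inv h)
  have "h \<in> carrier FG" using inv K_relations_carrier by blast
  then have "inv\<^bsub>FG\<^esub> h = - h" by simp
  then show ?case using balanced_neg[OF balanced_relation[OF inv]] by simp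
next
  case (eng h1 h2) then show ?case using balanced_add by simp
qed

lemma list_sum_St: "list_sum C S Xs \<Longrightarrow> list_sum St S Xs"
proof (induction Xs arbitrary: S)
  case Nil then show ?case using zero_object_projective projective_iff_zero by simp
next
  case (Cons X Xs)
  then obtain T where "direct_sum C S [X, T]" "list_sum C T Xs" by auto
  then have "direct_sum St S [X, T]" "list_sum St T Xs" using Cons.IH direct_sum_St by blast+
  then show ?case by auto
qed

text \<open>If \<open>[X] = [Y]\<close>, then \<open>[X] - [Y]\<close> is a combination of relations, hence balanced: \<open>X \<oplus> T\<close> and \<open>Y \<oplus> S\<close> are
isomorphic for some stably isomorphic \<open>S\<close> and \<open>T\<close>. As \<open>T\<close> is a sum of objects with local endomorphism rings, it
cancels.\<close>

lemma kc_stably_isomorphic: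
  assumes o: "X \<in> Obj C" "Y \<in> Obj C" and e: "kc X = kc Y" shows "isomorphic St X Y"
proof -
  have "fr X - fr Y \<in> K_subgroup C E" using e coset_eq_iff[of "fr X" "fr Y"] o unfolding K_class_def by simp
  then obtain Xs Ys S T where a: "list_sum C S Xs" "list_sum C T Ys" "isomorphic St S T" "fr X - fr Y = frs Xs - frs Ys"
    using K_subgroup_balanced unfolding balanced_def by blast
  have oS: "S \<in> Obj C" "T \<in> Obj C" using list_sum_Obj[OF a(1)] list_sum_Obj[OF a(2)] by simp_all
  obtain U where U: "direct_sum C U [X, T]" using ex_direct_sum o oS by blast
  obtain V where V: "direct_sum C V [Y, S]" using ex_direct_sum o oS by blast
  have "isomorphic C V U"
  proof (rule list_sum_frs_isomorphic)
    show "frs (Y # Xs) = frs (X # Ys)" using a(4) by (simp add: algebra_simps)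
    show "list_sum C V (Y # Xs)" "list_sum C U (X # Ys)" using U V a(1,2) by auto
  qed
  then have "direct_sum C U [Y, S]" using direct_sum_iso[OF V] direct_sum_Obj[OF U] by blast
  then have "direct_sum St U [Y, S]" by (rule direct_sum_St)
  then have "direct_sum St U [Y, T]"
    by (rule st.direct_sum_change[OF _ st.isomorphic_refl a(3)]) (use o oS in simp_all)
  then have 1: "direct_sum St U [T, Y]" by (rule st.direct_sum_sym)
  have 2: "direct_sum St U [T, X]" by (rule st.direct_sum_sym[OF direct_sum_St[OF U]])
  obtain Ls where Ls: "list_sum C T Ls" "\<forall>L \<in> set Ls. local_object C L"
    using krull_schmidt_list_sum[OF fitting krull_schmidt oS(2)] .
  have "\<forall>L \<in> set Ls. stable_range_one St L"
    using Ls(2) local_object_stable_range_one stable_range_one_St by blast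
  then show ?thesis by (rule st.list_sum_cancel[OF list_sum_St[OF Ls(1)] _ 2 1])
qed

end

section \<open>The syzygy endomorphism and the subgroup generated by the summands of an object\<close>

context fitting_IT_context
begin

lemma kc_syzygy_iso:
  assumes "X \<in> Obj C" "Y \<in> Obj C" "isomorphic St X Y" shows "kc (syzygy C E X) = kc (syzygy C E Y)"
  by (rule stably_isomorphic_kc) (use assms syzygy_iso[OF syzygy_is_syzygy syzygy_is_syzygy] in simp_all)

lemma kc_St_direct_sum:
  assumes d: "direct_sum St S [X, Y]" shows "kc S = kc X \<otimes>\<^bsub>KG\<^esub> kc Y"
proof -
  have o: "S \<in> Obj C" "X \<in> Obj C" "Y \<in> Obj C" using st.direct_sum_Obj[OF d] by simp_all
  obtain W where W: "direct_sum C W [X, Y]" using ex_direct_sum o by blast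
  have i: "isomorphic St S W"
    by (rule st.direct_sum_isos[OF d direct_sum_St[OF W]]) (use o st.isomorphic_refl in simp_all)
  have "kc S = kc W" by (rule stably_isomorphic_kc[OF o(1) _ i]) (use direct_sum_Obj[OF W] in simp)
  then show ?thesis using kc_direct_sum[OF W] by simp
qed

text \<open>The operator is defined by a choice, so existence has to be shown: on the free group it is prescribed on classes, and it
respects the relations because \<open>\<Omega>\<close> is additive and preserves projectives.\<close>

lemma K_syzygy_hom: "K_syzygy C E \<in> hom KG KG \<and> (\<forall>M \<in> Obj C. K_syzygy C E (kc M) = kc (syzygy C E M))"
proof -
  interpret K: comm_group KG by (rule KG_comm_group)
  define f where "f c = kc (syzygy C E (SOME M. M \<in> Obj C \<and> isoclass C M = c))" for c
  have rep: "(SOME M'. M' \<in> Obj C \<and> isoclass C M' = isoclass C M) \<in> Obj C \<and>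
    isoclass C (SOME M'. M' \<in> Obj C \<and> isoclass C M' = isoclass C M) = isoclass C M" if "M \<in> Obj C" for M
    by (rule someI[of _ M]) (use that in simp)
  have f: "f (isoclass C M) = kc (syzygy C E M)" if M: "M \<in> Obj C" for M
    unfolding f_def using rep[OF M] M isoclass_eq_iff isomorphic_St by (intro kc_syzygy_iso) blast+
  have "f ` (isoclass C ` Obj C) \<subseteq> carrier KG" using f by auto
  then obtain h where h: "h \<in> hom FG KG" "\<And>c. c \<in> isoclass C ` Obj C \<Longrightarrow> h (frag_of c) = f c"
    by (rule K.free_Abelian_group_universal) blast
  have hfr: "h (fr M) = kc (syzygy C E M)" if "M \<in> Obj C" for M using h(2) f that by simp
  interpret h: group_hom FG KG h using h(1) by (simp add: group_hom_def group_hom_axioms_def K.is_group)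
  have "K_relations C E \<subseteq> kernel FG KG h"
  proof
    fix z assume z: "z \<in> K_relations C E"
    then have zc: "z \<in> carrier FG" using K_relations_carrier by blast
    consider N S T where "direct_sum C N [S, T]" "z = fr N - fr S - fr T" | P where "P \<in> projectives C E" "z = fr P"
      using z unfolding K_relations_def by blast
    then have "h z = \<one>\<^bsub>KG\<^esub>"
    proof cases
      case 1
      have o: "N \<in> Obj C" "S \<in> Obj C" "T \<in> Obj C" using direct_sum_Obj[OF 1(1)] by simp_all
      have "fr N = z \<otimes>\<^bsub>FG\<^esub> (fr S \<otimes>\<^bsub>FG\<^esub> fr T)" unfolding 1(2) by simp
      then have "h (fr N) = h z \<otimes>\<^bsub>KG\<^esub> (h (fr S) \<otimes>\<^bsub>KG\<^esub> h (fr T))"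
        using zc o by (simp only: h.hom_mult h.G.m_closed fr_carrier)
      moreover have "h (fr N) = h (fr S) \<otimes>\<^bsub>KG\<^esub> h (fr T)"
        unfolding hfr[OF o(1)] hfr[OF o(2)] hfr[OF o(3)]
        by (rule kc_St_direct_sum[OF syzygy_direct_sum[OF syzygy_is_syzygy syzygy_is_syzygy syzygy_is_syzygy direct_sum_St]])
          (use o 1(1) in simp_all)
      moreover have "h z \<in> carrier KG" "h (fr S) \<in> carrier KG" "h (fr T) \<in> carrier KG"
        using zc o h.hom_closed fr_carrier by blast+
      ultimately show ?thesis by (metis K.m_closed K.r_cancel_one')
    next
      case 2
      have "syzygy C E P \<in> projectives C E"
        by (rule syzygy_projective[OF syzygy_is_syzygy 2(1)]) (rule projective_Obj[OF 2(1)])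
      then show ?thesis using hfr[OF projective_Obj[OF 2(1)]] kc_projective 2(2) by simp
    qed
    then show "z \<in> kernel FG KG h" using zc by (simp add: kernel_def)
  qed
  then have ker: "K_subgroup C E \<subseteq> kernel FG KG h"
    unfolding K_subgroup_def by (rule h.G.generate_subgroup_incl[OF _ h.subgroup_kernel])
  obtain g where g: "g \<in> hom (FG Mod K_subgroup C E) KG"
    "\<And>x. x \<in> carrier FG \<Longrightarrow> g (K_subgroup C E #>\<^bsub>FG\<^esub> x) = h x"
  proof (rule FactGroup_universal[OF h(1) K_subgroup_normal])
    fix x y assume x: "x \<in> carrier FG" and y: "y \<in> carrier FG"
      and "K_subgroup C E #>\<^bsub>FG\<^esub> x = K_subgroup C E #>\<^bsub>FG\<^esub> y"
    then have d: "x - y \<in> kernel FG KG h" using coset_eq_iff ker by blast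
    then have "h ((x - y) \<otimes>\<^bsub>FG\<^esub> y) = h (x - y) \<otimes>\<^bsub>KG\<^esub> h y" using y by (intro h.hom_mult) (simp_all only: kernel_def mem_Collect_eq)
    then show "h x = h y" using d y h.hom_closed[OF y] by (simp add: kernel_def)
  qed blast
  have "g \<in> hom KG KG \<and> (\<forall>M \<in> Obj C. g (kc M) = kc (syzygy C E M))"
    using g hfr fr_carrier unfolding K_group_def[symmetric] K_class_def by metis
  then show ?thesis unfolding K_syzygy_def
    by (rule someI[of "\<lambda>L. L \<in> hom KG KG \<and> (\<forall>M \<in> Obj C. L (kc M) = kc (syzygy C E M))" g])
qed

lemma K_syzygy_pow: "M \<in> Obj C \<Longrightarrow> (K_syzygy C E ^^ k) (kc M) = kc ((syzygy C E ^^ k) M)"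
  by (induction k) (simp_all add: K_syzygy_hom)

lemma proj_factors_not_automorphism:
  assumes "X \<notin> projectives C E" "proj_factors t" "t \<in> X \<leadsto> X" shows "\<not> automorphism C X t"
proof
  assume "automorphism C X t"
  then obtain g where g: "g \<in> X \<leadsto> X" "g \<cdot> t = Idn C X" using automorphismE by blast
  have "proj_factors (g \<cdot> t)" by (rule proj_factors_Cmp_left[OF assms(2)]) (use g assms(3) in simp_all)
  then have "zero_object St X" using g(1) unfolding g(2) by (simp add: st.zero_object_iff cls_zero_iff flip: cls_Idn)
  then show False using assms(1) projective_iff_zero by blast
qed

text \<open>Morphisms factoring through projectives are non-units of \<open>End(L)\<close>, so the alternative of a local ring survives
in the stable category.\<close>

lemma local_stable_sum:
  assumes L: "local_object C L" and np: "L \<notin> projectives C E" and e: "e \<in> L \<leadsto> L" "e' \<in> L \<leadsto> L"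
    and s: "cls (e \<boxplus> e') = Idn St L"
  shows "automorphism C L e \<or> automorphism C L e'"
proof (rule ccontr)
  assume "\<not> (automorphism C L e \<or> automorphism C L e')"
  then have 1: "\<not> automorphism C L (e \<boxplus> e')" using local_object_facts(3)[OF L e] by blast
  have LO: "L \<in> Obj C" using e by simp
  define t where "t = Idn C L \<boxplus> \<boxminus> (e \<boxplus> e')"
  have t: "t \<in> L \<leadsto> L" unfolding t_def using e by simp
  have "cls (Idn C L) = cls (e \<boxplus> e')" using s LO by (simp add: cls_Idn)
  then have "proj_factors t" unfolding t_def using e by (subst (asm) cls_eq_iff) simp_all
  then have 2: "\<not> automorphism C L t" using proj_factors_not_automorphism[OF np _ t] by blast
  have "t \<boxplus> (e \<boxplus> e') = Idn C L" unfolding t_def by (rule subtract_add_cancel) (use e in simp_all)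
  moreover have "\<not> automorphism C L (t \<boxplus> (e \<boxplus> e'))"
    by (rule local_object_facts(3)[OF L t _ 2 1]) (use e in simp)
  ultimately show False using local_object_facts(1)[OF L] by simp
qed

text \<open>If \<open>L\<close> is stably a sum of \<open>Y\<close> and \<open>Z\<close>, one of the two complementary idempotents is represented by an
automorphism; it is then an identity and the other one is zero.\<close>

lemma local_indecomposable:
  assumes L: "local_object C L" and np: "L \<notin> projectives C E" shows "indecomposable St L"
proof -
  have LO: "L \<in> Obj C" using L by (simp add: local_object_def)
  have key: "zero_object St Z" if b: "biprod2 St L Y Z I P J Q" and e: "e \<in> L \<leadsto> L" "I \<cdot>\<^bsub>St\<^esub> P = cls e" "automorphism C L e"
    for Y Z I P J Q e
  proof -
    note B = st.biprod2D[OF b]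
    note [simp] = B(10-)
    obtain g where g: "g \<in> L \<leadsto> L" "g \<cdot> e = Idn C L" using automorphismE[OF e(3)] by blast
    have "cls g \<cdot>\<^bsub>St\<^esub> cls e = Idn St L" using g e(1) LO by (simp flip: cls_Cmp add: cls_Idn)
    moreover have "cls e \<cdot>\<^bsub>St\<^esub> cls e = cls e" unfolding e(2)[symmetric]
      by (simp add: st.ringoid_simps st.Cmp_reassoc[OF B(5)])
    ultimately have "cls e = Idn St L"
      using st.idempotent_automorphism[OF cls_arrows[OF e(1)] cls_arrows[OF g(1)]] by blast
    then have "Idn St L \<boxplus>\<^bsub>St\<^esub> J \<cdot>\<^bsub>St\<^esub> Q = Idn St L \<boxplus>\<^bsub>St\<^esub> zmor St L L" using B(9) e(2) LO by simp
    then have JQ: "J \<cdot>\<^bsub>St\<^esub> Q = zmor St L L" using LO by (subst (asm) st.addm_cancel_left) simp_all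
    have "Idn St Z = Q \<cdot>\<^bsub>St\<^esub> (J \<cdot>\<^bsub>St\<^esub> Q) \<cdot>\<^bsub>St\<^esub> J" by (simp add: st.ringoid_simps B(6) st.Cmp_reassoc[OF B(6)])
    also have "\<dots> = zmor St Z Z" unfolding JQ using LO B(22,23) by simp
    finally show ?thesis using B(23) by (simp add: st.zero_object_iff)
  qed
  have "zero_object St Y \<or> zero_object St Z" if d: "direct_sum St L [Y, Z]" for Y Z
  proof -
    obtain I P J Q where b: "biprod2 St L Y Z I P J Q" using d unfolding st.direct_sum_two by blast
    note B = st.biprod2D[OF b]
    have "I \<cdot>\<^bsub>St\<^esub> P \<in> L \<leadsto>\<^bsub>St\<^esub> L" "J \<cdot>\<^bsub>St\<^esub> Q \<in> L \<leadsto>\<^bsub>St\<^esub> L" using B(10-) by simp_all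
    then obtain e e' where e: "e \<in> L \<leadsto> L" "I \<cdot>\<^bsub>St\<^esub> P = cls e" and e': "e' \<in> L \<leadsto> L" "J \<cdot>\<^bsub>St\<^esub> Q = cls e'"
      using st_arrowsE by metis
    have "cls (e \<boxplus> e') = Idn St L" using B(9) e e' by (simp add: cls_addm)
    then consider "automorphism C L e" | "automorphism C L e'" using local_stable_sum[OF L np e(1) e'(1)] by blast
    then show ?thesis using key[OF b e] key[OF st.biprod2_swap[OF b] e'] by cases blast+
  qed
  moreover have "\<not> zero_object St L" using np projective_iff_zero by blast
  ultimately show ?thesis unfolding indecomposable_def using LO by simp
qed

text \<open>The exchange step of the Krull--Schmidt theorem: an automorphism of \<open>L\<close> that factors through a direct sum factors,
up to automorphism, through one of the summands, and an idempotent of a local ring is \<open>0\<close> or \<open>1\<close>.\<close>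

lemma local_summand_isomorphic:
  assumes L: "local_object C L"
  shows "\<lbrakk>list_sum C X Ms; \<forall>M \<in> set Ms. local_object C M; r \<in> X \<leadsto> L; s \<in> L \<leadsto> X; automorphism C L (r \<cdot> s)\<rbrakk>
    \<Longrightarrow> \<exists>M \<in> set Ms. isomorphic C L M"
proof (induction Ms arbitrary: X r s)
  case Nil
  have "zero_object C X" using Nil(1) by simp
  then have "r = zmor C X L" using Nil(3) by (rule zero_object_maps)
  then have "r \<cdot> s = zmor C L L" using Nil(3,4) by simp
  then show ?case using Nil(5) local_object_facts(2)[OF L] by simp
next
  case (Cons M Ms)
  obtain T where T: "direct_sum C X [M, T]" "list_sum C T Ms" using Cons.prems(1) by auto
  obtain i p j q where b: "biprod2 C X M T i p j q" using T(1) unfolding direct_sum_two by blast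
  note B = biprod2D[OF b]
  note [simp] = B(10-)
  have LO: "L \<in> Obj C" using L by (simp add: local_object_def)
  have rt: "arr C r" "src C r = X" "tgt C r = L" "arr C s" "src C s = L" "tgt C s = X" using Cons.prems(3,4) by simp_all
  note [simp] = rt LO
  have "r \<cdot> s = r \<cdot> (i \<cdot> p \<boxplus> j \<cdot> q) \<cdot> s" unfolding B(9) by simp
  also have "\<dots> = (r \<cdot> i) \<cdot> (p \<cdot> s) \<boxplus> (r \<cdot> j) \<cdot> (q \<cdot> s)" by (simp add: ringoid_simps)
  finally have "automorphism C L ((r \<cdot> i) \<cdot> (p \<cdot> s)) \<or> automorphism C L ((r \<cdot> j) \<cdot> (q \<cdot> s))"
    using Cons.prems(5) local_object_facts(3)[OF L, of "(r \<cdot> i) \<cdot> (p \<cdot> s)" "(r \<cdot> j) \<cdot> (q \<cdot> s)"] by auto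
  then show ?case
  proof
    assume "automorphism C L ((r \<cdot> j) \<cdot> (q \<cdot> s))"
    then have "\<exists>M \<in> set Ms. isomorphic C L M"
      using Cons.prems(2) by (intro Cons.IH[OF T(2), of "r \<cdot> j" "q \<cdot> s"]) simp_all
    then show ?thesis by simp
  next
    assume "automorphism C L ((r \<cdot> i) \<cdot> (p \<cdot> s))"
    then obtain g where g: "g \<in> L \<leadsto> L" "g \<cdot> ((r \<cdot> i) \<cdot> (p \<cdot> s)) = Idn C L" using automorphismE by blast
    have M: "local_object C M" using Cons.prems(2) by simp
    define v where "v = g \<cdot> (r \<cdot> i)"
    define w where "w = p \<cdot> s"
    have v: "v \<in> M \<leadsto> L" and w: "w \<in> L \<leadsto> M" unfolding v_def w_def using g by simp_all
    have vw: "v \<cdot> w = Idn C L" unfolding v_def w_def using g by (simp add: ringoid_simps)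
    have idem: "w \<cdot> v \<in> M \<leadsto> M" "(w \<cdot> v) \<cdot> (w \<cdot> v) = w \<cdot> v"
      using v w by (simp_all add: ringoid_simps Cmp_reassoc[OF vw])
    have "w \<cdot> v = Idn C M"
    proof (cases "automorphism C M (w \<cdot> v)")
      case True
      then obtain k where "k \<in> M \<leadsto> M" "k \<cdot> (w \<cdot> v) = Idn C M" using automorphismE by blast
      then show ?thesis using idempotent_automorphism idem by blast
    next
      case False
      have t: "Idn C M \<boxplus> \<boxminus> (w \<cdot> v) \<in> M \<leadsto> M" using idem by simp
      have "Idn C M \<boxplus> \<boxminus> (w \<cdot> v) \<boxplus> w \<cdot> v = Idn C M" by (rule subtract_add_cancel) (use idem in simp_all)
      then have "automorphism C M (Idn C M \<boxplus> \<boxminus> (w \<cdot> v))"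
        using local_object_facts(3)[OF M t idem(1) _ False] local_object_facts(1)[OF M] by auto
      then obtain k where k: "k \<in> M \<leadsto> M" "k \<cdot> (Idn C M \<boxplus> \<boxminus> (w \<cdot> v)) = Idn C M" using automorphismE by blast
      have "(Idn C M \<boxplus> \<boxminus> (w \<cdot> v)) \<cdot> (w \<cdot> v) = zmor C M M"
        using v w by (simp add: ringoid_simps Cmp_reassoc[OF vw])
      then have "k \<cdot> (Idn C M \<boxplus> \<boxminus> (w \<cdot> v)) \<cdot> (w \<cdot> v) = zmor C M M"
        using k(1) t idem(1) by (subst Cmp_assoc') simp_all
      then have "w \<cdot> v = zmor C M M" unfolding k(2) using idem(1) by simp
      then have "v \<cdot> (w \<cdot> v) \<cdot> w = zmor C L L" using v w by simp
      then have "Idn C L = zmor C L L" using v w by (simp add: ringoid_simps vw Cmp_reassoc[OF vw])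
      then show ?thesis using local_object_facts(1,2)[OF L] by simp
    qed
    then have "isomorphic C L M" using isomorphicI[OF w v vw] by simp
    then show ?thesis by simp
  qed
qed

lemma indecomposable_iso:
  assumes "indecomposable St X" "isomorphic St X Y" "Y \<in> Obj C" shows "indecomposable St Y"
proof -
  have X: "X \<in> Obj C" using assms(1) by (simp add: indecomposable_def)
  have i: "isomorphic St Y X" using stable_iso_sym assms(2,3) X by blast
  have "\<not> zero_object St Y" using assms(1) st.zero_object_iso[OF _ i] X unfolding indecomposable_def by auto
  moreover have "zero_object St A \<or> zero_object St B" if "direct_sum St Y [A, B]" for A B
    using st.direct_sum_iso[OF that i] X assms(1) unfolding indecomposable_def by simp
  ultimately show ?thesis using assms(3) unfolding indecomposable_def by simp
qed

lemma indecomposable_local: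
  "\<lbrakk>list_sum C X Ls; indecomposable St X\<rbrakk> \<Longrightarrow> \<exists>L \<in> set Ls. L \<notin> projectives C E \<and> isomorphic St X L"
proof (induction Ls arbitrary: X)
  case Nil
  then show ?case using zero_object_projective projective_iff_zero unfolding indecomposable_def by simp
next
  case (Cons L Ls)
  obtain T where T: "direct_sum C X [L, T]" "list_sum C T Ls" using Cons.prems(1) by auto
  have d: "direct_sum St X [L, T]" by (rule direct_sum_St[OF T(1)])
  have "zero_object St L \<or> zero_object St T" using Cons.prems(2) d unfolding indecomposable_def by blast
  then show ?case
  proof
    assume "zero_object St L"
    then have i: "isomorphic St X T" by (rule st.direct_sum_zero_iso[OF st.direct_sum_sym[OF d]])
    have o: "X \<in> Obj C" "T \<in> Obj C" using direct_sum_Obj[OF T(1)] by simp_all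
    obtain M where M: "M \<in> set Ls" "M \<notin> projectives C E" "isomorphic St T M"
      using Cons.IH[OF T(2) indecomposable_iso[OF Cons.prems(2) i o(2)]] by blast
    have "M \<in> Obj C" using M(1) list_sum_Obj[OF T(2)] by blast
    then have "isomorphic St X M" using stable_iso_trans[OF i M(3)] o by blast
    then show ?thesis using M by auto
  next
    assume "zero_object St T"
    then have i: "isomorphic St X L" by (rule st.direct_sum_zero_iso[OF d])
    have "X \<notin> projectives C E" using Cons.prems(2) projective_iff_zero unfolding indecomposable_def by blast
    then have "L \<notin> projectives C E"
      using projective_change[OF stable_iso_sym[OF i]] direct_sum_Obj[OF T(1)] by blast
    then show ?thesis using i by auto
  qed
qed

abbreviation span_generators :: "'o \<Rightarrow> ('o set \<Rightarrow>\<^sub>0 int) set set" where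
  "span_generators M \<equiv> kc ` {N. indecomposable St N \<and> direct_summand St N M}"

text \<open>An indecomposable object of the stable category is stably isomorphic to a single local summand of itself, and
if it is a stable summand of \<open>M\<close>, then to one of the finitely many local summands of \<open>M\<close>.\<close>

lemma finite_span_generators: assumes M: "M \<in> Obj C" shows "finite (span_generators M)" "span_generators M \<subseteq> carrier KG"
proof -
  show "span_generators M \<subseteq> carrier KG" by (auto simp: indecomposable_def)
  obtain Ms where Ms: "list_sum C M Ms" "\<forall>L \<in> set Ms. local_object C L"
    using krull_schmidt_list_sum[OF fitting krull_schmidt M] .
  have "span_generators M \<subseteq> kc ` set Ms"
  proof
    fix x assume "x \<in> span_generators M"
    then obtain N where N: "indecomposable St N" "direct_summand St N M" "x = kc N" by blast
    have NO: "N \<in> Obj C" using N(1) by (simp add: indecomposable_def)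
    obtain Ns where Ns: "list_sum C N Ns" "\<forall>L \<in> set Ns. local_object C L"
      using krull_schmidt_list_sum[OF fitting krull_schmidt NO] .
    obtain L where L: "L \<in> set Ns" "L \<notin> projectives C E" "isomorphic St N L"
      using indecomposable_local[OF Ns(1) N(1)] by blast
    have lL: "local_object C L" and LO: "L \<in> Obj C" using L(1) Ns(2) by (auto simp: local_object_def)
    have "retract St N M" using N(2) st.direct_sum_retract unfolding st.direct_summand_iff by blast
    moreover have "retract St L N"
      by (rule st.isomorphic_retract[OF stable_iso_sym[OF L(3)]]) (use NO LO in simp_all)
    ultimately have "retract St L M" using st.retract_trans by blast
    then obtain F G where F: "F \<in> L \<leadsto>\<^bsub>St\<^esub> M" "G \<in> M \<leadsto>\<^bsub>St\<^esub> L" "G \<cdot>\<^bsub>St\<^esub> F = Idn St L" unfolding retract_def by blast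
    obtain s where s: "s \<in> L \<leadsto> M" "F = cls s" using st_arrowsE[OF F(1)] .
    obtain r where r: "r \<in> M \<leadsto> L" "G = cls r" using st_arrowsE[OF F(2)] .
    have "cls (r \<cdot> s \<boxplus> zmor C L L) = Idn St L" using F(3) s r by (simp add: cls_Cmp)
    then have "automorphism C L (r \<cdot> s) \<or> automorphism C L (zmor C L L)"
      by (intro local_stable_sum[OF lL L(2)]) (use s(1) r(1) in simp_all)
    then have "automorphism C L (r \<cdot> s)" using local_object_facts(2)[OF lL] by blast
    then obtain M' where M': "M' \<in> set Ms" "isomorphic C L M'"
      using local_summand_isomorphic[OF lL Ms(1,2) r(1) s(1)] by blast
    have M'O: "M' \<in> Obj C" using M'(1) list_sum_Obj[OF Ms(1)] by blast
    have "kc N = kc L" by (rule stably_isomorphic_kc[OF NO LO L(3)])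
    also have "\<dots> = kc M'" by (rule stably_isomorphic_kc[OF LO M'O isomorphic_St[OF M'(2) LO M'O]])
    finally show "x \<in> kc ` set Ms" using N(3) M'(1) by blast
  qed
  then show "finite (span_generators M)" using finite_subset by blast
qed

lemma summand_in_span:
  assumes M: "M \<in> Obj C"
  shows "\<lbrakk>list_sum C V Ls; \<forall>L \<in> set Ls. local_object C L; retract C V M\<rbrakk> \<Longrightarrow> kc V \<in> K_span C E M"
proof (induction Ls arbitrary: V)
  case Nil
  then have "kc V = \<one>\<^bsub>KG\<^esub>" using kc_projective zero_object_projective by simp
  then show ?case unfolding K_span_def using generate.one by metis
next
  case (Cons L Ls)
  obtain T where T: "direct_sum C V [L, T]" "list_sum C T Ls" using Cons.prems(1) by auto
  have LO: "L \<in> Obj C" using direct_sum_Obj[OF T(1)] by blast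
  have rL: "retract C L M" "retract C T M"
    using retract_trans[OF _ Cons.prems(3)] direct_sum_retract T(1) direct_sum_sym by blast+
  have "kc L \<in> K_span C E M"
  proof (cases "L \<in> projectives C E")
    case True then show ?thesis unfolding K_span_def using kc_projective generate.one by metis
  next
    case False
    then have "indecomposable St L" using local_indecomposable Cons.prems(2) by simp
    moreover have "direct_summand St L M"
      using retract_direct_summand[OF fitting rL(1)] direct_sum_St unfolding direct_summand_def by blast
    ultimately show ?thesis unfolding K_span_def by (intro generate.incl) blast
  qed
  moreover have "kc T \<in> K_span C E M" using Cons.IH[OF T(2) _ rL(2)] Cons.prems(2) by simp
  ultimately show ?case unfolding kc_direct_sum[OF T(1)] K_span_def by (rule generate.eng)
qed

text \<open>The minimum defining \<open>\<Phi>\<close> is taken over a nonempty set.\<close>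

lemma IT_Phi_iso:
  assumes M: "M \<in> Obj C" and m: "m \<ge> IT_Phi C E M"
  shows "K_syzygy C E \<in> iso (KG\<lparr>carrier := (K_syzygy C E ^^ m) ` K_span C E M\<rparr>)
         (KG\<lparr>carrier := (K_syzygy C E ^^ Suc m) ` K_span C E M\<rparr>)"
proof -
  have "\<exists>k. \<forall>m \<ge> k. K_syzygy C E \<in> iso (KG\<lparr>carrier := (K_syzygy C E ^^ m) ` K_span C E M\<rparr>)
         (KG\<lparr>carrier := (K_syzygy C E ^^ Suc m) ` K_span C E M\<rparr>)"
    unfolding K_span_def
    by (rule comm_group.endomorphism_eventually_iso[OF KG_comm_group finite_span_generators[OF M]]) (use K_syzygy_hom in blast)
  from LeastI_ex[OF this] show ?thesis using m unfolding IT_Phi_def by blast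
qed

lemma IT_Phi_inj:
  assumes M: "M \<in> Obj C" and m: "m \<ge> IT_Phi C E M" and x: "x \<in> K_span C E M" "y \<in> K_span C E M"
    and e: "(K_syzygy C E ^^ m) x = (K_syzygy C E ^^ m) y"
  shows "(K_syzygy C E ^^ IT_Phi C E M) x = (K_syzygy C E ^^ IT_Phi C E M) y"
  using m e
proof (induction m rule: dec_induct)
  case (step m)
  have "inj_on (K_syzygy C E) ((K_syzygy C E ^^ m) ` K_span C E M)"
    using IT_Phi_iso[OF M step.hyps(1)] by (simp add: iso_def bij_betw_def)
  then have "(K_syzygy C E ^^ m) x = (K_syzygy C E ^^ m) y"
    using step.prems x by (auto dest: inj_onD)
  then show ?case by (rule step.IH)
qed simp

text \<open>What \<open>\<Phi>\<close> is for: if two summands of \<open>V\<close> have stably isomorphic syzygies in some degree, they have so in degree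
\<open>\<Phi>(V)\<close>.\<close>

lemma Phi_stable_iso:
  assumes d: "direct_sum C V [A, B]" and m: "isomorphic St ((syzygy C E ^^ m) A) ((syzygy C E ^^ m) B)"
  shows "isomorphic St ((syzygy C E ^^ IT_Phi C E V) A) ((syzygy C E ^^ IT_Phi C E V) B)"
proof -
  have o: "V \<in> Obj C" "A \<in> Obj C" "B \<in> Obj C" using direct_sum_Obj[OF d] by simp_all
  let ?L = "K_syzygy C E" and ?n = "max m (IT_Phi C E V)"
  have span: "kc X \<in> K_span C E V" if "retract C X V" "X \<in> Obj C" for X
    using krull_schmidt_list_sum[OF fitting krull_schmidt that(2)] summand_in_span[OF o(1) _ _ that(1)] by metis
  have A: "kc A \<in> K_span C E V" using span direct_sum_retract[OF d] o by blast
  have B: "kc B \<in> K_span C E V" using span direct_sum_retract[OF direct_sum_sym[OF d]] o by blast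
  have eq: "(?L ^^ l) (kc A) = (?L ^^ l) (kc B)" if "l \<ge> m" for l
    using that
  proof (induction l rule: dec_induct)
    case base
    show ?case unfolding K_syzygy_pow[OF o(2)] K_syzygy_pow[OF o(3)] by (rule stably_isomorphic_kc[OF _ _ m]) (use o in simp_all)
  qed simp
  have "(?L ^^ IT_Phi C E V) (kc A) = (?L ^^ IT_Phi C E V) (kc B)"
    by (rule IT_Phi_inj[OF o(1) _ A B eq[of ?n]]) simp_all
  then show ?thesis unfolding K_syzygy_pow[OF o(2)] K_syzygy_pow[OF o(3)]
    by (intro kc_stably_isomorphic) (use o in simp_all)
qed

end

section \<open>The Igusa--Todorov inequality\<close>

context fitting_IT_context
begin

text \<open>The inequality \<open>pd D \<le> \<Psi>(A \<oplus> B) + 1\<close>. The summand \<open>Y\<close> provided by \<open>stably_equal_terms\<close> belongs to a stable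
replacement of \<open>\<Omega>\<^sup>d A\<close>; to compare it with the finitistic dimension of \<open>add(\<Omega>\<^sup>d V)\<close> it is exchanged for a stably
isomorphic summand of the chosen syzygy itself.\<close>

lemma Igusa_Todorov_bound:
  assumes t: "triangle A B D" and V: "direct_sum C V [A, B]" and D: "D \<in> pdim_le C E r"
    and f: "fpd C E (add_closure C ((syzygy C E ^^ IT_Phi C E V) V)) = enat q"
  shows "D \<in> pdim_le C E (IT_Phi C E V + q + 1)"
proof -
  let ?d = "IT_Phi C E V" and ?\<Omega> = "\<lambda>k. syzygy C E ^^ k"
  have o: "A \<in> Obj C" "B \<in> Obj C" "D \<in> Obj C" using triangle_Obj[OF t] by simp_all
  have VO: "V \<in> Obj C" using direct_sum_Obj[OF V] by blast
  let ?W = "?\<Omega> ?d V"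
  have "?\<Omega> r D \<in> projectives C E" using pdim_le_syzygy_pow[OF o(3), of r 0] D by simp
  then have "isomorphic St (?\<Omega> r A) (?\<Omega> r B)" by (rule triangle_projective[OF triangle_syzygy_pow[OF t]])
  then have AB: "isomorphic St (?\<Omega> ?d A) (?\<Omega> ?d B)" by (rule Phi_stable_iso[OF V])
  have "?\<Omega> ?d D \<in> pdim_le C E r" using pdim_le_syzygy_pow[OF o(3), of ?d r] pdim_le_mono[OF _ D, of "?d + r"] by simp
  then obtain X Y where X: "isomorphic St X (?\<Omega> ?d A)" "X \<in> Obj C" and Y: "direct_summand C Y X" "Y \<in> pdim_le C E r"
    and bound: "\<And>l. Y \<in> pdim_le C E l \<Longrightarrow> ?\<Omega> ?d D \<in> pdim_le C E (Suc l)"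
    using stably_equal_terms[OF fitting triangle_syzygy_pow[OF t] AB] by metis
  have YO: "Y \<in> Obj C" using pdim_le_Obj[OF Y(2)] .
  have dsum: "direct_sum St (?\<Omega> k V) [?\<Omega> k A, ?\<Omega> k B]" for k
  proof (induction k)
    case 0 show ?case using direct_sum_St[OF V] by simp
  next
    case (Suc k)
    show ?case using syzygy_direct_sum[OF syzygy_is_syzygy syzygy_is_syzygy syzygy_is_syzygy Suc] VO o by simp
  qed
  have "retract St Y X" using direct_sum_St direct_sum_retract st.direct_sum_retract Y(1) unfolding direct_summand_iff by blast
  moreover have "retract St X (?\<Omega> ?d A)" by (rule st.isomorphic_retract[OF X(1)]) (use X(2) o in simp_all)
  moreover have "retract St (?\<Omega> ?d A) ?W" by (rule st.direct_sum_retract[OF dsum])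
  ultimately have "retract St Y ?W" using st.retract_trans by blast
  then obtain Y' where Y': "direct_summand C Y' ?W" "isomorphic St Y' Y" using stable_summand_lift[OF fitting] by blast
  have Y'O: "Y' \<in> Obj C" using Y'(1) direct_sum_Obj unfolding direct_summand_iff by blast
  have "Y' \<in> add_closure C ?W"
  proof -
    have "direct_sum C ?W [?W]"
    proof -
      have W: "?W \<in> Obj C" using VO by simp
      interpret comm_group "Hom C ?W ?W" by (rule Hom_comm_group[OF W W])
      have "biproduct C ?W [?W] (\<lambda>_. Idn C ?W) (\<lambda>_. Idn C ?W)"
        unfolding biproduct_def using W by (simp add: mor_iff Pi_iff lessThan_Suc)
      then show ?thesis unfolding direct_sum_def by blast
    qed
    then have "direct_sum C ?W (replicate 1 ?W)" by simp
    then show ?thesis unfolding add_closure_def using Y'(1) by blast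
  qed
  moreover have "pd C E Y' < \<infinity>" using pd_finite_iff[OF Y'O] pdim_le_iso[OF Y(2) Y'(2) Y'O] by blast
  ultimately have "pd C E Y' \<le> enat q" unfolding f[symmetric] fpd_def by (intro Sup_upper) blast
  then have "Y' \<in> pdim_le C E q" using pd_le_iff[OF Y'O] by simp
  then have "Y \<in> pdim_le C E q" using pdim_le_iso_iff[OF Y'(2) Y'O YO] by blast
  then have "?\<Omega> ?d D \<in> pdim_le C E (Suc q)" by (rule bound)
  then show ?thesis using pdim_le_syzygy_pow[OF o(3), of ?d "Suc q"] by simp
qed

end

theorem theorem6p3:
  fixes C :: "('o, 'm) precategory" and E' E :: "('m \<times> 'm) set" and n :: nat
  assumes "n_IT_category C E' E n"
  shows "fpd C E (Obj C) \<le> enat n + 1 + IT_Psi_dim C E (projectives C E') \<and>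
    enat n + 1 + IT_Psi_dim C E (projectives C E') < \<infinity>"
proof -
  interpret n_IT_category C E' E n by (rule assms)
  interpret fitting_IT_context C E by unfold_locales (rule fitting)
  obtain b where b: "IT_Psi_dim C E (projectives C E') = enat b" using IT_Psi_dim_finite by auto
  have bound: "pd C E M \<le> enat (n + 1 + b)" if M: "M \<in> Obj C" and fin: "pd C E M < \<infinity>" for M
  proof -
    let ?N = "(syzygy C E ^^ n) M"
    have N: "?N \<in> Obj C" using M by simp
    obtain k where k: "M \<in> pdim_le C E k" using fin E.pd_finite_iff[OF M] by blast
    then have "M \<in> pdim_le C E (n + k)" by (rule E.pdim_le_mono[rotated]) simp
    then have Nk: "?N \<in> pdim_le C E k" using E.pdim_le_syzygy_pow[OF M] by blast
    obtain V1 V0 P S i p where V: "V1 \<in> projectives C E'" "V0 \<in> projectives C E'" and P: "P \<in> projectives C E"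
      and S: "direct_sum C S [?N, P]" and s: "ses C E V1 i V0 p S" using syzygy_presentation[OF M] by blast
    have SN: "isomorphic (stable_category C E) S ?N" by (rule E.direct_sum_projective_iso[OF S P])
    have SO: "S \<in> Obj C" using E'.direct_sum_Obj[OF S] by blast
    have Sk: "S \<in> pdim_le C E k" by (rule E.pdim_le_iso[OF Nk SN SO])
    obtain W where W: "direct_sum C W [V1, V0]" using E'.ex_direct_sum E'.projective_Obj V by blast
    have "W \<in> projectives C E'" by (rule E'.projective_direct_sum[OF W V])
    then have "IT_Psi C E W \<le> enat b" unfolding b[symmetric] IT_Psi_dim_def by (rule SUP_upper)
    then have psi: "enat (IT_Phi C E W) + fpd C E (add_closure C ((syzygy C E ^^ IT_Phi C E W) W)) \<le> enat b"
      unfolding IT_Psi_def .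
    then obtain q where q: "fpd C E (add_closure C ((syzygy C E ^^ IT_Phi C E W) W)) = enat q"
      by (cases "fpd C E (add_closure C ((syzygy C E ^^ IT_Phi C E W) W))") auto
    have le: "IT_Phi C E W + q \<le> b" using psi unfolding q by simp
    have "S \<in> pdim_le C E (IT_Phi C E W + q + 1)" by (rule Igusa_Todorov_bound[OF E.ses_triangle[OF s] W Sk q])
    then have "S \<in> pdim_le C E (1 + b)" by (rule E.pdim_le_mono[rotated]) (use le in simp)
    then have "?N \<in> pdim_le C E (1 + b)" using E.pdim_le_iso_iff[OF SN SO N] by blast
    then have "M \<in> pdim_le C E (n + (1 + b))" using E.pdim_le_syzygy_pow[OF M] by blast
    then show ?thesis using E.pd_le_iff[OF M] by (simp add: add.assoc)
  qed
  have "fpd C E (Obj C) \<le> enat (n + 1 + b)" unfolding fpd_def by (rule Sup_least) (use bound in blast)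
  then show ?thesis unfolding b by (simp add: one_enat_def)
qed

end
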